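(* Let $g\ge 2$ be an integer. The locus in ${\mathcal H}_{g}$ consisting of those hyperelliptic Riemann surfaces admitting more conformal automorphisms than the hyperelliptic one (i.e. than the group generated by the hyperelliptic involution) is connected if $2g+1$ is divisible by $3$, and it has exactly two connected components otherwise. The real locus in ${\mathcal H}_{g}$ is connected.
   Context: ${\mathcal H}_g$ denotes the moduli space of hyperelliptic Riemann surfaces of genus $g$. It is identified with the moduli space ${\mathcal M}_{0,[2g+2]}$ of unordered sets of $2g+2$ pairwise distinct points of the Riemann sphere $\widehat{\mathbb C}$ modulo Möbius transformations, a hyperelliptic surface corresponding to the set of branch values of its hyperelliptic quotient map, and it carries the corresponding topology (the quotient topology from the configuration space of ordered $(2g+2)$-tuples of distinct points). Under this identification the surfaces with more conformal automorphisms than those generated by the hyperelliptic involution correspond to the sets of points invariant under some non-identity Möbius transformation. The real locus in ${\mathcal H}_g$ is the locus corresponding to the classes of sets of $2g+2$ points that are invariant under some anticonformal involution of $\widehat{\mathbb C}$. *)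

theory Defs
  imports "HOL-Analysis.Analysis"
begin

section \<open>The Riemann sphere and its conformal and anticonformal maps\<close>

text \<open>The Riemann sphere is the one-point compactification of the complex plane:
  \<^term>\<open>None\<close> is the point at infinity.\<close>

definition riemann_sphere :: "complex option topology" where
  "riemann_sphere = Alexandroff_compactification euclidean"

definition moebius_map :: "complex \<Rightarrow> complex \<Rightarrow> complex \<Rightarrow> complex \<Rightarrow> complex option \<Rightarrow> complex option"
  where
  "moebius_map a b c d p =
     (case p of
        None \<Rightarrow> if c = 0 then None else Some (a / c)
      | Some z \<Rightarrow> if c * z + d = 0 then None else Some ((a * z + b) / (c * z + d)))"

definition moebius_transformations :: "(complex option \<Rightarrow> complex option) set" where
  "moebius_transformations = {moebius_map a b c d | a b c d. a * d - b * c \<noteq> 0}"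

text \<open>The two standard charts of the sphere are \<open>z\<close> and \<open>1/z\<close>; each is given here as a map of the
  sphere to itself, the chart being defined where the value is not \<^term>\<open>None\<close>. Both are their own
  inverses.\<close>

definition sphere_charts :: "(complex option \<Rightarrow> complex option) set" where
  "sphere_charts = {id, moebius_map 0 1 1 0}"

definition conformal_sphere_map :: "(complex option \<Rightarrow> complex option) \<Rightarrow> bool" where
  "conformal_sphere_map f \<longleftrightarrow>
     homeomorphic_map riemann_sphere riemann_sphere f \<and>
     (\<forall>\<phi>\<in>sphere_charts. \<forall>\<psi>\<in>sphere_charts.
        (\<lambda>z. the (\<psi> (f (\<phi> (Some z))))) holomorphic_on {z. \<psi> (f (\<phi> (Some z))) \<noteq> None})"

definition anticonformal_sphere_map :: "(complex option \<Rightarrow> complex option) \<Rightarrow> bool" where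
  "anticonformal_sphere_map f \<longleftrightarrow> conformal_sphere_map (f \<circ> map_option cnj)"

text \<open>An anticonformal map reverses orientation, so it is never the identity.\<close>

definition anticonformal_involution :: "(complex option \<Rightarrow> complex option) \<Rightarrow> bool" where
  "anticonformal_involution f \<longleftrightarrow> anticonformal_sphere_map f \<and> f \<circ> f = id"

section \<open>Moduli of unordered point sets on the sphere\<close>

definition quotient_topology :: "'a topology \<Rightarrow> ('a \<Rightarrow> 'b) \<Rightarrow> 'b topology" where
  "quotient_topology X f =
     topology (\<lambda>U. U \<subseteq> f ` topspace X \<and> openin X {x \<in> topspace X. f x \<in> U})"

lemma openin_quotient_topology:
  "openin (quotient_topology X f) U \<longleftrightarrow>
     U \<subseteq> f ` topspace X \<and> openin X {x \<in> topspace X. f x \<in> U}"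
proof -
  have "istopology (\<lambda>U. U \<subseteq> f ` topspace X \<and> openin X {x \<in> topspace X. f x \<in> U})"
    unfolding istopology_def
  proof (intro conjI allI impI; (elim conjE)?)
    fix S T
    assume "openin X {x \<in> topspace X. f x \<in> S}" "openin X {x \<in> topspace X. f x \<in> T}"
    moreover have "{x \<in> topspace X. f x \<in> S \<inter> T} =
        {x \<in> topspace X. f x \<in> S} \<inter> {x \<in> topspace X. f x \<in> T}"
      by blast
    ultimately show "openin X {x \<in> topspace X. f x \<in> S \<inter> T}"
      by (simp add: openin_Int)
  next
    fix K
    assume K: "\<forall>S\<in>K. S \<subseteq> f ` topspace X \<and> openin X {x \<in> topspace X. f x \<in> S}"
    have eq: "{x \<in> topspace X. f x \<in> \<Union>K} = (\<Union>S\<in>K. {x \<in> topspace X. f x \<in> S})"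
      by blast
    show "openin X {x \<in> topspace X. f x \<in> \<Union>K}"
      unfolding eq using K by (intro openin_Union) auto
  qed auto
  then show ?thesis
    by (simp add: quotient_topology_def topology_inverse')
qed

lemma topspace_quotient_topology [simp]: "topspace (quotient_topology X f) = f ` topspace X"
proof -
  have "{x \<in> topspace X. f x \<in> f ` topspace X} = topspace X"
    by blast
  then have "openin (quotient_topology X f) (f ` topspace X)"
    by (simp add: openin_quotient_topology)
  then show ?thesis
    by (meson openin_quotient_topology openin_subset openin_topspace subset_antisym)
qed

lemma quotient_map_quotient_topology: "quotient_map X (quotient_topology X f) f"
  by (auto simp: quotient_map_def openin_quotient_topology)

definition configuration_space :: "nat \<Rightarrow> (nat \<Rightarrow> complex option) topology" where
  "configuration_space n =
     subtopology (product_topology (\<lambda>_. riemann_sphere) {..<n}) {x. inj_on x {..<n}}"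

definition moduli_class :: "complex option set \<Rightarrow> complex option set set" where
  "moduli_class A = (\<lambda>M. M ` A) ` moebius_transformations"

definition moduli_unordered :: "nat \<Rightarrow> complex option set set topology" where
  "moduli_unordered n =
     quotient_topology (configuration_space n) (\<lambda>x. moduli_class (x ` {..<n}))"

section \<open>The hyperelliptic moduli space\<close>

text \<open>A hyperelliptic Riemann surface of genus \<open>g\<close> is represented by the Moebius class of the set of
  the \<open>2 g + 2\<close> branch values of its hyperelliptic quotient map. It has more conformal automorphisms
  than those generated by the hyperelliptic involution iff some non-identity Moebius transformation
  preserves the branch values.\<close>

definition hyperelliptic_moduli :: "nat \<Rightarrow> complex option set set topology" where
  "hyperelliptic_moduli g = moduli_unordered (2 * g + 2)"

definition extra_automorphism_locus :: "nat \<Rightarrow> complex option set set set" where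
  "extra_automorphism_locus g =
     {moduli_class A | A. card A = 2 * g + 2 \<and>
        (\<exists>M\<in>moebius_transformations. M \<noteq> id \<and> M ` A = A)}"

definition real_locus :: "nat \<Rightarrow> complex option set set set" where
  "real_locus g =
     {moduli_class A | A. card A = 2 * g + 2 \<and> (\<exists>T. anticonformal_involution T \<and> T ` A = A)}"

end

theory Submission
  imports Defs "HOL-Complex_Analysis.Complex_Analysis"
    "HOL-Computational_Algebra.Fundamental_Theorem_Algebra"
begin

text \<open>A Moebius transformation permuting a finite set of at least three points has finite order, hence is
conjugate to a rotation \<open>z \<mapsto> w z\<close>, whose fixed points are the two poles \<open>0\<close> and \<open>\<infinity>\<close>. The invariant set
consists of full orbits of the rotation together with \<open>e \<in> {0, 1, 2}\<close> poles, and the classes with a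
given \<open>e\<close> form the set \<open>symmetric_classes n e\<close>, where \<open>n = 2 g + 2\<close>. Each of these three sets is connected:
a base point in every orbit can be moved freely, and all sets of that shape are joined, whatever the
order of the rotation is, to the same set, the regular \<open>(n - e)\<close>-gon together with \<open>e\<close> poles
(\<open>symmetric_class_connected_to_polygon\<close>). The main tool for moving points is the family
\<open>u + t (v - u)\<close> with a complex parameter \<open>t\<close>: coincidences occur for finitely many \<open>t\<close> only, and
removing finitely many points from the plane leaves it connected.

As \<open>n\<close> is even, the inversion \<open>1/z\<close> preserves the regular \<open>n\<close>-gon and fixes its vertices \<open>1\<close> and \<open>-1\<close>,
so the families \<open>e = 0\<close> and \<open>e = 2\<close> meet. If 3 divides \<open>n - 1\<close>, some set invariant under
the tetrahedral group contains exactly one fixed point of a rotation of order 3, and such a set also has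
symmetries of order 2; so the family \<open>e = 1\<close> meets the others (\<open>tetrahedral_configuration\<close>) and the locus
is connected.

If 3 does not divide \<open>n - 1\<close>, the union of the families \<open>e = 0, 2\<close> and the family \<open>e = 1\<close> are the
components. Both are closed, because a prescribed permutation of the points is induced by a
Moebius transformation on a closed set of configurations (\<open>closedin_symmetric_classes\<close>). They are
disjoint by a count in the finite symmetry group of a set: the stabilizer of a fixed point \<open>p\<close> that is
the only one of its axis in the set has order dividing the odd number \<open>n - 1\<close>, thus at least 5, and
the other pole of the axis is not in the orbit of \<open>p\<close>. As in the classification of the finite rotation
groups, so large a stabilizer must be the whole group, so every symmetry has exactly one fixed point
in the set (\<open>one_fixed_point_exclusive\<close>).

An anticonformal involution is, after a change of coordinate, complex conjugation or the antipodal map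
\<open>-1/cnj z\<close>. The sets invariant under conjugation with a given number of points on the real circle
form a connected family, and so do the sets invariant under the antipodal map, again by moving points
along complex lines. Families with different numbers of real points are linked by
sets symmetric with respect to two perpendicular circles, and the antipodal family contains sets of real
points (\<open>real_locus_connected\<close>).\<close>

section \<open>Moebius transformations\<close>

abbreviation Moeb :: "(complex option \<Rightarrow> complex option) set" where
  "Moeb \<equiv> moebius_transformations"

text \<open>The point with homogeneous coordinates \<open>(u : v)\<close>. In these coordinates a Moebius map is linear, which
avoids the case distinctions at infinity.\<close>
definition homog :: "complex \<Rightarrow> complex \<Rightarrow> complex option" where
  "homog u v = (if v = 0 then None else Some (u / v))"

lemma homog_cases:
  obtains u v where "p = homog u v" "(u, v) \<noteq> (0, 0)"
proof (cases p)
  case None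
  then show ?thesis using that[of 1 0] by (simp add: homog_def)
next
  case (Some z)
  then show ?thesis using that[of z 1] by (simp add: homog_def)
qed

lemma moebius_map_homog:
  assumes "(u, v) \<noteq> (0, 0)"
  shows "moebius_map a b c d (homog u v) = homog (a * u + b * v) (c * u + d * v)"
  using assms by (auto simp: homog_def moebius_map_def divide_simps)

lemma nonsingular_apply:
  fixes a b c d :: complex
  assumes "a * d - b * c \<noteq> 0" "(u, v) \<noteq> (0, 0)"
  shows "(a * u + b * v, c * u + d * v) \<noteq> (0, 0)"
proof
  assume *: "(a * u + b * v, c * u + d * v) = (0, 0)"
  have "(a * d - b * c) * u = d * (a * u + b * v) - b * (c * u + d * v)"
       "(a * d - b * c) * v = a * (c * u + d * v) - c * (a * u + b * v)"
    by (simp_all add: algebra_simps)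
  with * assms show False by auto
qed

lemma moebius_map_comp:
  assumes "a' * d' - b' * c' \<noteq> 0"
  shows "moebius_map a b c d \<circ> moebius_map a' b' c' d' =
    moebius_map (a * a' + b * c') (a * b' + b * d') (c * a' + d * c') (c * b' + d * d')"
proof
  fix p
  obtain u v where p: "p = homog u v" "(u, v) \<noteq> (0, 0)"
    by (rule homog_cases)
  show "(moebius_map a b c d \<circ> moebius_map a' b' c' d') p =
    moebius_map (a * a' + b * c') (a * b' + b * d') (c * a' + d * c') (c * b' + d * d') p"
    using moebius_map_homog[OF p(2)] moebius_map_homog[OF nonsingular_apply[OF assms p(2)]]
    by (simp add: p(1) algebra_simps)
qed

lemma MoebI: "a * d - b * c \<noteq> 0 \<Longrightarrow> moebius_map a b c d \<in> Moeb"
  by (auto simp: moebius_transformations_def)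

lemma MoebE:
  assumes "M \<in> Moeb"
  obtains a b c d where "M = moebius_map a b c d" "a * d - b * c \<noteq> 0"
  using assms by (auto simp: moebius_transformations_def)

lemma moebius_map_id: "a \<noteq> 0 \<Longrightarrow> moebius_map a 0 0 a = id"
  by (auto simp: moebius_map_def fun_eq_iff split: option.splits)

lemma Moeb_id [simp]: "id \<in> Moeb"
  using MoebI[of 1 1 0 0] moebius_map_id[of 1] by simp

lemma Moeb_comp: "M \<in> Moeb \<Longrightarrow> N \<in> Moeb \<Longrightarrow> M \<circ> N \<in> Moeb"
proof (elim MoebE)
  fix a b c d a' b' c' d'
  assume *: "M = moebius_map a b c d" "a * d - b * c \<noteq> 0"
    "N = moebius_map a' b' c' d'" "a' * d' - b' * c' \<noteq> 0"
  have "(a * a' + b * c') * (c * b' + d * d') - (a * b' + b * d') * (c * a' + d * c')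
     = (a * d - b * c) * (a' * d' - b' * c')"
    by (simp add: algebra_simps)
  with * show "M \<circ> N \<in> Moeb"
    by (simp add: moebius_map_comp MoebI)
qed

lemma Moeb_inverse:
  assumes "M \<in> Moeb"
  obtains N where "N \<in> Moeb" "M \<circ> N = id" "N \<circ> M = id"
proof -
  from assms obtain a b c d where M: "M = moebius_map a b c d" "a * d - b * c \<noteq> 0"
    by (rule MoebE)
  have det: "d * a - (- b) * (- c) \<noteq> 0" using M(2) by (simp add: algebra_simps)
  show ?thesis
  proof
    show "moebius_map d (-b) (-c) a \<in> Moeb" using det by (rule MoebI)
    show "M \<circ> moebius_map d (-b) (-c) a = id" "moebius_map d (-b) (-c) a \<circ> M = id"
      using moebius_map_comp[OF det, of a b c d] moebius_map_comp[OF M(2), of d "-b" "-c" a]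
        moebius_map_id[OF M(2)]
      by (simp_all add: M(1) algebra_simps)
  qed
qed

lemma Moeb_bij: "M \<in> Moeb \<Longrightarrow> bij M"
  by (erule Moeb_inverse) (rule o_bij)

lemma Moeb_inj: "M \<in> Moeb \<Longrightarrow> inj M"
  using Moeb_bij bij_is_inj by blast

lemma Moeb_inv: "M \<in> Moeb \<Longrightarrow> inv M \<in> Moeb"
  by (metis Moeb_inverse inv_unique_comp)

lemma Moeb_inv_comp [simp]:
  "M \<in> Moeb \<Longrightarrow> M \<circ> inv M = id" "M \<in> Moeb \<Longrightarrow> inv M \<circ> M = id"
  "M \<in> Moeb \<Longrightarrow> M (inv M x) = x" "M \<in> Moeb \<Longrightarrow> inv M (M x) = x"
  by (metis Moeb_inverse inv_unique_comp, metis Moeb_inverse inv_unique_comp,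
      simp add: Moeb_bij bij_is_surj surj_f_inv_f, simp add: Moeb_inj inv_f_f)

lemma Moeb_funpow: "M \<in> Moeb \<Longrightarrow> M ^^ k \<in> Moeb"
  by (induction k) (auto simp: Moeb_comp)

lemma moebius_map_affine: "moebius_map a b 0 1 (Some z) = Some (a * z + b)"
  "moebius_map a b 0 1 None = None"
  by (auto simp: moebius_map_def)

lemma Moeb_fix_None:
  assumes "M \<in> Moeb" "M None = None"
  obtains a b where "a \<noteq> 0" "M = moebius_map a b 0 1"
proof -
  from assms(1) obtain a b c d where M: "M = moebius_map a b c d" "a * d - b * c \<noteq> 0"
    by (rule MoebE)
  with assms(2) have "c = 0" by (auto simp: moebius_map_def split: if_splits)
  with M have "M = moebius_map (a / d) (b / d) 0 1" "a / d \<noteq> 0"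
    by (auto simp: moebius_map_def fun_eq_iff field_simps split: option.splits)
  then show ?thesis using that by blast
qed

lemma Moeb_fix_None_0:
  assumes "M \<in> Moeb" "M None = None" "M (Some 0) = Some 0"
  obtains a where "a \<noteq> 0" "M = moebius_map a 0 0 1"
  using Moeb_fix_None[OF assms(1,2)] assms(3) by (metis add_0 moebius_map_affine(1) mult_zero_right option.inject)

lemma Moeb_to_None_0:
  assumes "p \<noteq> q"
  obtains N where "N \<in> Moeb" "N p = None" "N q = Some 0"
proof -
  obtain u v where p: "p = homog u v" "(u, v) \<noteq> (0, 0)" by (rule homog_cases)
  obtain s t where q: "q = homog s t" "(s, t) \<noteq> (0, 0)" by (rule homog_cases)
  have det: "t * (-u) - (-s) * v \<noteq> 0"
  proof
    assume "t * (-u) - (-s) * v = 0"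
    then have "s * v = u * t" by (simp add: algebra_simps)
    then have "p = q" using p q by (auto simp: homog_def field_simps)
    with assms show False by simp
  qed
  show ?thesis
  proof
    show "moebius_map t (-s) v (-u) \<in> Moeb" using det by (rule MoebI)
    show "moebius_map t (-s) v (-u) p = None" "moebius_map t (-s) v (-u) q = Some 0"
      using det unfolding p(1) q(1) moebius_map_homog[OF p(2)] moebius_map_homog[OF q(2)]
      by (auto simp: homog_def algebra_simps)
  qed
qed

lemma Moeb_to_None:
  obtains N where "N \<in> Moeb" "N p = None"
  using Moeb_to_None_0[of p "if p = None then Some 0 else None"] by (metis option.distinct(1))

text \<open>Once two of the fixed points are moved to \<open>\<infinity>\<close> and \<open>0\<close>, the map is a rotation \<open>z \<mapsto> a z\<close>, and the third
fixed point forces \<open>a = 1\<close>.\<close>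
lemma Moeb_fix_three:
  assumes M: "M \<in> Moeb" and fixes_pts: "M p = p" "M q = q" "M r = r"
    and distinct: "p \<noteq> q" "p \<noteq> r" "q \<noteq> r"
  shows "M = id"
proof -
  obtain N where N: "N \<in> Moeb" "N p = None" "N q = Some 0"
    using Moeb_to_None_0[OF distinct(1)] .
  define M' where "M' = N \<circ> M \<circ> inv N"
  have invN: "inv N None = p" "inv N (Some 0) = q" "inv N (N r) = r"
    using N by (metis Moeb_inv_comp(4))+
  have M': "M' \<in> Moeb" "M' None = None" "M' (Some 0) = Some 0" "M' (N r) = N r"
    using N M fixes_pts invN by (simp_all add: M'_def Moeb_comp Moeb_inv)
  obtain a where a: "a \<noteq> 0" "M' = moebius_map a 0 0 1"
    using Moeb_fix_None_0[OF M'(1-3)] .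
  obtain z where z: "N r = Some z" "z \<noteq> 0"
    using N distinct invN by (cases "N r") (metis, metis)
  have "a = 1" using M'(4) a z by (simp add: moebius_map_affine)
  then have "M' = id" using a moebius_map_id by simp
  then have "inv N \<circ> M' \<circ> N = id" using N by simp
  moreover have "inv N \<circ> M' \<circ> N = M"
    using N by (simp add: M'_def fun_eq_iff)
  ultimately show ?thesis by simp
qed

text \<open>Uniqueness in this form makes the group of Moebius symmetries of a finite set finite.\<close>
lemma Moeb_agree_three:
  assumes "M \<in> Moeb" "N \<in> Moeb" "M p = N p" "M q = N q" "M r = N r"
    and "p \<noteq> q" "p \<noteq> r" "q \<noteq> r"
  shows "M = N"
proof -
  have "inv N \<circ> M = id"
    using assms by (intro Moeb_fix_three[of _ p q r] Moeb_comp Moeb_inv) auto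
  then have "N \<circ> (inv N \<circ> M) = N" by simp
  then show ?thesis using assms(2) by (simp add: fun_eq_iff)
qed

text \<open>The fixed points are the roots of a quadratic equation, or \<open>\<infinity>\<close> if the map is affine.\<close>
lemma Moeb_has_fixed_point:
  assumes "M \<in> Moeb"
  obtains p where "M p = p"
proof -
  from assms obtain a b c d where M: "M = moebius_map a b c d" "a * d - b * c \<noteq> 0"
    by (rule MoebE)
  show ?thesis
  proof (cases "c = 0")
    case True
    then show ?thesis using that[of None] M by (simp add: moebius_map_def)
  next
    case False
    \<comment> \<open>a root of \<open>c z\<^sup>2 + (d - a) z - b\<close>\<close>
    define z where "z = (a - d + csqrt ((a - d)\<^sup>2 + 4 * b * c)) / (2 * c)"
    have "(2 * c * z - (a - d))\<^sup>2 = (a - d)\<^sup>2 + 4 * b * c"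
      using False by (simp add: z_def)
    then have "4 * c * (z * (c * z + d) - (a * z + b)) = 0"
      by (simp add: power2_eq_square algebra_simps)
    then have eq: "z * (c * z + d) = a * z + b"
      using False by (metis eq_iff_diff_eq_0 mult_eq_0_iff zero_neq_numeral)
    have "c * z + d \<noteq> 0"
      using nonsingular_apply[OF M(2), of z 1] eq by auto
    then have "M (Some z) = Some z"
      using eq M by (simp add: moebius_map_def divide_eq_eq)
    then show ?thesis by (rule that)
  qed
qed

lemma moduli_class_self: "A \<in> moduli_class A"
  unfolding moduli_class_def by (metis Moeb_id image_eqI image_id id_apply)

lemma moduli_class_image:
  assumes "N \<in> Moeb"
  shows "moduli_class (N ` A) = moduli_class A"
proof -
  have sub: "moduli_class (K ` B) \<subseteq> moduli_class B" if "K \<in> Moeb" for K B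
    unfolding moduli_class_def using that Moeb_comp by (fastforce simp: image_image comp_def)
  have "inv N ` N ` A = A" using assms by (simp add: image_image)
  then show ?thesis using sub[OF assms, of A] sub[OF Moeb_inv[OF assms], of "N ` A"] by simp
qed

lemma moduli_class_eqD:
  assumes "moduli_class A = moduli_class B"
  obtains N where "N \<in> Moeb" "B = N ` A"
  using moduli_class_self[of B] unfolding assms[symmetric] by (auto simp: moduli_class_def)

section \<open>The topology of the sphere\<close>

lemma topspace_riemann_sphere [simp]: "topspace riemann_sphere = UNIV"
  by (auto simp: riemann_sphere_def) (metis not_None_eq rangeI)

text \<open>Open neighbourhoods of infinity are complements of compact sets. Their closedness is already contained in the
openness of the finite part, so only boundedness remains.\<close>
lemma openin_riemann_sphere:
  "openin riemann_sphere U \<longleftrightarrow>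
    open {z. Some z \<in> U} \<and> (None \<in> U \<longrightarrow> bounded {z. Some z \<notin> U})"
proof
  assume "openin riemann_sphere U"
  then consider V where "open V" "U = Some ` V" | C where "compact C" "U = insert None (Some ` (- C))"
    by (auto simp: riemann_sphere_def openin_Alexandroff_compactification Compl_eq_Diff_UNIV)
  then show "open {z. Some z \<in> U} \<and> (None \<in> U \<longrightarrow> bounded {z. Some z \<notin> U})"
  proof cases
    case 1
    then have "{z. Some z \<in> U} = V" by auto
    with 1 show ?thesis by auto
  next
    case 2
    then have "{z. Some z \<in> U} = - C" "{z. Some z \<notin> U} = C" by auto
    with 2 show ?thesis by (auto simp: compact_imp_closed compact_imp_bounded open_Compl)
  qed
next
  assume *: "open {z. Some z \<in> U} \<and> (None \<in> U \<longrightarrow> bounded {z. Some z \<notin> U})"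
  show "openin riemann_sphere U"
  proof (cases "None \<in> U")
    case False
    then have "U = Some ` {z. Some z \<in> U}" 
      by (intro set_eqI, rename_tac p, case_tac p) auto
    then show ?thesis using * unfolding riemann_sphere_def
      by (metis open_openin openin_Alexandroff_compactification_image_Some)
  next
    case True
    have eq: "{z. Some z \<notin> U} = - {z. Some z \<in> U}" by auto
    have "U = insert None (Some ` (- {z. Some z \<notin> U}))"
      using True by (intro set_eqI, rename_tac p, case_tac p) auto
    moreover have "compact {z. Some z \<notin> U}"
      using * True by (auto simp: compact_eq_bounded_closed eq)
    ultimately show ?thesis
      unfolding riemann_sphere_def openin_Alexandroff_compactification
      by (auto simp: Compl_eq_Diff_UNIV compact_imp_closed)
  qed
qed

lemma continuous_map_Some_sphere: "continuous_map euclidean riemann_sphere Some"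
  unfolding riemann_sphere_def by (rule continuous_map_Some)

lemma continuous_map_Some_comp:
  "continuous_on S f \<Longrightarrow> continuous_map (top_of_set S) riemann_sphere (\<lambda>x. Some (f x))"
  using continuous_map_compose[OF _ continuous_map_Some_sphere, of "top_of_set S" f]
  by (simp add: comp_def)

lemma openin_finite_part: "openin riemann_sphere {p. p \<noteq> None}"
  by (simp add: openin_riemann_sphere)

lemma continuous_map_the:
  "continuous_map (subtopology riemann_sphere {p. p \<noteq> None}) euclidean the"
  unfolding continuous_map_def
proof (intro conjI allI impI)
  fix U :: "complex set"
  assume "openin euclidean U"
  then have "openin riemann_sphere (Some ` U)"
    unfolding riemann_sphere_def by simp
  moreover have "{x \<in> topspace (subtopology riemann_sphere {p. p \<noteq> None}). the x \<in> U} =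
    Some ` U \<inter> {p. p \<noteq> None}" by force
  ultimately show "openin (subtopology riemann_sphere {p. p \<noteq> None})
     {x \<in> topspace (subtopology riemann_sphere {p. p \<noteq> None}). the x \<in> U}"
    using openin_subtopology by metis
qed auto

lemma continuous_map_affine_sphere:
  assumes "a \<noteq> 0"
  shows "continuous_map riemann_sphere riemann_sphere (moebius_map a b 0 1)"
  unfolding continuous_map_def
proof (intro conjI allI impI)
  fix U assume "openin riemann_sphere U"
  then have U: "open {z. Some z \<in> U}" "None \<in> U \<Longrightarrow> bounded {z. Some z \<notin> U}"
    by (auto simp: openin_riemann_sphere)
  have "{z. Some (a * z + b) \<in> U} = (\<lambda>z. a * z + b) -` {z. Some z \<in> U}" by auto
  moreover have "open \<dots>"
    by (intro open_vimage U continuous_intros)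
  moreover have "bounded {z. Some (a * z + b) \<notin> U}" if N: "None \<in> U"
  proof -
    have "bounded ((\<lambda>w. (w - b) / a) ` {z. Some z \<notin> U})"
    proof -
      obtain B where "\<And>z. Some z \<notin> U \<Longrightarrow> norm z \<le> B"
        using U(2)[OF N] by (auto simp: bounded_iff)
      then have "norm ((z - b) / a) \<le> (B + norm b) / norm a" if "Some z \<notin> U" for z
        unfolding norm_divide using that norm_triangle_ineq4[of z b]
        by (intro divide_right_mono) force+
      then show ?thesis by (auto simp: bounded_iff)
    qed
    moreover have "{z. Some (a * z + b) \<notin> U} \<subseteq> (\<lambda>w. (w - b) / a) ` {z. Some z \<notin> U}"
    proof
      fix z assume "z \<in> {z. Some (a * z + b) \<notin> U}"
      then show "z \<in> (\<lambda>w. (w - b) / a) ` {z. Some z \<notin> U}"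
        using assms by (intro image_eqI[of _ _ "a * z + b"]) auto
    qed
    ultimately show ?thesis by (rule bounded_subset)
  qed
  ultimately show "openin riemann_sphere {x \<in> topspace riemann_sphere. moebius_map a b 0 1 x \<in> U}"
    by (simp add: openin_riemann_sphere moebius_map_affine)
qed auto

lemma moebius_map_inversion:
  "moebius_map 0 1 1 0 (Some z) = (if z = 0 then None else Some (inverse z))"
  "moebius_map 0 1 1 0 None = Some 0"
  by (simp_all add: moebius_map_def divide_inverse)

lemma continuous_map_inversion_sphere:
  "continuous_map riemann_sphere riemann_sphere (moebius_map 0 1 1 0)"
  unfolding continuous_map_def
proof (intro conjI allI impI)
  fix U assume "openin riemann_sphere U"
  then have U: "open {z. Some z \<in> U}" "None \<in> U \<Longrightarrow> bounded {z. Some z \<notin> U}"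
    by (auto simp: openin_riemann_sphere)
  let ?V = "{p. moebius_map 0 1 1 0 p \<in> U}"
  have *: "Some z \<in> ?V \<longleftrightarrow> Some (inverse z) \<in> U" if "z \<noteq> 0" for z
    using that by (simp add: moebius_map_inversion)
  have op: "open ((- {0}) \<inter> inverse -` {z. Some z \<in> U})"
    by (intro continuous_open_preimage U continuous_intros) auto
  have 1: "open {z. Some z \<in> ?V}"
  proof (cases "None \<in> U")
    case False
    then have "{z. Some z \<in> ?V} = (- {0}) \<inter> inverse -` {z. Some z \<in> U}"
      by (auto simp: moebius_map_inversion)
    then show ?thesis using op by simp
  next
    case True
    obtain B where B: "B > 0" "\<And>z. Some z \<notin> U \<Longrightarrow> norm z \<le> B"
      using U(2)[OF True] by (auto simp: bounded_pos)
    have "ball 0 (1 / B) \<subseteq> {z. Some z \<in> ?V}"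
    proof
      fix z :: complex assume "z \<in> ball 0 (1 / B)"
      then have z: "norm z < 1 / B" by simp
      show "z \<in> {z. Some z \<in> ?V}"
      proof (cases "z = 0")
        case True
        with \<open>None \<in> U\<close> show ?thesis by (simp add: moebius_map_inversion)
      next
        case False
        then have "norm (inverse z) > B"
          using z B(1) unfolding norm_inverse
          by (metis inverse_eq_divide inverse_inverse_eq inverse_less_imp_less
              positive_imp_inverse_positive zero_less_norm_iff less_imp_inverse_less)
        then show ?thesis using B(2)[of "inverse z"] * False by force
      qed
    qed
    then have "{z. Some z \<in> ?V} = ball 0 (1 / B) \<union> ((- {0}) \<inter> inverse -` {z. Some z \<in> U})"
      using B(1) True by (auto simp: moebius_map_inversion split: if_splits)
    then show ?thesis using op by (metis open_Un open_ball)
  qed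
  have 2: "bounded {z. Some z \<notin> ?V}" if "None \<in> ?V"
  proof -
    have "0 \<in> {z. Some z \<in> U}" using that by (simp add: moebius_map_inversion)
    then obtain e where e: "e > 0" "ball 0 e \<subseteq> {z. Some z \<in> U}"
      using U(1) by (meson openE)
    have "norm z \<le> 1 / e" if "Some z \<notin> ?V" for z
    proof (cases "z = 0")
      case False
      then have "inverse z \<notin> ball 0 e" using that e(2) * by blast
      then have "e \<le> inverse (norm z)" by (simp add: norm_inverse)
      then show ?thesis using e(1) le_imp_inverse_le[of e "inverse (norm z)"]
        by (simp add: inverse_eq_divide)
    qed (use e in simp)
    then show ?thesis by (auto simp: bounded_iff)
  qed
  show "openin riemann_sphere {x \<in> topspace riemann_sphere. moebius_map 0 1 1 0 x \<in> U}"
    using 1 2 by (simp add: openin_riemann_sphere)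
qed auto

text \<open>Every Moebius map is a composition of affine maps and the inversion \<open>1/z\<close>.\<close>
lemma continuous_map_Moeb:
  assumes "M \<in> Moeb"
  shows "continuous_map riemann_sphere riemann_sphere M"
proof -
  from assms obtain a b c d where M: "M = moebius_map a b c d" "a * d - b * c \<noteq> 0"
    by (rule MoebE)
  show ?thesis
  proof (cases "c = 0")
    case True
    then obtain a' b' where "a' \<noteq> 0" "M = moebius_map a' b' 0 1"
      using Moeb_fix_None[OF assms] M(1) by (auto simp: moebius_map_def)
    then show ?thesis by (simp add: continuous_map_affine_sphere)
  next
    case False
    \<comment> \<open>\<open>(a z + b) / (c z + d) = a / c + e / (c z + d)\<close>\<close>
    define e where "e = (b * c - a * d) / c"
    have e: "e \<noteq> 0" using M(2) False by (auto simp: e_def)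
    have "M = moebius_map e (a / c) 0 1 \<circ> (moebius_map 0 1 1 0 \<circ> moebius_map c d 0 1)"
      using False by (simp add: moebius_map_comp M(1)) (simp add: e_def field_simps)
    then show ?thesis
      using e False
      by (simp only:) (rule continuous_map_compose[where X' = riemann_sphere],
        rule continuous_map_compose[where X' = riemann_sphere],
        simp_all add: continuous_map_affine_sphere continuous_map_inversion_sphere)
  qed
qed

lemma homeomorphic_map_Moeb:
  assumes "M \<in> Moeb"
  shows "homeomorphic_map riemann_sphere riemann_sphere M"
proof -
  have "homeomorphic_maps riemann_sphere riemann_sphere M (inv M)"
    using assms by (simp add: homeomorphic_maps_def continuous_map_Moeb Moeb_inv)
  then show ?thesis by (rule homeomorphic_maps_imp_map)
qed

lemma continuous_map_conjugation: "continuous_map riemann_sphere riemann_sphere (map_option cnj)"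
  unfolding continuous_map_def
proof (intro conjI allI impI)
  fix U assume "openin riemann_sphere U"
  then have U: "open {z. Some z \<in> U}" "None \<in> U \<Longrightarrow> bounded {z. Some z \<notin> U}"
    by (auto simp: openin_riemann_sphere)
  have "open (cnj -` {z. Some z \<in> U})"
    by (intro open_vimage U continuous_intros)
  moreover have "bounded {z. Some (cnj z) \<notin> U}" if "None \<in> U"
    using U(2)[OF that] unfolding bounded_iff by (metis complex_cnj_cnj complex_mod_cnj mem_Collect_eq)
  ultimately show "openin riemann_sphere {x \<in> topspace riemann_sphere. map_option cnj x \<in> U}"
    by (simp add: openin_riemann_sphere vimage_def)
qed auto

section \<open>Moving configurations of points\<close>

lemma topspace_configuration_space:
  "x \<in> topspace (configuration_space n) \<longleftrightarrow> x \<in> extensional {..<n} \<and> inj_on x {..<n}"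
  by (simp add: configuration_space_def PiE_def)

lemma topspace_moduli_unordered:
  "topspace (moduli_unordered n) = {moduli_class A | A. card A = n \<and> finite A}"
proof -
  have "(\<exists>x \<in> topspace (configuration_space n). x ` {..<n} = A) \<longleftrightarrow> card A = n \<and> finite A" for A
  proof
    assume "\<exists>x \<in> topspace (configuration_space n). x ` {..<n} = A"
    then obtain x where "inj_on x {..<n}" "A = x ` {..<n}"
      using topspace_configuration_space by blast
    then show "card A = n \<and> finite A" by (simp add: card_image)
  next
    assume A: "card A = n \<and> finite A"
    then obtain h where h: "bij_betw h {..<n} A"
      using bij_betw_from_nat_into_finite by blast
    have "restrict h {..<n} \<in> topspace (configuration_space n)"
      using h unfolding topspace_configuration_space bij_betw_def
      by (simp add: inj_on_def)
    moreover have "restrict h {..<n} ` {..<n} = A"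
      using h unfolding bij_betw_def by simp
    ultimately show "\<exists>x \<in> topspace (configuration_space n). x ` {..<n} = A" by blast
  qed
  then have eq: "(\<lambda>x. x ` {..<n}) ` topspace (configuration_space n) = {A. card A = n \<and> finite A}"
    unfolding image_def by (intro set_eqI) (simp only: mem_Collect_eq eq_commute)
  have "topspace (moduli_unordered n) =
      moduli_class ` (\<lambda>x. x ` {..<n}) ` topspace (configuration_space n)"
    unfolding moduli_unordered_def topspace_quotient_topology image_image ..
  then show ?thesis
    unfolding eq setcompr_eq_image .
qed

text \<open>The bridge between paths and the moduli space. The points may be labelled by any finite index set,
as their order is lost in the moduli space.\<close>
lemma connectedin_moving_points:
  fixes f :: "'t::topological_space \<Rightarrow> 'i \<Rightarrow> complex option"
  assumes D: "connected D" and I: "card I = n" "finite I"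
    and cont: "\<And>i. i \<in> I \<Longrightarrow> continuous_map (top_of_set D) riemann_sphere (\<lambda>t. f t i)"
    and inj: "\<And>t. t \<in> D \<Longrightarrow> inj_on (f t) I"
  shows "connectedin (moduli_unordered n) ((\<lambda>t. moduli_class (f t ` I)) ` D)"
proof -
  obtain e where e: "bij_betw e {..<n} I"
    using I bij_betw_from_nat_into_finite by blast
  define x where "x t = restrict (f t \<circ> e) {..<n}" for t
  have eI: "e i \<in> I" if "i < n" for i using e that by (auto simp: bij_betw_def)
  have "inj_on (x t) {..<n}" if "t \<in> D" for t
  proof -
    have "inj_on (f t \<circ> e) {..<n}"
      using inj[OF that] e by (auto simp: bij_betw_def intro: comp_inj_on)
    then show ?thesis by (simp add: x_def inj_on_def)
  qed
  then have "continuous_map (top_of_set D) (configuration_space n) x"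
    unfolding configuration_space_def continuous_map_in_subtopology
    by (auto simp: continuous_map_componentwise x_def cont eI)
  moreover have "continuous_map (configuration_space n) (moduli_unordered n)
       (\<lambda>x. moduli_class (x ` {..<n}))"
    unfolding moduli_unordered_def
    by (intro quotient_imp_continuous_map quotient_map_quotient_topology)
  ultimately have "continuous_map (top_of_set D) (moduli_unordered n)
       ((\<lambda>x. moduli_class (x ` {..<n})) \<circ> x)"
    by (rule continuous_map_compose)
  moreover have "connectedin (top_of_set D) D"
    using D by (simp add: connectedin_subtopology)
  ultimately have "connectedin (moduli_unordered n) (((\<lambda>x. moduli_class (x ` {..<n})) \<circ> x) ` D)"
    by (rule connectedin_continuous_map_image)
  moreover have "x t ` {..<n} = f t ` I" for t
    using e by (auto simp: x_def bij_betw_def image_image)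
  ultimately show ?thesis by (simp add: comp_def)
qed

lemma finite_zeros_of_affine:
  fixes \<alpha> \<beta> :: complex
  assumes "\<alpha> \<noteq> 0"
  shows "finite {t. \<alpha> + t * \<beta> = 0}"
proof (rule finite_subset)
  show "{t. \<alpha> + t * \<beta> = 0} \<subseteq> {- \<alpha> / \<beta>}"
  proof
    fix t assume "t \<in> {t. \<alpha> + t * \<beta> = 0}"
    then have "t * \<beta> = - \<alpha>" by (simp add: eq_neg_iff_add_eq_0 add.commute)
    with assms show "t \<in> {- \<alpha> / \<beta>}" by (cases "\<beta> = 0") (simp_all add: eq_divide_eq del: divide_minus_left)
  qed
qed simp

section \<open>Symmetries of finite sets\<close>

text \<open>The powers of \<open>M\<close> induce only finitely many permutations of \<open>A\<close>, so two of them coincide.\<close>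
lemma finite_permutation_power:
  assumes "finite A" "inj M" "M ` A = A"
  obtains k where "k > 0" "\<forall>x\<in>A. (M ^^ k) x = x"
proof -
  have pow: "(M ^^ i) ` A = A" for i
  proof (induction i)
    case (Suc i)
    then have "M ` (M ^^ i) ` A = A" using assms(3) by simp
    then show ?case by (simp add: image_image)
  qed simp
  have "(\<lambda>i. restrict (M ^^ i) A) ` UNIV \<subseteq> (\<Pi>\<^sub>E x\<in>A. A)"
  proof (intro image_subsetI restrict_PiE_iff[THEN iffD2] ballI)
    show "(M ^^ i) x \<in> A" if "x \<in> A" for i x
      using pow[of i] that by blast
  qed
  moreover have "finite (\<Pi>\<^sub>E x\<in>A. A)"
    using assms(1) by (simp add: finite_PiE)
  ultimately have "\<not> inj (\<lambda>i::nat. restrict (M ^^ i) A)"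
    using finite_subset infinite_UNIV_nat finite_imageD by metis
  then obtain i j :: nat where "i \<noteq> j" "restrict (M ^^ i) A = restrict (M ^^ j) A"
    by (auto simp: inj_def)
  then obtain i j :: nat where ij: "i < j" "restrict (M ^^ i) A = restrict (M ^^ j) A"
    by (metis nat_neq_iff)
  have "(M ^^ (j - i)) x = x" if "x \<in> A" for x
  proof -
    have "(M ^^ i) x = (M ^^ (i + (j - i))) x"
      using ij that by (metis le_add_diff_inverse less_imp_le restrict_apply)
    then have "(M ^^ i) x = (M ^^ i) ((M ^^ (j - i)) x)"
      by (simp add: funpow_add)
    moreover have "inj (M ^^ i)" using assms(2) by (rule inj_fn)
    ultimately show ?thesis by (metis injD)
  qed
  with ij show ?thesis using that[of "j - i"] by simp
qed

lemma three_points: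
  assumes "finite A" "card A \<ge> 3"
  obtains p q r where "{p, q, r} \<subseteq> A" "p \<noteq> q" "p \<noteq> r" "q \<noteq> r"
proof -
  obtain B where "B \<subseteq> A" "card B = 3" by (rule obtain_subset_with_card_n[OF assms(2)])
  moreover from this(2) obtain p q r where pqr: "B = {p, q, r}" "p \<noteq> q" "p \<noteq> r" "q \<noteq> r"
    unfolding card_3_iff by blast
  ultimately have "{p, q, r} \<subseteq> A" by simp
  then show ?thesis using pqr(2-4) by (rule that)
qed

lemma Moeb_finite_order:
  assumes "M \<in> Moeb" "finite A" "card A \<ge> 3" "M ` A = A"
  obtains k where "k > 0" "M ^^ k = id"
proof -
  obtain k where k: "k > 0" "\<forall>x\<in>A. (M ^^ k) x = x"
    using finite_permutation_power[OF assms(2) Moeb_inj[OF assms(1)] assms(4)] .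
  obtain p q r where "{p, q, r} \<subseteq> A" and distinct: "p \<noteq> q" "p \<noteq> r" "q \<noteq> r"
    using three_points[OF assms(2,3)] .
  then have "(M ^^ k) p = p" "(M ^^ k) q = q" "(M ^^ k) r = r"
    using k(2) by simp_all
  then have "M ^^ k = id"
    using distinct by (intro Moeb_fix_three[of _ p q r] Moeb_funpow assms(1))
  with k show ?thesis using that by blast
qed

lemma conjugate_funpow:
  assumes "N \<in> Moeb"
  shows "(N \<circ> M \<circ> inv N) ^^ k = N \<circ> M ^^ k \<circ> inv N"
  using assms by (induction k) (auto simp: fun_eq_iff)

lemma translation_funpow:
  "(moebius_map 1 b 0 1 ^^ k) (Some z) = Some (z + of_nat k * b)"
  by (induction k) (auto simp: moebius_map_affine algebra_simps)

text \<open>With the given fixed point at \<open>\<infinity>\<close> the map is \<open>a z + b\<close>. It is not a translation, because a translation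
has infinite order; so \<open>a \<noteq> 1\<close> and there is a finite fixed point.\<close>
lemma second_fixed_point:
  assumes M: "M \<in> Moeb" "M \<noteq> id" "M p = p" and k: "k > 0" "M ^^ k = id"
  obtains q where "q \<noteq> p" "M q = q"
proof -
  obtain N where N: "N \<in> Moeb" "N p = None" by (rule Moeb_to_None)
  define M' where "M' = N \<circ> M \<circ> inv N"
  have invN: "inv N None = p" using N by (metis Moeb_inv_comp(4))
  have M': "M' \<in> Moeb" "M' None = None"
    using N M invN by (simp_all add: M'_def Moeb_comp Moeb_inv)
  obtain a b where ab: "a \<noteq> 0" "M' = moebius_map a b 0 1"
    using Moeb_fix_None[OF M'] .
  have "M' ^^ k = id" using k N by (simp add: M'_def conjugate_funpow)
  have "a \<noteq> 1"
  proof
    assume "a = 1"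
    then have "Some (of_nat k * b) = Some 0"
      using translation_funpow[where b = b and k = k and z = 0] ab \<open>M' ^^ k = id\<close> by simp
    then have "b = 0" using k by simp
    then have "M' = id" using ab \<open>a = 1\<close> moebius_map_id by simp
    then have "inv N \<circ> M' \<circ> N = id" using N by simp
    then have "M = id" using N by (simp add: M'_def fun_eq_iff)
    with M show False by simp
  qed
  define z where "z = b / (1 - a)"
  have "M' (Some z) = Some z"
    using \<open>a \<noteq> 1\<close> by (simp add: ab moebius_map_affine z_def field_simps)
  then have "N (M (inv N (Some z))) = Some z" by (simp add: M'_def)
  then have "M (inv N (Some z)) = inv N (Some z)" using N by (metis Moeb_inv_comp(4))
  moreover have "inv N (Some z) \<noteq> p" using N by (metis Moeb_inv_comp(3) option.distinct(1))
  ultimately show ?thesis using that by blast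
qed

abbreviation rotation :: "complex \<Rightarrow> complex option \<Rightarrow> complex option" where
  "rotation w \<equiv> moebius_map w 0 0 1"

lemma root_of_unity_nonzero: "w ^ m = 1 \<Longrightarrow> m > 0 \<Longrightarrow> w \<noteq> (0::complex)"
  by (metis zero_neq_one zero_power)

lemma rotation_Moeb: "w \<noteq> 0 \<Longrightarrow> rotation w \<in> Moeb"
  by (rule MoebI) simp

lemma rotation_fixed: "w \<noteq> 1 \<Longrightarrow> rotation w p = p \<longleftrightarrow> p \<in> {None, Some 0}"
  by (cases p) (auto simp: moebius_map_affine)

lemma rotation_funpow: "(rotation w ^^ k) (Some z) = Some (w ^ k * z)"
  by (induction k) (auto simp: moebius_map_affine)

text \<open>Only the values 0, 1 and 2 of \<open>e\<close> occur for finite sets with at least three points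
(\<open>symmetry_normal_form\<close>).\<close>
definition has_symmetry_fixing :: "nat \<Rightarrow> complex option set \<Rightarrow> bool" where
  "has_symmetry_fixing e A \<longleftrightarrow>
     (\<exists>M\<in>Moeb. M \<noteq> id \<and> M ` A = A \<and> card {x \<in> A. M x = x} = e)"

lemma has_symmetry_fixing_image:
  assumes "has_symmetry_fixing e A" "N \<in> Moeb"
  shows "has_symmetry_fixing e (N ` A)"
proof -
  obtain M where M: "M \<in> Moeb" "M \<noteq> id" "M ` A = A" "card {x \<in> A. M x = x} = e"
    using assms(1) by (auto simp: has_symmetry_fixing_def)
  define M' where "M' = N \<circ> M \<circ> inv N"
  have M'N: "M' (N x) = N (M x)" for x using assms(2) by (simp add: M'_def)
  have "M' ` N ` A = N ` M ` A" by (simp add: image_image M'N)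
  moreover have "M' \<noteq> id"
  proof
    assume "M' = id"
    then have "M x = x" for x
      using M'N[of x] Moeb_inj[OF assms(2)] by (metis eq_id_iff injD)
    with M(2) show False by auto
  qed
  moreover have "{x \<in> N ` A. M' x = x} = N ` {x \<in> A. M x = x}"
    using Moeb_inj[OF assms(2)] by (auto simp: M'N inj_eq)
  moreover have "card (N ` {x \<in> A. M x = x}) = e"
    using M(4) Moeb_inj[OF assms(2)] by (simp add: card_image inj_on_subset)
  moreover have "M' \<in> Moeb" using M assms by (simp add: M'_def Moeb_comp Moeb_inv)
  ultimately show ?thesis using M by (auto simp: has_symmetry_fixing_def)
qed

text \<open>Of the fixed points of a rotation, the \<open>e\<close> ones that belong to the invariant set; a single one is
placed at \<open>\<infinity>\<close>.\<close>
definition poles :: "nat \<Rightarrow> complex option set" where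
  "poles e = (if e = 0 then {} else if e = 1 then {None} else {None, Some 0})"

text \<open>The symmetry has exactly two fixed points. They are moved to \<open>\<infinity>\<close> and \<open>0\<close>, in such a way that \<open>\<infinity>\<close>
is in the set if only one of them is.\<close>
lemma symmetry_normal_form:
  assumes A: "finite A" "card A \<ge> 3" and sym: "has_symmetry_fixing e A"
  obtains N w k where "N \<in> Moeb" "w \<noteq> 0" "w \<noteq> 1" "k > 0" "w ^ k = 1"
    "rotation w ` N ` A = N ` A" "N ` A \<inter> {None, Some 0} = poles e" "e \<le> 2"
proof -
  obtain M where M: "M \<in> Moeb" "M \<noteq> id" "M ` A = A" "card {x \<in> A. M x = x} = e"
    using sym by (auto simp: has_symmetry_fixing_def)
  obtain k where k: "k > 0" "M ^^ k = id"
    using Moeb_finite_order[OF M(1) A M(3)] .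
  obtain p' where p': "M p' = p'" using Moeb_has_fixed_point[OF M(1)] .
  obtain q' where q': "q' \<noteq> p'" "M q' = q'" using second_fixed_point[OF M(1,2) p' k] .
  obtain p q where pq: "p \<noteq> q" "M p = p" "M q = q" "q \<in> A \<longrightarrow> p \<in> A"
    using p' q' by (cases "q' \<in> A") (metis, metis)
  have "x \<in> {p, q}" if "M x = x" for x
    using Moeb_fix_three[OF M(1), of p q x] pq that M(2) by auto
  then have fixed: "{x \<in> A. M x = x} = A \<inter> {p, q}" using pq by auto
  obtain N where N: "N \<in> Moeb" "N p = None" "N q = Some 0" using Moeb_to_None_0[OF pq(1)] .
  define M' where "M' = N \<circ> M \<circ> inv N"
  have invN: "inv N None = p" "inv N (Some 0) = q" using N by (metis Moeb_inv_comp(4))+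
  have M': "M' \<in> Moeb" "M' None = None" "M' (Some 0) = Some 0"
    using N M invN pq by (simp_all add: M'_def Moeb_comp Moeb_inv)
  obtain w where w: "w \<noteq> 0" "M' = rotation w" using Moeb_fix_None_0[OF M'] .
  have "w \<noteq> 1"
  proof
    assume "w = 1"
    then have "M' = id" using w moebius_map_id by simp
    then have "inv N \<circ> M' \<circ> N = id" using N by simp
    then have "M = id" using N by (simp add: M'_def fun_eq_iff)
    with M show False by simp
  qed
  moreover have "w ^ k = 1"
  proof -
    have "M' ^^ k = id" using k N by (simp add: M'_def conjugate_funpow)
    then show ?thesis using rotation_funpow[where w = w and k = k and z = 1] w by simp
  qed
  moreover have "rotation w ` N ` A = N ` A"
  proof -
    have "M' ` N ` A = N ` M ` A" using N by (simp add: M'_def image_image)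
    then show ?thesis using M w by simp
  qed
  moreover have "N ` A \<inter> {None, Some 0} = N ` (A \<inter> {p, q})"
    using image_Int[OF Moeb_inj[OF N(1)], of A "{p, q}"] N by simp
  moreover have "A \<inter> {p, q} = {} \<or> A \<inter> {p, q} = {p} \<or> A \<inter> {p, q} = {p, q}"
    using pq by auto
  then have "N ` (A \<inter> {p, q}) = poles e" "e \<le> 2"
    using M(4) N pq(1) unfolding fixed by (auto simp: poles_def)
  ultimately show ?thesis using that[OF N(1) w(1)] k by simp
qed

lemma image_eq_self: "finite X \<Longrightarrow> inj M \<Longrightarrow> M ` X \<subseteq> X \<Longrightarrow> M ` X = X"
  by (meson endo_inj_surj inj_on_subset subset_UNIV)

lemma rotation_imp_symmetry:
  assumes "finite A" "w \<noteq> 0" "w \<noteq> 1" "rotation w ` A \<subseteq> A" "A \<inter> {None, Some 0} = poles e" "e \<le> 2"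
  shows "has_symmetry_fixing e A"
proof -
  have "rotation w \<noteq> id"
  proof
    assume "rotation w = id"
    then have "rotation w (Some 1) = Some 1" by simp
    with assms show False by (simp add: moebius_map_affine)
  qed
  moreover have "{x \<in> A. rotation w x = x} = poles e"
    using assms(3,5) rotation_fixed by blast
  moreover have "card (poles e) = e" using assms(6) by (auto simp: poles_def)
  ultimately show ?thesis
    using rotation_Moeb[OF assms(2)] image_eq_self[OF assms(1) Moeb_inj[OF rotation_Moeb[OF assms(2)]] assms(4)]
    unfolding has_symmetry_fixing_def by (intro bexI[of _ "rotation w"]) simp_all
qed

section \<open>Connectedness of the families of rotationally symmetric sets\<close>

lemma ball_image_pairs:
  "(\<forall>(\<alpha>, \<beta>) \<in> (\<lambda>(i, j). (F i j, G i j)) ` {(i, j). R i j}. P \<alpha> \<beta>) \<longleftrightarrow>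
     (\<forall>i j. R i j \<longrightarrow> P (F i j) (G i j))"
  by auto

lemma ball_image_pair:
  "(\<forall>(\<alpha>, \<beta>) \<in> (\<lambda>j. (F j, G j)) ` A. P \<alpha> \<beta>) \<longleftrightarrow> (\<forall>j\<in>A. P (F j) (G j))"
  by auto

text \<open>Each condition excludes at most one parameter, because the affine function does not vanish at
\<open>t = 0\<close>.\<close>
lemma connected_avoiding_zeros:
  fixes P :: "(complex \<times> complex) set"
  assumes "finite P" "\<And>\<alpha> \<beta>. (\<alpha>, \<beta>) \<in> P \<Longrightarrow> \<alpha> \<noteq> 0" "open S" "convex S"
  shows "connected {t \<in> S. \<forall>(\<alpha>, \<beta>) \<in> P. \<alpha> + t * \<beta> \<noteq> 0}"
proof -
  have "finite (\<Union>(\<alpha>, \<beta>) \<in> P. {t. \<alpha> + t * \<beta> = 0})"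
    using assms by (auto intro!: finite_zeros_of_affine)
  then have "connected (S - (\<Union>(\<alpha>, \<beta>) \<in> P. {t. \<alpha> + t * \<beta> = 0}))"
    using assms by (intro connected_open_diff_countable)
      (auto simp: convex_connected countable_finite)
  moreover have "S - (\<Union>(\<alpha>, \<beta>) \<in> P. {t. \<alpha> + t * \<beta> = 0}) =
      {t \<in> S. \<forall>(\<alpha>, \<beta>) \<in> P. \<alpha> + t * \<beta> \<noteq> 0}" by auto
  ultimately show ?thesis by simp
qed

text \<open>Moving \<open>h\<close> distinct points of the plane along complex lines: only finitely many parameters produce
a collision, since no two points collide at \<open>t = 0\<close>.\<close>
lemma connected_injective_parameters:
  fixes u v :: "nat \<Rightarrow> complex"
  assumes u: "inj_on u {..<h}" and S: "open S" "convex S"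
  shows "connected {t \<in> S. inj_on (\<lambda>j. u j + t * (v j - u j)) {..<h}}"
proof -
  define P where "P = (\<lambda>(i, j). (u i - u j, (v i - u i) - (v j - u j))) ` {(i, j). i < h \<and> j < h \<and> i \<noteq> j}"
  have "finite {(i, j). i < h \<and> j < h \<and> i \<noteq> j}"
    by (rule finite_subset[of _ "{..<h} \<times> {..<h}"]) auto
  then have "finite P" by (simp add: P_def)
  moreover have "\<alpha> \<noteq> 0" if "(\<alpha>, \<beta>) \<in> P" for \<alpha> \<beta>
    using that u by (auto simp: P_def inj_on_def)
  ultimately have "connected {t \<in> S. \<forall>(\<alpha>, \<beta>) \<in> P. \<alpha> + t * \<beta> \<noteq> 0}"
    using S by (intro connected_avoiding_zeros) auto
  moreover have "(\<forall>(\<alpha>, \<beta>) \<in> P. \<alpha> + t * \<beta> \<noteq> 0) \<longleftrightarrow>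
      inj_on (\<lambda>j. u j + t * (v j - u j)) {..<h}" for t
  proof -
    have 1: "(u i - u j) + t * ((v i - u i) - (v j - u j)) =
        (u i + t * (v i - u i)) - (u j + t * (v j - u j))" for i j
      by (simp add: algebra_simps)
    have "(\<forall>(\<alpha>, \<beta>) \<in> P. \<alpha> + t * \<beta> \<noteq> 0) \<longleftrightarrow>
      (\<forall>i j. i < h \<and> j < h \<and> i \<noteq> j \<longrightarrow> (u i - u j) + t * ((v i - u i) - (v j - u j)) \<noteq> 0)"
      unfolding P_def ball_image_pairs ..
    then show ?thesis unfolding 1 inj_on_def right_minus_eq by blast
  qed
  ultimately show ?thesis by simp
qed

definition symmetric_classes :: "nat \<Rightarrow> nat \<Rightarrow> complex option set set set" where
  "symmetric_classes n e = {moduli_class A | A. card A = n \<and> has_symmetry_fixing e A}"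

lemma symmetric_classesI:
  "card A = n \<Longrightarrow> has_symmetry_fixing e A \<Longrightarrow> moduli_class A \<in> symmetric_classes n e"
  unfolding symmetric_classes_def by blast

definition orbit_points :: "complex \<Rightarrow> nat \<Rightarrow> nat \<Rightarrow> (nat \<Rightarrow> complex) \<Rightarrow> complex option set" where
  "orbit_points w m k a = (\<lambda>(l, j). Some (w ^ l * a j)) ` ({..<m} \<times> {..<k})"

text \<open>The points \<open>a 0, ..., a (k - 1)\<close> represent \<open>k\<close> different orbits, each with \<open>m\<close> elements, of the rotation
by \<open>w\<close>.\<close>
definition separated_orbits :: "complex \<Rightarrow> nat \<Rightarrow> nat \<Rightarrow> (nat \<Rightarrow> complex) \<Rightarrow> bool" where
  "separated_orbits w m k a \<longleftrightarrow>
     (\<forall>j<k. a j \<noteq> 0) \<and>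
     (\<forall>l<m. \<forall>i<k. \<forall>l'<m. \<forall>j<k. w ^ l * a i = w ^ l' * a j \<longrightarrow> l = l' \<and> i = j)"

lemma orbit_pointsI: "l < m \<Longrightarrow> j < k \<Longrightarrow> Some (w ^ l * a j) \<in> orbit_points w m k a"
  unfolding orbit_points_def by force

lemma orbit_points_symmetry:
  assumes w: "w \<noteq> 1" "w ^ m = 1" "m > 0" and a: "separated_orbits w m k a" and e: "e \<le> 2"
  shows "has_symmetry_fixing e (poles e \<union> orbit_points w m k a)"
    and "card (poles e \<union> orbit_points w m k a) = e + m * k"
proof -
  have w0: "w \<noteq> 0" using root_of_unity_nonzero[OF w(2,3)] .
  have zero: "None \<notin> orbit_points w m k a" "Some 0 \<notin> orbit_points w m k a"
    using a w0 by (auto simp: orbit_points_def separated_orbits_def)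
  have fin: "finite (poles e)" "finite (orbit_points w m k a)"
    by (auto simp: poles_def orbit_points_def)
  have "rotation w ` orbit_points w m k a \<subseteq> orbit_points w m k a"
  proof
    fix y assume "y \<in> rotation w ` orbit_points w m k a"
    then obtain l j where lj: "l < m" "j < k" "y = Some (w * (w ^ l * a j))"
      by (auto simp: orbit_points_def moebius_map_affine)
    show "y \<in> orbit_points w m k a"
    proof (cases "Suc l = m")
      case True
      then have "y = Some (w ^ 0 * a j)" using lj w(2) by (auto simp: mult.assoc[symmetric])
      then show ?thesis using lj(2) w(3) by (simp only: orbit_pointsI)
    next
      case False
      then have "y = Some (w ^ Suc l * a j)" "Suc l < m" using lj by (auto simp: mult.assoc)
      then show ?thesis using lj(2) by (simp only: orbit_pointsI)
    qed
  qed
  moreover have "rotation w ` poles e \<subseteq> poles e"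
    by (auto simp: poles_def moebius_map_affine)
  moreover have "(poles e \<union> orbit_points w m k a) \<inter> {None, Some 0} = poles e"
    using zero by (auto simp: poles_def)
  ultimately show "has_symmetry_fixing e (poles e \<union> orbit_points w m k a)"
    using fin e w w0 by (intro rotation_imp_symmetry[of _ w]) auto
  have "poles e \<inter> orbit_points w m k a = {}" using zero by (auto simp: poles_def)
  moreover have "card (poles e) = e" using e by (auto simp: poles_def)
  moreover have "card (orbit_points w m k a) = m * k"
  proof -
    have "inj_on (\<lambda>(l, j). Some (w ^ l * a j)) ({..<m} \<times> {..<k})"
      using a by (auto simp: separated_orbits_def inj_on_def)
    then show ?thesis by (simp add: orbit_points_def card_image)
  qed
  ultimately show "card (poles e \<union> orbit_points w m k a) = e + m * k"
    using fin by (simp add: card_Un_disjoint)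
qed

text \<open>The representatives of the orbits are moved along complex lines and the rest of each orbit follows,
so the symmetry persists.\<close>
lemma orbit_points_connected:
  assumes w: "w \<noteq> 1" "w ^ m = 1" "m > 0" "inj_on (\<lambda>l. w ^ l) {..<m}"
    and u: "separated_orbits w m k u" and v: "separated_orbits w m k v"
    and e: "e \<le> 2" and n: "n = e + m * k"
  shows "connected_component_of (subtopology (moduli_unordered n) (symmetric_classes n e))
     (moduli_class (poles e \<union> orbit_points w m k u)) (moduli_class (poles e \<union> orbit_points w m k v))"
proof -
  have w0: "w \<noteq> 0" using root_of_unity_nonzero[OF w(2,3)] .
  define a where "a t j = u j + t * (v j - u j)" for t j
  define P where "P = (\<lambda>j. (u j, v j - u j)) ` {..<k} \<union>
     (\<lambda>((l, i), (l', j)). (w ^ l * u i - w ^ l' * u j, w ^ l * (v i - u i) - w ^ l' * (v j - u j))) `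
       {((l, i), (l', j)). l < m \<and> i < k \<and> l' < m \<and> j < k \<and> i \<noteq> j}"
  define D where "D = {t \<in> UNIV. \<forall>(\<alpha>, \<beta>) \<in> P. \<alpha> + t * \<beta> \<noteq> 0}"
  have "finite {((l, i), (l', j)). l < m \<and> i < k \<and> l' < m \<and> j < k \<and> i \<noteq> j}"
    by (rule finite_subset[of _ "({..<m} \<times> {..<k}) \<times> ({..<m} \<times> {..<k})"]) auto
  then have "finite P" by (simp add: P_def)
  moreover have "\<alpha> \<noteq> 0" if "(\<alpha>, \<beta>) \<in> P" for \<alpha> \<beta>
    using that u by (fastforce simp: P_def separated_orbits_def)
  ultimately have D: "connected D"
    unfolding D_def by (intro connected_avoiding_zeros) auto
  have separated_iff: "separated_orbits w m k (a t) \<longleftrightarrow> t \<in> D" for t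
  proof
    assume sep: "separated_orbits w m k (a t)"
    have "u j + t * (v j - u j) \<noteq> 0" if "j < k" for j
      using sep that by (auto simp: separated_orbits_def a_def)
    moreover have "(w ^ l * u i - w ^ l' * u j) + t * (w ^ l * (v i - u i) - w ^ l' * (v j - u j)) \<noteq> 0"
      if "l < m" "i < k" "l' < m" "j < k" "i \<noteq> j" for l i l' j
    proof -
      have "w ^ l * a t i - w ^ l' * a t j \<noteq> 0"
        using sep that by (auto simp: separated_orbits_def)
      then show ?thesis by (simp add: a_def algebra_simps)
    qed
    ultimately show "t \<in> D" by (auto simp: D_def P_def)
  next
    assume t: "t \<in> D"
    have nz: "a t j \<noteq> 0" if "j < k" for j
      using t that by (auto simp: D_def P_def a_def)
    have "l = l' \<and> i = j" if "l < m" "i < k" "l' < m" "j < k" "w ^ l * a t i = w ^ l' * a t j"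
      for l i l' j
    proof (cases "i = j")
      case True
      then show ?thesis using that nz[of j] inj_onD[OF w(4), of l l'] by simp
    next
      case False
      then have "(w ^ l * u i - w ^ l' * u j, w ^ l * (v i - u i) - w ^ l' * (v j - u j)) \<in> P"
        using that by (force simp: P_def)
      then have "(w ^ l * u i - w ^ l' * u j) + t * (w ^ l * (v i - u i) - w ^ l' * (v j - u j)) \<noteq> 0"
        using t by (auto simp: D_def)
      then have "w ^ l * a t i - w ^ l' * a t j \<noteq> 0"
        by (simp add: a_def algebra_simps)
      with that show ?thesis by simp
    qed
    then show "separated_orbits w m k (a t)"
      using nz by (auto simp: separated_orbits_def)
  qed
  define I where "I = Inl ` poles e \<union> Inr ` ({..<m} \<times> {..<k})"
  define f where "f t = case_sum id (\<lambda>(l, j). Some (w ^ l * a t j))" for t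
  have f_image: "f t ` I = poles e \<union> orbit_points w m k (a t)" for t
    by (simp add: f_def I_def image_Un image_image orbit_points_def)
  have "finite I" by (simp add: I_def poles_def)
  moreover have cardI: "card I = n"
  proof -
    have "card I = card (poles e) + m * k"
      unfolding I_def by (subst card_Un_disjoint) (auto simp: card_image poles_def)
    then show ?thesis using e n by (auto simp: poles_def)
  qed
  moreover have "inj_on (f t) I" if "t \<in> D" for t
  proof (rule eq_card_imp_inj_on)
    have "separated_orbits w m k (a t)" using that separated_iff by blast
    then show "card (f t ` I) = card I"
      using orbit_points_symmetry(2)[OF w(1-3) _ e] n cardI f_image by simp
  qed fact
  moreover have "continuous_map (top_of_set D) riemann_sphere (\<lambda>t. f t i)" if "i \<in> I" for i
  proof (cases i)
    case (Inl p)
    then show ?thesis by (simp add: f_def)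
  next
    case (Inr lj)
    then show ?thesis unfolding f_def
      by (cases lj) (auto simp: a_def intro!: continuous_map_Some_comp continuous_intros)
  qed
  ultimately have "connectedin (moduli_unordered n) ((\<lambda>t. moduli_class (f t ` I)) ` D)"
    by (intro connectedin_moving_points D)
  moreover have "(\<lambda>t. moduli_class (f t ` I)) ` D \<subseteq> symmetric_classes n e"
  proof
    fix c assume "c \<in> (\<lambda>t. moduli_class (f t ` I)) ` D"
    then obtain t where t: "t \<in> D" "c = moduli_class (f t ` I)" by blast
    then have "separated_orbits w m k (a t)" using separated_iff by blast
    then show "c \<in> symmetric_classes n e"
      using orbit_points_symmetry[OF w(1-3) _ e] n unfolding t(2) f_image
      by (intro symmetric_classesI) simp_all
  qed
  moreover have a01: "a 0 = u" "a 1 = v"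
    by (simp_all add: a_def fun_eq_iff)
  moreover have "0 \<in> D" "1 \<in> D"
    using u v separated_iff[of 0] separated_iff[of 1] a01 by simp_all
  then have "moduli_class (f 0 ` I) \<in> (\<lambda>t. moduli_class (f t ` I)) ` D"
    "moduli_class (f 1 ` I) \<in> (\<lambda>t. moduli_class (f t ` I)) ` D"
    by blast+
  ultimately show ?thesis
    unfolding connected_component_of_def connectedin_subtopology
    by (intro exI[of _ "(\<lambda>t. moduli_class (f t ` I)) ` D"]) (simp add: f_image)
qed

lemma root_of_unity_power:
  assumes "w ^ m = (1::complex)"
  shows "(w ^ l) ^ m = 1" "(w ^ l * z) ^ m = z ^ m"
proof -
  have "(w ^ l) ^ m = (w ^ m) ^ l"
    by (simp only: power_mult[symmetric] mult.commute)
  then show "(w ^ l) ^ m = 1" using assms by simp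
  then show "(w ^ l * z) ^ m = z ^ m" by (simp add: power_mult_distrib)
qed

text \<open>The order \<open>m\<close> of \<open>w\<close> is the length of every orbit in the punctured plane, and two points lie in the
same orbit iff they have the same \<open>m\<close>-th power; one root of each such power is chosen.\<close>
lemma rotation_orbit_decomposition:
  assumes B: "finite B" and w: "w \<noteq> 1" "N > 0" "w ^ N = 1"
    and inv: "rotation w ` B = B" and poles: "B \<inter> {None, Some 0} = poles e"
  obtains m k a where "m > 0" "w ^ m = 1" "inj_on (\<lambda>l. w ^ l) {..<m}"
    "separated_orbits w m k a" "B = poles e \<union> orbit_points w m k a"
proof -
  define m where "m = (LEAST m. m > 0 \<and> w ^ m = 1)"
  have "m > 0 \<and> w ^ m = 1"
    unfolding m_def by (rule LeastI[of _ N]) (use w in simp)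
  then have m: "m > 0" "w ^ m = 1" by auto
  have least: "m \<le> i" if "i > 0" "w ^ i = 1" for i
    unfolding m_def by (rule Least_le) (use that in simp)
  have w0: "w \<noteq> 0" using root_of_unity_nonzero[OF m(2,1)] .
  have ne: "w ^ i \<noteq> w ^ j" if "i < j" "j < m" for i j
  proof
    assume "w ^ i = w ^ j"
    moreover have "w ^ j = w ^ i * w ^ (j - i)"
      using that by (simp flip: power_add)
    ultimately have "w ^ i * 1 = w ^ i * w ^ (j - i)" by simp
    then have "w ^ (j - i) = 1" using w0 by simp
    with least[of "j - i"] that show False by simp
  qed
  have inj: "inj_on (\<lambda>l. w ^ l) {..<m}"
    using ne by (intro inj_onI) (metis lessThan_iff nat_neq_iff)
  have roots: "(\<lambda>l. w ^ l) ` {..<m} = {z. z ^ m = 1}"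
  proof (rule card_subset_eq)
    show "finite {z::complex. z ^ m = 1}" using m(1) by (intro finite_roots_unity) simp
    show "(\<lambda>l. w ^ l) ` {..<m} \<subseteq> {z. z ^ m = 1}"
      using root_of_unity_power(1)[OF m(2)] by auto
    show "card ((\<lambda>l. w ^ l) ` {..<m}) = card {z::complex. z ^ m = 1}"
      using inj m(1) by (simp add: card_image card_roots_unity_eq)
  qed
  define Z where "Z = {z. z \<noteq> 0 \<and> Some z \<in> B}"
  have B_eq: "B = poles e \<union> Some ` Z"
  proof (rule set_eqI)
    show "p \<in> B \<longleftrightarrow> p \<in> poles e \<union> Some ` Z" for p
    proof (cases "p \<in> {None, Some 0}")
      case True
      then show ?thesis using poles by (auto simp: Z_def)
    next
      case False
      then have "p \<notin> poles e" by (auto simp: poles_def split: if_splits)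
      then show ?thesis using False by (cases p) (auto simp: Z_def)
    qed
  qed
  have "Some ` Z \<subseteq> B" by (auto simp: Z_def)
  then have "finite Z" using B finite_subset finite_image_iff inj_Some by (metis inj_on_subset subset_UNIV)
  have step: "w * z \<in> Z" if "z \<in> Z" for z
  proof -
    have "rotation w (Some z) \<in> B" using that inv by (auto simp: Z_def)
    then show ?thesis using that w0 by (simp add: Z_def moebius_map_affine)
  qed
  have pow: "w ^ l * z \<in> Z" if "z \<in> Z" for l z
    using that by (induction l) (auto simp: step mult.assoc)
  define Q where "Q = (\<lambda>z. z ^ m) ` Z"
  obtain h where h: "bij_betw h {..<card Q} Q"
    using \<open>finite Z\<close> bij_betw_from_nat_into_finite[of Q] by (auto simp: Q_def)
  define a where "a j = (SOME z. z \<in> Z \<and> z ^ m = h j)" for j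
  have a: "a j \<in> Z" "a j ^ m = h j" if "j < card Q" for j
  proof -
    have "h j \<in> Q" using h that by (auto simp: bij_betw_def)
    then have "\<exists>z. z \<in> Z \<and> z ^ m = h j" by (auto simp: Q_def)
    then show "a j \<in> Z" "a j ^ m = h j" unfolding a_def by (metis (mono_tags, lifting) someI_ex)+
  qed
  have a0: "a j \<noteq> 0" if "j < card Q" for j using a(1)[OF that] by (simp add: Z_def)
  note wl = root_of_unity_power(2)[OF m(2)]
  have sep: "separated_orbits w m (card Q) a"
    unfolding separated_orbits_def
  proof (intro conjI allI impI)
    fix l i l' j assume *: "l < m" "i < card Q" "l' < m" "j < card Q" "w ^ l * a i = w ^ l' * a j"
    then have "h i = h j" using a(2) wl by metis
    then show "i = j" using h * by (auto simp: bij_betw_def inj_on_def)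
    then show "l = l'" using * a0 inj by (auto simp: inj_on_def)
  qed (use a0 in auto)
  have "Z = {w ^ l * a j | l j. l < m \<and> j < card Q}"
  proof (intro equalityI subsetI)
    fix z assume z: "z \<in> Z"
    then have "z ^ m \<in> Q" by (simp add: Q_def)
    then obtain j where j: "j < card Q" "z ^ m = h j" using h by (auto simp: bij_betw_def)
    then have "(z / a j) ^ m = 1" using a(2)[OF j(1)] a0[OF j(1)]
      by (metis divide_self_if power_divide power_not_zero)
    then obtain l where "l < m" "z / a j = w ^ l" using roots by auto
    then show "z \<in> {w ^ l * a j | l j. l < m \<and> j < card Q}" using j a0[OF j(1)]
      by (auto simp: divide_eq_eq)
  qed (use pow a in auto)
  then have "Some ` Z = orbit_points w m (card Q) a"
    by (force simp: orbit_points_def)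
  with B_eq sep m inj show ?thesis using that by blast
qed

text \<open>The common target of the deformations: the \<open>m k\<close>-th roots of unity are \<open>k\<close> orbits of any rotation of
order \<open>m\<close>.\<close>
lemma roots_of_unity_orbit_points:
  assumes "w ^ m = 1" "inj_on (\<lambda>l. w ^ l) {..<m}" "m > 0" "k > 0"
  obtains v where "separated_orbits w m k v"
    "orbit_points w m k v = Some ` {z. z ^ (m * k) = 1}"
proof -
  define v where "v j = cis (2 * pi * real j / real (m * k))" for j
  have vm: "v j ^ m = cis (2 * pi * real j / real k)" for j
  proof -
    have "real m * (2 * pi * real j / real (m * k)) = 2 * pi * real j / real k"
      using assms(3,4) by (simp add: field_simps)
    then show ?thesis by (simp only: v_def Complex.DeMoivre)
  qed
  have injv: "i = j" if "v i ^ m = v j ^ m" "i < k" "j < k" for i j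
    using Complex.bij_betw_roots_unity[OF assms(4)] that unfolding vm bij_betw_def
    by (auto dest: inj_onD)
  note wl = root_of_unity_power(2)[OF assms(1)]
  have sep: "separated_orbits w m k v"
    unfolding separated_orbits_def
  proof (intro conjI allI impI)
    show "v j \<noteq> 0" for j by (simp add: v_def)
    fix l i l' j assume *: "l < m" "i < k" "l' < m" "j < k" "w ^ l * v i = w ^ l' * v j"
    then have "v i ^ m = v j ^ m" using wl by metis
    then show "i = j" using injv * by blast
    then show "l = l'" using * assms(2) by (auto simp: inj_on_def v_def)
  qed
  have inj: "inj_on (\<lambda>(l, j). w ^ l * v j) ({..<m} \<times> {..<k})"
    using sep by (auto simp: separated_orbits_def inj_on_def)
  have "(\<lambda>(l, j). w ^ l * v j) ` ({..<m} \<times> {..<k}) = {z. z ^ (m * k) = 1}"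
  proof (rule card_subset_eq)
    show "finite {z::complex. z ^ (m * k) = 1}"
      using assms by (intro finite_roots_unity) simp
    have "(w ^ l * v j) ^ (m * k) = 1" for l j
    proof -
      have "(w ^ l * v j) ^ (m * k) = ((w ^ l * v j) ^ m) ^ k" by (rule power_mult)
      also have "\<dots> = cis (2 * pi * real j)" using assms(4) unfolding wl vm by (simp add: Complex.DeMoivre)
      also have "\<dots> = 1" using cis_multiple_2pi[of "real j"] by (simp add: mult.commute mult.left_commute)
      finally show ?thesis .
    qed
    then show "(\<lambda>(l, j). w ^ l * v j) ` ({..<m} \<times> {..<k}) \<subseteq> {z. z ^ (m * k) = 1}" by auto
    show "card ((\<lambda>(l, j). w ^ l * v j) ` ({..<m} \<times> {..<k})) = card {z::complex. z ^ (m * k) = 1}"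
      using inj assms card_roots_unity_eq[of "m * k"] by (simp add: card_image)
  qed
  moreover have "orbit_points w m k v = Some ` (\<lambda>(l, j). w ^ l * v j) ` ({..<m} \<times> {..<k})"
    by (simp add: orbit_points_def image_image case_prod_unfold)
  ultimately have "orbit_points w m k v = Some ` {z. z ^ (m * k) = 1}" by simp
  then show ?thesis by (rule that[OF sep])
qed

text \<open>The common base point of the family with parameter \<open>e\<close>, for rotations of all orders.\<close>
definition polygon :: "nat \<Rightarrow> nat \<Rightarrow> complex option set" where
  "polygon n e = poles e \<union> Some ` {z. z ^ (n - e) = 1}"

lemma finite_polygon: "n > e \<Longrightarrow> finite (polygon n e)"
  unfolding polygon_def by (intro finite_UnI finite_imageI finite_roots_unity) (auto simp: poles_def)

lemma card_polygon:
  assumes "n > e" "e \<le> 2"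
  shows "card (polygon n e) = n"
proof -
  have "poles e \<inter> Some ` {z. z ^ (n - e) = 1} = {}"
    using assms by (auto simp: poles_def zero_power)
  moreover have "card (poles e) = e" "finite (poles e)" using assms by (auto simp: poles_def)
  moreover have "card (Some ` {z::complex. z ^ (n - e) = 1}) = n - e"
    using assms by (simp add: card_image card_roots_unity_eq)
  moreover have "finite {z::complex. z ^ (n - e) = 1}"
    using assms by (intro finite_roots_unity) simp
  ultimately show ?thesis using assms by (simp add: polygon_def card_Un_disjoint)
qed

lemma polygon_symmetry:
  assumes "n \<ge> e + 2" "e \<le> 2"
  shows "has_symmetry_fixing e (polygon n e)"
proof (rule rotation_imp_symmetry)
  define N where "N = n - e"
  define w where "w = cis (2 * pi * real 1 / real N)"
  have N: "N \<ge> 2" using assms by (simp add: N_def)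
  have inj: "inj_on (\<lambda>k. cis (2 * pi * real k / real N)) {..<N}"
    using N by (intro bij_betw_imp_inj_on[OF Complex.bij_betw_roots_unity]) simp
  have "w \<noteq> cis (2 * pi * real 0 / real N)"
    unfolding w_def using inj_onD[OF inj, of 1 0] N by auto
  then show "w \<noteq> 1" by simp
  show "w \<noteq> 0" by (simp add: w_def)
  have "w ^ N = cis (2 * pi * real 1)" using N by (simp add: w_def Complex.DeMoivre)
  then have "w ^ N = 1" by simp
  then show "rotation w ` polygon n e \<subseteq> polygon n e"
    by (auto simp: polygon_def poles_def moebius_map_affine N_def power_mult_distrib)
  show "polygon n e \<inter> {None, Some 0} = poles e"
    using assms by (auto simp: polygon_def poles_def zero_power)
  show "finite (polygon n e)" using assms by (intro finite_polygon) simp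
qed fact

text \<open>This is where the family \<open>e = 0\<close>, to which the polygon belongs by its rotations, meets the family
\<open>e = 2\<close>: the inversion \<open>1/z\<close> fixes the two vertices \<open>1\<close> and \<open>-1\<close>.\<close>
lemma polygon_inversion_symmetry:
  assumes "even n" "n \<ge> 4"
  shows "has_symmetry_fixing 2 (polygon n 0)"
proof -
  let ?J = "moebius_map 0 1 1 0"
  have J: "?J \<in> Moeb" by (rule MoebI) simp
  have "?J None \<noteq> None" by (simp add: moebius_map_inversion)
  then have "?J \<noteq> id" by (metis id_apply)
  have fin: "finite (polygon n 0)" using assms by (intro finite_polygon) simp
  have "?J ` polygon n 0 \<subseteq> polygon n 0"
    using assms by (auto simp: polygon_def poles_def moebius_map_inversion power_inverse zero_power)
  then have "?J ` polygon n 0 = polygon n 0"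
    using image_eq_self[OF fin Moeb_inj[OF J]] by blast
  moreover have "{x \<in> polygon n 0. ?J x = x} = {Some 1, Some (- 1)}"
  proof (intro equalityI subsetI)
    fix x assume x: "x \<in> {x \<in> polygon n 0. ?J x = x}"
    then obtain z where z: "x = Some z" "z \<noteq> 0" "inverse z = z"
      by (cases x) (auto simp: moebius_map_inversion split: if_splits)
    then have "z * z = 1" by (metis right_inverse)
    then show "x \<in> {Some 1, Some (- 1)}" using z by (simp add: square_eq_1_iff)
  next
    fix x assume "x \<in> {Some 1, Some (- 1) :: complex option}"
    then show "x \<in> {x \<in> polygon n 0. ?J x = x}"
      using assms by (auto simp: polygon_def moebius_map_inversion)
  qed
  ultimately show ?thesis
    unfolding has_symmetry_fixing_def using J \<open>?J \<noteq> id\<close> by (intro bexI[of _ ?J]) auto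
qed

text \<open>The polygon depends on \<open>n\<close> and \<open>e\<close> but not on the order \<open>m\<close> of the rotation, which may be any divisor of
\<open>n - e\<close>; so one base point serves all symmetries of the family.\<close>
lemma symmetric_class_connected_to_polygon:
  assumes c: "c \<in> symmetric_classes n e" and n: "n \<ge> 3"
  shows "connected_component_of (subtopology (moduli_unordered n) (symmetric_classes n e))
     c (moduli_class (polygon n e))"
proof -
  obtain A where A: "c = moduli_class A" "card A = n" "has_symmetry_fixing e A"
    using c by (auto simp: symmetric_classes_def)
  have finA: "finite A" using A n by (metis card.infinite not_numeral_le_zero)
  obtain N w k where N: "N \<in> Moeb" "w \<noteq> 0" "w \<noteq> 1" "k > 0" "w ^ k = 1"
    "rotation w ` N ` A = N ` A" "N ` A \<inter> {None, Some 0} = poles e" "e \<le> 2"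
    using symmetry_normal_form[OF finA _ A(3)] A(2) n by metis
  obtain m k a where a: "m > 0" "w ^ m = 1" "inj_on (\<lambda>l. w ^ l) {..<m}"
    "separated_orbits w m k a" "N ` A = poles e \<union> orbit_points w m k a"
    using rotation_orbit_decomposition[OF _ N(3-7)] finA by (metis finite_imageI)
  have "card (N ` A) = n" using A(2) Moeb_inj[OF N(1)] by (simp add: card_image inj_on_subset)
  then have n_eq: "n = e + m * k"
    using orbit_points_symmetry(2)[OF N(3) a(2,1,4) N(8)] a(5) by simp
  then have "k > 0" using n N(8) by (cases k) auto
  then obtain v where v: "separated_orbits w m k v" "orbit_points w m k v = Some ` {z. z ^ (m * k) = 1}"
    using roots_of_unity_orbit_points[OF a(2,3,1)] by blast
  have "moduli_class (N ` A) = c" using A(1) moduli_class_image[OF N(1)] by simp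
  then show ?thesis
    using orbit_points_connected[OF N(3) a(2,1,3,4) v(1) N(8) n_eq] a(5) v(2) n_eq
    by (simp add: polygon_def)
qed

section \<open>A counting argument for finite transformation groups\<close>

text \<open>A finite group of permutations of the whole type, given as a set of functions. It is used for
the symmetry group of a point set and for stabilizers in it.\<close>
locale transformation_group =
  fixes G :: "('a \<Rightarrow> 'a) set"
  assumes finite_G: "finite G"
    and id_G: "id \<in> G"
    and comp_G: "g \<in> G \<Longrightarrow> h \<in> G \<Longrightarrow> g \<circ> h \<in> G"
    and bij_G: "g \<in> G \<Longrightarrow> bij g"
    and inv_G: "g \<in> G \<Longrightarrow> inv g \<in> G"
begin

definition stab :: "'a \<Rightarrow> ('a \<Rightarrow> 'a) set" where
  "stab x = {g \<in> G. g x = x}"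

definition orb :: "'a \<Rightarrow> 'a set" where
  "orb x = (\<lambda>g. g x) ` G"

lemma inv_simps [simp]:
  assumes "g \<in> G"
  shows "g (inv g x) = x" "inv g (g x) = x"
  using bij_G[OF assms] by (simp_all add: bij_is_surj surj_f_inv_f bij_is_inj)

lemma finite_stab: "finite (stab x)" and finite_orb: "finite (orb x)"
  using finite_G by (auto simp: stab_def orb_def)

lemma orb_self: "x \<in> orb x"
  unfolding orb_def using id_G by (intro image_eqI[of _ _ id]) simp_all

lemma card_fibre:
  assumes "g \<in> G"
  shows "card {f \<in> G. f x = g x} = card (stab x)"
proof (rule bij_betw_same_card[symmetric], rule bij_betwI[where g = "\<lambda>f. inv g \<circ> f"])
  show "(\<lambda>f. g \<circ> f) \<in> stab x \<rightarrow> {f \<in> G. f x = g x}"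
    using assms comp_G by (auto simp: stab_def)
  show "(\<lambda>f. inv g \<circ> f) \<in> {f \<in> G. f x = g x} \<rightarrow> stab x"
    using assms comp_G inv_G by (auto simp: stab_def)
  show "inv g \<circ> (g \<circ> f) = f" "g \<circ> (inv g \<circ> f) = f" for f
    using assms by (auto simp: fun_eq_iff)
qed

lemma orbit_stabilizer: "card (orb x) * card (stab x) = card G"
proof -
  have "card G = card (\<Union>y \<in> orb x. {f \<in> G. f x = y})"
    by (rule arg_cong[where f = card]) (auto simp: orb_def)
  also have "\<dots> = (\<Sum>y \<in> orb x. card {f \<in> G. f x = y})"
    using finite_G finite_orb by (intro card_UN_disjoint) auto
  also have "\<dots> = (\<Sum>y \<in> orb x. card (stab x))"
    by (rule sum.cong) (auto simp: orb_def card_fibre)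
  finally show ?thesis by simp
qed

lemma card_stab_orb:
  assumes "y \<in> orb x"
  shows "card (stab y) = card (stab x)"
proof -
  obtain h where h: "h \<in> G" "y = h x" using assms by (auto simp: orb_def)
  show ?thesis
  proof (rule bij_betw_same_card[symmetric], rule bij_betwI[where g = "\<lambda>f. inv h \<circ> f \<circ> h"])
    show "(\<lambda>f. h \<circ> f \<circ> inv h) \<in> stab x \<rightarrow> stab y"
      using h comp_G inv_G by (auto simp: stab_def)
    show "(\<lambda>f. inv h \<circ> f \<circ> h) \<in> stab y \<rightarrow> stab x"
      using h comp_G inv_G by (auto simp: stab_def)
    show "inv h \<circ> (h \<circ> f \<circ> inv h) \<circ> h = f" "h \<circ> (inv h \<circ> f \<circ> h) \<circ> inv h = f" for f
      using h by (auto simp: fun_eq_iff)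
  qed
qed

lemma orb_trans: "h \<in> G \<Longrightarrow> x \<in> orb y \<Longrightarrow> h x \<in> orb y"
proof -
  assume "h \<in> G" "x \<in> orb y"
  then obtain g where "g \<in> G" "x = g y" by (auto simp: orb_def)
  then show "h x \<in> orb y"
    using comp_G[OF \<open>h \<in> G\<close>, of g] unfolding orb_def by (intro image_eqI[of _ _ "h \<circ> g"]) simp_all
qed

lemma orb_sym:
  assumes "x \<in> orb y"
  shows "y \<in> orb x"
proof -
  obtain h where "h \<in> G" "x = h y" using assms by (auto simp: orb_def)
  then have "inv h \<in> G" "inv h x = y" using inv_G by auto
  then show ?thesis unfolding orb_def by force
qed

lemma conjugate_mem: "h \<in> G \<Longrightarrow> g \<in> G \<Longrightarrow> h \<circ> g \<circ> inv h \<in> G"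
  by (intro comp_G inv_G)

lemma conjugate_ne_id:
  assumes "h \<in> G" "g \<noteq> id"
  shows "h \<circ> g \<circ> inv h \<noteq> id"
proof
  assume *: "h \<circ> g \<circ> inv h = id"
  have "g x = x" for x
  proof -
    have "(h \<circ> g \<circ> inv h) (h x) = h x" by (simp add: *)
    then have "h (g x) = h x" using assms by simp
    then show ?thesis using assms by (metis inv_simps(2))
  qed
  then show False using assms(2) by auto
qed

text \<open>The combinatorial core of the classification of the finite rotation groups. Let \<open>e\<close> be the order of the
stabilizer of \<open>p\<close> and \<open>k\<close> the length of its orbit. The stabilizers of the points of the orbit meet only in
the identity, as the second fixed point \<open>q\<close> lies outside the orbit; so they cover all
elements but a set \<open>R\<close> of \<open>k - 1\<close>. If \<open>k > 1\<close>, pick \<open>r \<in> R\<close> and a fixed point \<open>y\<close> of \<open>r\<close>. All nonidentity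
elements fixing a point of the orbit of \<open>y\<close> are in \<open>R\<close>, and each fixes only two points, so
\<open>card (orb y) * (s - 1) \<le> 2 (k - 1)\<close> for the order \<open>s \<ge> 2\<close> of the stabilizer of \<open>y\<close>. As \<open>card (orb y) * s = k e\<close>,
this gives \<open>k e \<le> 4 (k - 1)\<close>, impossible for \<open>e \<ge> 4\<close>.\<close>
theorem large_stabilizer_fixes_point:
  assumes fix2: "\<And>g. g \<in> G \<Longrightarrow> g \<noteq> id \<Longrightarrow> card {x. g x = x} = 2"
    and fix_eq: "\<And>g h x. \<lbrakk>g \<in> G; h \<in> G; g \<noteq> id; h \<noteq> id; g x = x; h x = x\<rbrakk>
      \<Longrightarrow> {y. g y = y} = {y. h y = y}"
    and m: "m \<in> G" "{x. m x = x} = {p, q}" and q: "q \<notin> orb p"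
    and large: "card (stab p) \<ge> 4" and g: "g \<in> G"
  shows "g p = p"
proof -
  define P where "P = orb p"
  define k where "k = card P"
  define e where "e = card (stab p)"
  have mne: "m \<noteq> id"
  proof
    assume "m = id"
    then have "(UNIV :: 'a set) = {p, q}" using m(2) by auto
    then have UNIV: "x = p \<or> x = q" for x by blast
    have P: "P \<subseteq> {p}" using UNIV q unfolding P_def by blast
    have "f = id" if "f \<in> G" for f
    proof (rule ccontr)
      assume "f \<noteq> id"
      moreover have "f p = p" using P orb_trans[OF that orb_self[of p]] by (auto simp: P_def)
      moreover have "f q = q"
        using bij_G[OF that] \<open>f p = p\<close> UNIV orb_self by (metis bij_is_inj injD q)
      ultimately show False using UNIV by (metis eq_id_iff)
    qed
    then have "stab p \<subseteq> {id}" by (auto simp: stab_def)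
    then have "card (stab p) \<le> 1" 
      by (metis card_mono finite.emptyI finite.insertI is_singletonI is_singleton_altdef)
    with large show False by simp
  qed
  have disj: "f = id" if "f \<in> G" "x \<in> P" "y \<in> P" "x \<noteq> y" "f x = x" "f y = y" for f x y
  proof (rule ccontr)
    assume "f \<noteq> id"
    from that(2) obtain h where h: "h \<in> G" "x = h p" by (auto simp: P_def orb_def)
    define m' where "m' = h \<circ> m \<circ> inv h"
    have "m p = p" using m(2) by auto
    then have m': "m' \<in> G" "m' \<noteq> id" "m' x = x"
      using conjugate_mem[OF h(1) m(1)] conjugate_ne_id[OF h(1) mne] h by (simp_all add: m'_def)
    have "m' y = y"
      using fix_eq[OF that(1) m'(1) \<open>f \<noteq> id\<close> m'(2) that(5) m'(3)] that(6) by blast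
    then have "m (inv h y) = inv h y" using h(1) by (simp add: m'_def) (metis inv_simps(2))
    then have "inv h y \<in> {p, q}" using m(2) by blast
    moreover have "inv h y \<noteq> p" using that(4) h by (metis inv_simps(1))
    ultimately have "q = inv h y" by simp
    moreover have "inv h y \<in> orb p" using that(3) inv_G[OF h(1)] orb_trans by (simp add: P_def)
    ultimately show False using q by simp
  qed
  define R where "R = {f \<in> G. \<forall>x \<in> P. f x \<noteq> x}"
  have finP: "finite P" by (simp add: P_def finite_orb)
  have k1: "k \<ge> 1" using finP orb_self[of p] by (auto simp: k_def P_def Suc_le_eq card_gt_0_iff)
  have "card (\<Union>x \<in> P. stab x - {id}) = (\<Sum>x \<in> P. card (stab x - {id}))"
  proof (rule card_UN_disjoint)
    show "\<forall>x\<in>P. \<forall>y\<in>P. x \<noteq> y \<longrightarrow> (stab x - {id}) \<inter> (stab y - {id}) = {}"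
      using disj unfolding stab_def by blast
  qed (use finP finite_stab in auto)
  also have "\<dots> = (\<Sum>x \<in> P. e - 1)"
  proof (rule sum.cong)
    show "card (stab x - {id}) = e - 1" if "x \<in> P" for x
      using card_stab_orb[of x p] that id_G finite_stab[of x] by (simp add: P_def e_def stab_def)
  qed simp
  finally have cU: "card (\<Union>x \<in> P. stab x - {id}) = k * (e - 1)" by (simp add: k_def)
  have idU: "id \<notin> R" using orb_self[of p] by (auto simp: R_def P_def)
  have "G = insert id ((\<Union>x \<in> P. stab x - {id}) \<union> R)"
    using id_G by (auto simp: R_def stab_def)
  moreover have "card (insert id ((\<Union>x \<in> P. stab x - {id}) \<union> R)) = Suc (k * (e - 1) + card R)"
  proof -
    have "(\<Union>x \<in> P. stab x - {id}) \<inter> R = {}" by (auto simp: R_def stab_def)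
    moreover have "finite R" "finite (\<Union>x \<in> P. stab x - {id})"
      using finite_G finP finite_stab by (auto simp: R_def)
    ultimately show ?thesis using idU cU by (simp add: card_Un_disjoint)
  qed
  ultimately have "card G = Suc (k * (e - 1) + card R)" by simp
  moreover have cG: "card G = k * e" using orbit_stabilizer[of p] by (simp add: k_def P_def e_def)
  moreover have "k * e = k * (e - 1) + k"
  proof -
    have "e = (e - 1) + 1" using large by (simp add: e_def)
    then show ?thesis by (metis add_mult_distrib2 mult.right_neutral)
  qed
  ultimately have cR: "card R = k - 1" by simp
  have "k = 1"
  proof (rule ccontr)
    assume "k \<noteq> 1"
    then have "card R > 0" using cR k1 by simp
    then obtain r where r: "r \<in> R" by (metis card.empty ex_in_conv less_irrefl)
    have rG: "r \<in> G" "r \<noteq> id" using r idU by (auto simp: R_def)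
    then have "{x. r x = x} \<noteq> {}" using fix2[OF rG] by (metis card.empty zero_neq_numeral)
    then obtain y where y: "r y = y" by auto
    define s where "s = card (stab y)"
    have s2: "s \<ge> 2"
    proof -
      have "{id, r} \<subseteq> stab y" using rG id_G y by (auto simp: stab_def)
      then have "card {id, r} \<le> s" unfolding s_def using finite_stab by (intro card_mono)
      then show ?thesis using rG by simp
    qed
    have inR: "f \<in> R" if f: "f \<in> stab z" "f \<noteq> id" and z: "z \<in> orb y" for f z
    proof (rule ccontr)
      assume "f \<notin> R"
      then obtain x where x: "x \<in> P" "f x = x" using f by (auto simp: R_def stab_def)
      obtain h where h: "h \<in> G" "z = h y" using z by (auto simp: orb_def)
      define r' where "r' = h \<circ> r \<circ> inv h"
      have r': "r' \<in> G" "r' \<noteq> id" "r' z = z"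
        using conjugate_mem[OF h(1) rG(1)] conjugate_ne_id[OF h(1) rG(2)] h y by (simp_all add: r'_def)
      have "{y. f y = y} = {y. r' y = y}"
        using f r' by (intro fix_eq[where x = z]) (auto simp: stab_def)
      then have "r' x = x" using x by blast
      then have "r (inv h x) = inv h x" using h(1) by (simp add: r'_def) (metis inv_simps(2))
      moreover have "inv h x \<in> P" using x orb_trans inv_G[OF h(1)] by (simp add: P_def)
      ultimately show False using r by (auto simp: R_def)
    qed
    have Rfix: "card {x. f x = x} = 2" if "f \<in> R" for f
    proof (rule fix2)
      show "f \<noteq> id" using that idU by blast
      show "f \<in> G" using that by (simp add: R_def)
    qed
    then have Rfin: "finite {x. f x = x}" if "f \<in> R" for f
      using that by (metis card.infinite zero_neq_numeral)
    \<comment> \<open>the pairs of a point in the orbit of \<open>y\<close> and a nonidentity element fixing it\<close>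
    define T where "T = (SIGMA z:orb y. stab z - {id})"
    have finT: "finite T" unfolding T_def using finite_orb finite_stab by (intro finite_SigmaI) auto
    have "card T = (\<Sum>z \<in> orb y. card (stab z - {id}))"
      unfolding T_def using finite_orb finite_stab by (intro card_SigmaI) auto
    also have "\<dots> = (\<Sum>z \<in> orb y. s - 1)"
    proof (rule sum.cong)
      show "card (stab z - {id}) = s - 1" if "z \<in> orb y" for z
        using card_stab_orb[OF that] id_G finite_stab[of z] by (simp add: s_def stab_def)
    qed simp
    finally have cT: "card T = card (orb y) * (s - 1)" by simp
    have "card T \<le> card (SIGMA f:R. {x. f x = x})"
    proof -
      have "(\<lambda>(z, f). (f, z)) ` T \<subseteq> (SIGMA f:R. {x. f x = x})"
        using inR by (auto simp: T_def stab_def)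
      moreover have "inj_on (\<lambda>(z, f). (f, z)) T" by (auto simp: inj_on_def)
      moreover have "finite (SIGMA f:R. {x. f x = x})"
      proof (rule finite_SigmaI)
        show "finite R" using finite_G by (simp add: R_def)
        show "finite {x. f x = x}" if "f \<in> R" for f
          by (rule Rfin) fact
      qed
      ultimately show ?thesis using card_inj_on_le by blast
    qed
    also have "\<dots> = (\<Sum>f \<in> R. card {x. f x = x})"
    proof (rule card_SigmaI)
      show "finite R" using finite_G by (simp add: R_def)
      show "\<forall>f\<in>R. finite {x. f x = x}"
        using Rfin by blast
    qed
    also have "\<dots> = (\<Sum>f \<in> R. 2)"
      using Rfix by (intro sum.cong) auto
    finally have le: "card (orb y) * (s - 1) \<le> 2 * (k - 1)" using cT cR by simp
    have "k * e = card (orb y) * s" using cG orbit_stabilizer[of y] by (simp add: s_def)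
    also have "\<dots> \<le> card (orb y) * (2 * (s - 1))" using s2 by (intro mult_le_mono2) simp
    also have "\<dots> \<le> 4 * (k - 1)" using le by simp
    also have "\<dots> < k * 4" using k1 by simp
    also have "\<dots> \<le> k * e" using large by (simp add: e_def)
    finally show False by simp
  qed
  then have "P = {p}" using orb_self[of p] by (auto simp: k_def P_def card_1_singleton_iff)
  then show ?thesis using orb_trans[OF g orb_self[of p]] by (simp add: P_def)
qed

text \<open>All orbits have as many elements as the group.\<close>
lemma free_action_dvd:
  assumes "finite B" "\<And>f x. f \<in> G \<Longrightarrow> x \<in> B \<Longrightarrow> f x \<in> B"
    and "\<And>f x. \<lbrakk>f \<in> G; x \<in> B; f x = x\<rbrakk> \<Longrightarrow> f = id"
  shows "card G dvd card B"
proof -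
  have "card G dvd card (\<Union> (orb ` B))"
  proof (rule dvd_partition)
    show "finite (\<Union> (orb ` B))" using assms(1) finite_orb by auto
    show "\<forall>c\<in>orb ` B. card G dvd card c"
    proof
      fix c assume "c \<in> orb ` B"
      then obtain x where x: "x \<in> B" "c = orb x" by auto
      have "stab x = {id}" using assms(3)[OF _ x(1)] id_G by (auto simp: stab_def)
      then show "card G dvd card c" using orbit_stabilizer[of x] x by simp
    qed
    show "\<forall>c1\<in>orb ` B. \<forall>c2\<in>orb ` B. c1 \<noteq> c2 \<longrightarrow> c1 \<inter> c2 = {}"
    proof (intro ballI impI, rule ccontr)
      fix c1 c2 assume *: "c1 \<in> orb ` B" "c2 \<in> orb ` B" "c1 \<noteq> c2" "c1 \<inter> c2 \<noteq> {}"
      then obtain x y z where "c1 = orb x" "c2 = orb y" "z \<in> orb x" "z \<in> orb y" by auto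
      moreover have "orb a \<subseteq> orb b" if z: "z \<in> orb a" "z \<in> orb b" for a b z
      proof
        fix w assume "w \<in> orb a"
        then obtain f where "f \<in> G" "w = f a" by (auto simp: orb_def)
        moreover obtain h where "h \<in> G" "a = h z" using orb_sym[OF z(1)] by (auto simp: orb_def)
        ultimately show "w \<in> orb b" using orb_trans z(2) by blast
      qed
      ultimately show False using *(3) by blast
    qed
  qed
  moreover have "\<Union> (orb ` B) = B"
    using assms(2) orb_self by (auto simp: orb_def)
  ultimately show ?thesis by simp
qed

end

section \<open>A tetrahedral configuration\<close>

text \<open>The rotation of order 3 that permutes the vertices of the regular octahedron \<open>0, \<infinity>, \<plusminus>1, \<plusminus>\<i>\<close> by
\<open>\<infinity> \<rightarrow> 1 \<rightarrow> \<i> \<rightarrow> \<infinity>\<close> and \<open>0 \<rightarrow> -1 \<rightarrow> -\<i> \<rightarrow> 0\<close>. Together with \<open>-z\<close> and \<open>1/z\<close> it generates the tetrahedral group.\<close>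
definition tet :: "complex option \<Rightarrow> complex option" where
  "tet = moebius_map 1 \<i> 1 (- \<i>)"

abbreviation neg :: "complex option \<Rightarrow> complex option" where
  "neg \<equiv> moebius_map (- 1) 0 0 1"

abbreviation recip :: "complex option \<Rightarrow> complex option" where
  "recip \<equiv> moebius_map 0 1 1 0"

text \<open>Proportional matrices give the same map; this is needed to compare compositions.\<close>
lemma moebius_map_scale: "k \<noteq> 0 \<Longrightarrow> moebius_map (k * a) (k * b) (k * c) (k * d) = moebius_map a b c d"
proof
  fix p assume k: "k \<noteq> 0"
  obtain u v where p: "p = homog u v" "(u, v) \<noteq> (0, 0)" by (rule homog_cases)
  have "homog (k * x) (k * y) = homog x y" for x y using k by (simp add: homog_def)
  from this[of "a * u + b * v" "c * u + d * v"]
  show "moebius_map (k * a) (k * b) (k * c) (k * d) p = moebius_map a b c d p"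
    unfolding p(1) moebius_map_homog[OF p(2)] by (simp add: algebra_simps)
qed

lemma tet_Moeb: "tet \<in> Moeb" and neg_Moeb: "neg \<in> Moeb" and recip_Moeb: "recip \<in> Moeb"
  unfolding tet_def by (rule MoebI, simp add: complex_eq_iff)+

lemma tet_neg: "tet \<circ> neg = recip \<circ> tet"
  using moebius_map_scale[of "-1" 1 "-\<i>" 1 "\<i>"] by (simp add: tet_def moebius_map_comp)

lemma tet_recip: "tet \<circ> recip = neg \<circ> recip \<circ> tet"
  using moebius_map_scale[of "-\<i>" "-1" "\<i>" 1 "\<i>"]
  by (simp add: tet_def moebius_map_comp comp_assoc)

lemma tet_cube: "tet \<circ> tet \<circ> tet = id"
  using moebius_map_id[of "2 + 2 * \<i>"]
  by (simp add: tet_def moebius_map_comp algebra_simps complex_eq_iff)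

lemma neg_apply: "neg None = None" "neg (Some z) = Some (- z)"
  by (simp_all add: moebius_map_affine)

lemma recip_apply: "recip None = Some 0" "z \<noteq> 0 \<Longrightarrow> recip (Some z) = Some (inverse z)" "recip (Some 0) = None"
  by (simp_all add: moebius_map_inversion)

lemma tet_apply: "tet None = Some 1" "z \<noteq> \<i> \<Longrightarrow> tet (Some z) = Some ((z + \<i>) / (z - \<i>))"
  by (simp_all add: tet_def moebius_map_def)

text \<open>Invariance under the Klein four-group \<open>{z, -z, 1/z, -1/z}\<close>, the normal subgroup of the tetrahedral group.\<close>
definition klein_invariant :: "complex option set \<Rightarrow> bool" where
  "klein_invariant X \<longleftrightarrow> neg ` X = X \<and> recip ` X = X"

lemma klein_invariant_Un: "klein_invariant X \<Longrightarrow> klein_invariant Y \<Longrightarrow> klein_invariant (X \<union> Y)"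
  by (simp add: klein_invariant_def image_Un)

lemma neg_tet: "neg \<circ> tet = tet \<circ> neg \<circ> recip"
proof -
  have nr: "neg \<circ> recip = recip \<circ> neg" using moebius_map_scale[of "-1" 0 "-1" 1 0]
    by (simp add: moebius_map_comp)
  have "recip \<circ> recip = id" using moebius_map_id[of 1] by (simp add: moebius_map_comp)
  have "tet \<circ> neg \<circ> recip = recip \<circ> (tet \<circ> recip)" by (simp add: tet_neg comp_assoc)
  also have "\<dots> = recip \<circ> (neg \<circ> recip) \<circ> tet" by (simp add: tet_recip comp_assoc)
  also have "\<dots> = recip \<circ> recip \<circ> neg \<circ> tet" by (simp only: nr comp_assoc)
  finally show ?thesis by (simp add: \<open>recip \<circ> recip = id\<close>)
qed

text \<open>The Klein four-group is normalised by \<open>tet\<close>.\<close>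
lemma klein_invariant_tet:
  assumes "klein_invariant X"
  shows "klein_invariant (tet ` X)"
proof -
  have "recip ` tet ` X = tet ` neg ` X" by (simp only: image_comp tet_neg)
  moreover have "neg ` tet ` X = tet ` neg ` recip ` X"
    by (simp only: image_comp neg_tet comp_assoc)
  ultimately show ?thesis using assms by (simp add: klein_invariant_def)
qed

text \<open>The fixed points of \<open>tet\<close> are the roots of \<open>z^2 - (1 + \<i>) z - \<i>\<close>; the other one is \<open>tet_fixed'\<close>. They
belong to different orbits of the tetrahedral group, which are the vertices of a tetrahedron
and of its dual.\<close>
definition tet_fixed :: complex where
  "tet_fixed = Complex ((1 + sqrt 3) / 2) ((1 + sqrt 3) / 2)"

definition tet_fixed' :: complex where
  "tet_fixed' = Complex ((1 - sqrt 3) / 2) ((1 - sqrt 3) / 2)"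

lemma tet_fixed_iff: "tet p = p \<longleftrightarrow> p = Some tet_fixed \<or> p = Some tet_fixed'"
proof (cases p)
  case None
  then show ?thesis by (simp add: tet_apply)
next
  case (Some z)
  have poly: "z * (z - \<i>) - (z + \<i>) = (z - tet_fixed) * (z - tet_fixed')"
  proof -
    have "tet_fixed + tet_fixed' = 1 + \<i>" "tet_fixed * tet_fixed' = - \<i>"
      by (simp_all add: tet_fixed_def tet_fixed'_def complex_eq_iff field_simps)
    moreover have "(z - tet_fixed) * (z - tet_fixed') = z * z - (tet_fixed + tet_fixed') * z + tet_fixed * tet_fixed'"
      by (simp add: algebra_simps)
    ultimately show ?thesis by (simp add: algebra_simps)
  qed
  show ?thesis
  proof (cases "z = \<i>")
    case True
    have "tet (Some \<i>) = None" by (simp add: tet_def moebius_map_def)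
    moreover have "\<i> \<noteq> tet_fixed" "\<i> \<noteq> tet_fixed'"
      by (auto simp: tet_fixed_def tet_fixed'_def complex_eq_iff)
    ultimately show ?thesis using True Some by simp
  next
    case False
    then have "tet p = p \<longleftrightarrow> z * (z - \<i>) - (z + \<i>) = 0"
      using Some by (auto simp: tet_apply field_simps)
    then show ?thesis using Some by (simp add: poly)
  qed
qed

definition tet_vertices :: "complex option set" where
  "tet_vertices = {Some tet_fixed, neg (Some tet_fixed), recip (Some tet_fixed), neg (recip (Some tet_fixed))}"

lemma sqrt3: "sqrt 3 > 1" "sqrt 3 * sqrt 3 = (3::real)"
  by (simp_all add: real_less_rsqrt)

lemma inverse_tet_fixed: "inverse tet_fixed = Complex ((sqrt 3 - 1) / 2) (- (sqrt 3 - 1) / 2)"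
proof (rule inverse_unique)
  show "tet_fixed * Complex ((sqrt 3 - 1) / 2) (- (sqrt 3 - 1) / 2) = 1"
    using sqrt3 by (simp add: tet_fixed_def complex_eq_iff field_simps)
qed

text \<open>The vertices lie in the four open quadrants, one in each; their signs tell them apart.\<close>
lemma tet_fixed_signs:
  "Re tet_fixed > 0" "Im tet_fixed > 0" "Re (inverse tet_fixed) > 0" "Im (inverse tet_fixed) < 0"
  using sqrt3(1) unfolding inverse_tet_fixed by (simp_all add: tet_fixed_def add_pos_pos)

lemma tet_fixed'_bounds:
  "Re tet_fixed' < 0" "Im tet_fixed' < 0" "Re tet_fixed' > - Re tet_fixed"
  using sqrt3 by (simp_all add: tet_fixed_def tet_fixed'_def field_simps)

lemma tet_fixed_nonzero: "tet_fixed \<noteq> 0"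
  using tet_fixed_signs(1) by auto

lemma tet_vertices_eq:
  "tet_vertices = {Some tet_fixed, Some (- tet_fixed), Some (inverse tet_fixed), Some (- inverse tet_fixed)}"
  using tet_fixed_nonzero by (simp add: tet_vertices_def neg_apply recip_apply)

lemma card_tet_vertices: "card tet_vertices = 4"
proof -
  have "distinct [tet_fixed, - tet_fixed, inverse tet_fixed, - inverse tet_fixed]"
    using tet_fixed_signs by (auto simp del: inverse_complex.sel simp: complex_eq_iff)
  then have "card (Some ` set [tet_fixed, - tet_fixed, inverse tet_fixed, - inverse tet_fixed]) = 4"
    by (subst card_image) (simp_all only: distinct_card inj_Some inj_on_subset[OF inj_Some] subset_UNIV, simp)
  then show ?thesis by (simp add: tet_vertices_eq)
qed

lemma klein_invariant_tet_vertices: "klein_invariant tet_vertices"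
  using tet_fixed_nonzero
  by (auto simp: klein_invariant_def tet_vertices_eq neg_apply recip_apply)

lemma tet_tet_vertices: "tet ` tet_vertices = tet_vertices"
proof -
  define q where "q = Some tet_fixed"
  have q: "tet q = q" by (simp add: tet_fixed_iff q_def)
  have t1: "tet (neg q) = recip q" using fun_cong[OF tet_neg, of q] q by simp
  have t2: "tet (recip q) = neg (recip q)" using fun_cong[OF tet_recip, of q] q by simp
  have t3: "tet (neg (recip q)) = neg q" using fun_cong[OF neg_tet, of q] q by simp
  show ?thesis
    unfolding tet_vertices_def q_def[symmetric] image_insert image_empty q t1 t2 t3 by blast
qed

lemma tet_vertices_nonreal: "p \<in> tet_vertices \<Longrightarrow> \<exists>z. p = Some z \<and> Im z \<noteq> 0"
  using tet_fixed_signs(2,4) unfolding tet_vertices_eq by (auto simp del: inverse_complex.sel)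

lemma tet_fixed'_not_vertex: "Some tet_fixed' \<notin> tet_vertices"
proof -
  have "tet_fixed' \<noteq> tet_fixed" "tet_fixed' \<noteq> - tet_fixed" "tet_fixed' \<noteq> inverse tet_fixed"
    "tet_fixed' \<noteq> - inverse tet_fixed"
    using tet_fixed_signs tet_fixed'_bounds
    by (auto simp del: inverse_complex.sel simp: complex_eq_iff)
  then show ?thesis unfolding tet_vertices_eq by blast
qed

text \<open>The set \<open>W\<close> is on the real line and \<open>tet ` W\<close> is on the unit circle. These circles meet at \<open>1\<close> and \<open>-1\<close>
only, which are not in \<open>W\<close>; so \<open>W\<close> and \<open>tet ` W\<close> are disjoint, and applying \<open>tet\<close> gives the disjointness of
all three images. Their union is invariant under the tetrahedral group. The fixed points of \<open>tet\<close> are not on these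
circles, so the vertices of one tetrahedron can be added, and only one fixed point of \<open>tet\<close> is among them. The
symmetry \<open>-z\<close> fixes either both or none of the points \<open>0\<close>, \<open>\<infinity>\<close> of \<open>A\<close>, as \<open>1/z\<close> exchanges them.\<close>
lemma tetrahedral_set:
  assumes W: "finite W" "klein_invariant W" "W \<inter> {Some 1, Some (- 1)} = {}"
    and real: "\<And>z. Some z \<in> W \<Longrightarrow> Im z = 0"
  defines "A \<equiv> W \<union> tet ` W \<union> tet ` tet ` W \<union> tet_vertices"
  shows "card A = 3 * card W + 4" "has_symmetry_fixing 1 A" "\<exists>e. e \<noteq> 1 \<and> has_symmetry_fixing e A"
proof -
  note inj = Moeb_inj[OF tet_Moeb]
  have cube: "tet ` tet ` tet ` X = X" for X
    using tet_cube by (metis image_comp image_id id_apply)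
  have disj1: "W \<inter> tet ` W = {}"
  proof (rule ccontr)
    assume "W \<inter> tet ` W \<noteq> {}"
    then obtain x where x: "x \<in> W" "tet x \<in> W" by auto
    then have "tet x \<noteq> Some 1" "tet x \<noteq> Some (- 1)" using W(3) by auto
    then obtain z where z: "x = Some z" using tet_apply(1) by (cases x) auto
    have "Im z = 0" using x z real by simp
    then have "z \<noteq> \<i>" by auto
    then have t: "tet x = Some ((z + \<i>) / (z - \<i>))" using z tet_apply(2) by simp
    define y where "y = (z + \<i>) / (z - \<i>)"
    have "Im y = 0" using x(2) real t by (simp add: y_def)
    moreover have "norm y = 1"
    proof -
      have "z + \<i> = cnj (z - \<i>)" using \<open>Im z = 0\<close> by (simp add: complex_eq_iff)
      then have "norm (z + \<i>) = norm (z - \<i>)" by (metis complex_mod_cnj)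
      then show ?thesis using \<open>z \<noteq> \<i>\<close> by (simp add: y_def norm_divide)
    qed
    ultimately have "\<bar>Re y\<bar> = 1" by (simp add: cmod_eq_Re)
    then have "y = 1 \<or> y = - 1" using \<open>Im y = 0\<close> by (auto simp: complex_eq_iff)
    then show False using \<open>tet x \<noteq> Some 1\<close> \<open>tet x \<noteq> Some (- 1)\<close> t by (auto simp: y_def)
  qed
  have "tet ` (W \<inter> tet ` W) = tet ` W \<inter> tet ` tet ` W" by (rule image_Int[OF inj])
  then have disj2: "tet ` W \<inter> tet ` tet ` W = {}" using disj1 by simp
  have "tet ` (tet ` W \<inter> tet ` tet ` W) = tet ` tet ` W \<inter> W" using image_Int[OF inj] cube by simp
  then have disj3: "tet ` tet ` W \<inter> W = {}" using disj2 by simp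
  have disj4: "W \<inter> tet_vertices = {}" using tet_vertices_nonreal real by fastforce
  then have disj5: "tet ` W \<inter> tet_vertices = {}"
    using image_Int[OF inj, of W tet_vertices] tet_tet_vertices by simp
  then have disj6: "tet ` tet ` W \<inter> tet_vertices = {}"
    using image_Int[OF inj, of "tet ` W" tet_vertices] tet_tet_vertices by simp
  have card_tet: "card (tet ` X) = card X" for X by (rule card_image[OF inj_on_subset[OF inj]]) simp
  have fin: "finite (tet ` W)" "finite (tet ` tet ` W)" "finite tet_vertices"
    using W(1) by (auto simp: tet_vertices_def)
  have "card A = card (W \<union> tet ` W \<union> tet ` tet ` W) + card tet_vertices"
    unfolding A_def using fin W(1) disj4 disj5 disj6
    by (intro card_Un_disjoint) (simp_all add: Int_Un_distrib2)
  also have "card (W \<union> tet ` W \<union> tet ` tet ` W) = card (W \<union> tet ` W) + card (tet ` tet ` W)"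
    using fin W(1) disj2 disj3
    by (intro card_Un_disjoint) (simp_all add: Int_Un_distrib2 Int_commute[of W])
  also have "card (W \<union> tet ` W) = card W + card (tet ` W)"
    using fin W(1) disj1 by (intro card_Un_disjoint) auto
  finally show "card A = 3 * card W + 4" by (simp add: card_tet card_tet_vertices)
  have tetA: "tet ` A = A" unfolding A_def image_Un cube tet_tet_vertices by blast
  have kleinA: "klein_invariant A"
    unfolding A_def by (intro klein_invariant_Un klein_invariant_tet W klein_invariant_tet_vertices)
  have f': "Some tet_fixed' \<notin> A"
  proof
    have "Im tet_fixed' \<noteq> 0" using sqrt3 by (simp add: tet_fixed'_def)
    then have W': "Some tet_fixed' \<notin> W" using real by blast
    have t: "Some tet_fixed' \<in> tet ` X \<longleftrightarrow> Some tet_fixed' \<in> X" for X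
      using tet_fixed_iff[of "Some tet_fixed'"] inj by (metis image_eqI inj_image_mem_iff)
    assume "Some tet_fixed' \<in> A"
    then show False using W' t tet_fixed'_not_vertex by (auto simp: A_def)
  qed
  have "Some tet_fixed \<in> A" by (simp add: A_def tet_vertices_def)
  then have "{x \<in> A. tet x = x} = {Some tet_fixed}" using f' by (auto simp: tet_fixed_iff)
  moreover have "tet \<noteq> id" using tet_apply(1) by (metis id_apply option.distinct(1))
  ultimately show "has_symmetry_fixing 1 A"
    unfolding has_symmetry_fixing_def using tetA tet_Moeb by (intro bexI[of _ tet]) simp_all
  have "neg \<noteq> id"
  proof
    assume "neg = id"
    then have "neg (Some 1) = Some 1" by simp
    then show False by (simp add: neg_apply)
  qed
  then have "has_symmetry_fixing (card {x \<in> A. neg x = x}) A"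
    unfolding has_symmetry_fixing_def using kleinA neg_Moeb
    by (intro bexI[of _ neg]) (simp_all add: klein_invariant_def)
  moreover have "card {x \<in> A. neg x = x} \<noteq> 1"
  proof -
    have "recip ` A = A" using kleinA by (simp add: klein_invariant_def)
    then have none_zero: "None \<in> A \<longleftrightarrow> Some 0 \<in> A"
      using recip_apply(1,3) by (metis image_eqI)
    have neg_fixed: "neg x = x \<longleftrightarrow> x = None \<or> x = Some 0" for x
      by (cases x) (auto simp: neg_apply)
    have fixed: "{x \<in> A. neg x = x} = A \<inter> {None, Some 0}"
      unfolding neg_fixed by blast
    show ?thesis
    proof (cases "None \<in> A")
      case True
      then have "A \<inter> {None, Some 0} = {None, Some 0}" using none_zero by blast
      then show ?thesis unfolding fixed by simp
    next
      case False
      then have "A \<inter> {None, Some 0} = {}" using none_zero by blast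
      then show ?thesis unfolding fixed by simp
    qed
  qed
  ultimately show "\<exists>e. e \<noteq> 1 \<and> has_symmetry_fixing e A" by blast
qed

text \<open>The points \<open>\<plusminus>t, \<plusminus>1/t\<close> for \<open>t = 2, 3, ...\<close> come in fours; the pair \<open>0, \<infinity>\<close> is added to reach the
cardinalities that are 2 modulo 4.\<close>
lemma klein_invariant_real_set:
  assumes "even w"
  obtains W where "finite W" "klein_invariant W" "W \<inter> {Some 1, Some (- 1)} = {}"
    "\<And>z. Some z \<in> W \<Longrightarrow> Im z = 0" "card W = w"
proof -
  define b where "b = w div 4"
  define V where "V = real ` {2..<b + 2}"
  define S where "S = V \<union> inverse ` V"
  define T where "T = S \<union> uminus ` S"
  define C where "C = (Some \<circ> complex_of_real) ` T"
  have V: "finite V" "card V = b" "\<And>x. x \<in> V \<Longrightarrow> x > 1"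
    by (auto simp: V_def card_image)
  have iV: "x < 1" "x > 0" if "x \<in> inverse ` V" for x
    using that V(3) by (auto simp: inverse_less_1_iff) fastforce+
  have S: "finite S" "card S = 2 * b" "\<And>x. x \<in> S \<Longrightarrow> x > 0 \<and> x \<noteq> 1"
  proof -
    show "finite S" using V by (simp add: S_def)
    show "x > 0 \<and> x \<noteq> 1" if "x \<in> S" for x
      using that V(3) iV unfolding S_def by fastforce
    have "V \<inter> inverse ` V = {}" using V(3) iV by fastforce
    then have "card S = card V + card (inverse ` V)"
      unfolding S_def using V(1) by (intro card_Un_disjoint) auto
    then show "card S = 2 * b" using V(2) card_image[of inverse V] by (simp add: inj_on_def)
  qed
  have invS: "inverse x \<in> S" if "x \<in> S" for x using that by (auto simp: S_def)
  have T: "finite T" "card T = 4 * b" "\<And>x. x \<in> T \<Longrightarrow> x \<noteq> 0 \<and> x \<noteq> 1 \<and> x \<noteq> - 1"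
  proof -
    show "finite T" using S by (simp add: T_def)
    show "x \<noteq> 0 \<and> x \<noteq> 1 \<and> x \<noteq> - 1" if "x \<in> T" for x
      using that S(3) unfolding T_def by fastforce
    have "S \<inter> uminus ` S = {}"
    proof (rule ccontr)
      assume "S \<inter> uminus ` S \<noteq> {}"
      then obtain x where "x \<in> S" "- x \<in> S" by auto
      then show False using S(3)[of x] S(3)[of "- x"] by simp
    qed
    then have "card T = card S + card (uminus ` S)"
      unfolding T_def using S(1) by (intro card_Un_disjoint) auto
    then show "card T = 4 * b" using S(2) card_image[of uminus S] by (simp add: inj_on_def)
  qed
  have closed: "- x \<in> T" "inverse x \<in> T" if "x \<in> T" for x
    using that invS by (auto simp: T_def)
  have C: "finite C" "card C = 4 * b" "None \<notin> C" "Some 0 \<notin> C" "Some 1 \<notin> C" "Some (- 1) \<notin> C"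
    "\<And>z. Some z \<in> C \<Longrightarrow> Im z = 0"
  proof -
    show "finite C" "card C = 4 * b" using T by (auto simp: C_def card_image inj_on_def)
    show "None \<notin> C" "Some 0 \<notin> C" "\<And>z. Some z \<in> C \<Longrightarrow> Im z = 0"
      using T(3) by (auto simp: C_def)
    show "Some 1 \<notin> C" "Some (- 1) \<notin> C"
      using T(3)[of 1] T(3)[of "- 1"] by (auto simp: C_def complex_eq_iff)
  qed
  have kC: "klein_invariant C"
    unfolding klein_invariant_def
  proof (intro conjI image_eq_self C(1) Moeb_inj neg_Moeb recip_Moeb image_subsetI)
    fix p assume "p \<in> C"
    then obtain x where x: "x \<in> T" "p = Some (complex_of_real x)" by (auto simp: C_def)
    then have "neg p = Some (complex_of_real (- x))" "recip p = Some (complex_of_real (inverse x))"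
      using T(3) by (simp_all add: neg_apply recip_apply of_real_inverse)
    then show "neg p \<in> C" "recip p \<in> C" using closed[OF x(1)] unfolding C_def comp_def by blast+
  qed
  show ?thesis
  proof (cases "4 dvd w")
    case True
    then have "card C = w" using C(2) by (simp add: b_def)
    then show ?thesis using that[of C] C kC by blast
  next
    case False
    then have w: "w = 4 * b + 2" using assms by (auto simp: b_def) presburger
    have "klein_invariant {None, Some 0}"
      by (auto simp: klein_invariant_def neg_apply recip_apply)
    then have "klein_invariant ({None, Some 0} \<union> C)" using kC by (rule klein_invariant_Un)
    moreover have "card ({None, Some 0} \<union> C) = w" using C w by simp
    moreover have "Im z = 0" if "Some z \<in> {None, Some 0} \<union> C" for z
      using that C(7) by auto
    moreover have "finite ({None, Some 0} \<union> C)"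
      "({None, Some 0} \<union> C) \<inter> {Some 1, Some (- 1)} = {}" using C(1,5,6) by auto
    ultimately show ?thesis by (intro that[of "{None, Some 0} \<union> C"])
  qed
qed

text \<open>As \<open>n\<close> is even and \<open>n - 1\<close> is divisible by 3, \<open>n = 4 + 3 w\<close> with an even \<open>w\<close>.\<close>
theorem tetrahedral_configuration:
  assumes "3 dvd n - 1" "even n" "n \<ge> 4"
  obtains A e where "card A = n" "has_symmetry_fixing 1 A" "e \<noteq> 1" "has_symmetry_fixing e A"
proof -
  obtain w where w: "n = 3 * w + 4" "even w"
  proof -
    obtain k where "n - 1 = 3 * k" using assms(1) by (auto simp: dvd_def)
    then have "n = 3 * (k - 1) + 4" "even (k - 1)" using assms(2,3) by presburger+
    then show ?thesis using that by blast
  qed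
  obtain W where "finite W" "klein_invariant W" "W \<inter> {Some 1, Some (- 1)} = {}"
    "\<And>z. Some z \<in> W \<Longrightarrow> Im z = 0" "card W = w"
    using klein_invariant_real_set[OF w(2)] by blast
  from tetrahedral_set[OF this(1-4)] this(5) w(1) that show ?thesis by metis
qed

section \<open>The symmetric classes form closed sets\<close>

definition realizing_set :: "nat \<Rightarrow> (nat \<Rightarrow> nat) \<Rightarrow> (nat \<Rightarrow> complex option) set" where
  "realizing_set n s =
     {x \<in> topspace (configuration_space n). \<exists>M\<in>Moeb. \<forall>i<n. M (x i) = x (s i)}"

text \<open>A singular matrix sends all points but one to a single point, so it cannot satisfy the relation at
three distinct points with distinct targets.\<close>
lemma moebius_relation_nondegenerate:
  fixes z w :: "nat \<Rightarrow> complex"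
  assumes n: "n \<ge> 3" and z: "inj_on z {..<n}" and w: "inj_on w {..<n}"
    and ne: "(a, b, c, d) \<noteq> 0"
    and rel: "\<And>i. i < n \<Longrightarrow> a * z i + b = w i * (c * z i + d)"
  shows "a * d - b * c \<noteq> 0"
proof
  assume det: "a * d - b * c = 0"
  have prod0: "(c * z i + d) * (c * z j + d) = 0" if "i < n" "j < n" "i \<noteq> j" for i j
  proof -
    have "(w i - w j) * ((c * z i + d) * (c * z j + d)) =
      (w i * (c * z i + d)) * (c * z j + d) - (w j * (c * z j + d)) * (c * z i + d)"
      by (simp add: algebra_simps)
    also have "\<dots> = (a * d - b * c) * (z i - z j)"
      unfolding rel[OF that(1), symmetric] rel[OF that(2), symmetric] by (simp add: algebra_simps)
    finally have "(w i - w j) * ((c * z i + d) * (c * z j + d)) = 0" using det by simp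
    moreover have "w i \<noteq> w j" using w that by (auto simp: inj_on_def)
    ultimately show ?thesis by simp
  qed
  have two: "c = 0 \<and> d = 0" if "i < n" "j < n" "i \<noteq> j" "c * z i + d = 0" "c * z j + d = 0" for i j
  proof -
    have "c * (z i - z j) = (c * z i + d) - (c * z j + d)" by (simp add: algebra_simps)
    then have "c * (z i - z j) = 0" using that by simp
    moreover have "z i \<noteq> z j" using z that by (auto simp: inj_on_def)
    ultimately show ?thesis using that by simp
  qed
  have "c = 0 \<and> d = 0"
  proof (cases "c * z 0 + d = 0")
    case True
    show ?thesis
    proof (cases "c * z 1 + d = 0")
      case True
      with \<open>c * z 0 + d = 0\<close> show ?thesis using two[of 0 1] n by simp
    next
      case False
      then have "c * z 2 + d = 0" using prod0[of 1 2] n by simp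
      with \<open>c * z 0 + d = 0\<close> show ?thesis using two[of 0 2] n by simp
    qed
  next
    case False
    then have "c * z 1 + d = 0" "c * z 2 + d = 0" using prod0[of 0 1] prod0[of 0 2] n by simp_all
    then show ?thesis using two[of 1 2] n by simp
  qed
  then have cd: "c = 0" "d = 0" by auto
  then have ab: "a * z 0 + b = 0" "a * z 1 + b = 0" using rel[of 0] rel[of 1] n by simp_all
  have "a * (z 0 - z 1) = (a * z 0 + b) - (a * z 1 + b)" by (simp add: algebra_simps)
  then have "a * (z 0 - z 1) = 0" by (simp only: ab diff_self)
  moreover have "z 0 \<noteq> z 1" using inj_onD[OF z, of 0 1] n by auto
  ultimately have "a = 0" by simp
  with ab cd ne show False by (simp add: zero_prod_def)
qed

text \<open>After moving the points of a given configuration away from \<open>\<infinity>\<close>, the condition says that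
\<open>a z i + b = z (s i) (c z i + d)\<close> has a nonzero solution \<open>(a, b, c, d)\<close>. It may be normalised to be a unit
vector, so the configurations in question are the projection of a closed set along a compact factor.\<close>
lemma closedin_realizing_set:
  assumes n: "n \<ge> 3" and s: "s ` {..<n} \<subseteq> {..<n}" "inj_on s {..<n}"
  shows "closedin (configuration_space n) (realizing_set n s)"
proof -
  define X where "X = configuration_space n"
  have sn: "s i < n" if "i < n" for i using s(1) that by auto
  have "openin X (topspace X - realizing_set n s)"
  proof (subst openin_subopen, rule ballI)
    fix x0 assume x0: "x0 \<in> topspace X - realizing_set n s"
    obtain a where a: "Some a \<notin> x0 ` {..<n}"
    proof -
      have "finite {a. Some a \<in> x0 ` {..<n}}"
        using finite_vimageI[of "x0 ` {..<n}" Some] by (simp add: vimage_def)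
      then obtain a where "a \<notin> {a. Some a \<in> x0 ` {..<n}}"
        using ex_new_if_finite[OF infinite_UNIV_char_0] by blast
      then show ?thesis using that by blast
    qed
    \<comment> \<open>a coordinate in which all points of the configuration \<open>x0\<close> are finite\<close>
    define N where "N = moebius_map 0 1 1 (- a)"
    have N: "N \<in> Moeb" unfolding N_def by (rule MoebI) simp
    have N_None: "N p = None \<longleftrightarrow> p = Some a" for p
      by (cases p) (auto simp: N_def moebius_map_def)
    define U where "U = {x \<in> topspace X. \<forall>i<n. N (x i) \<noteq> None}"
    have contN: "continuous_map X riemann_sphere (\<lambda>x. N (x i))" if "i < n" for i
    proof -
      have "continuous_map X riemann_sphere (\<lambda>x. x i)"
        unfolding X_def configuration_space_def
        using that by (intro continuous_map_from_subtopology continuous_map_product_projection) simp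
      then show ?thesis
        using continuous_map_compose[OF _ continuous_map_Moeb[OF N]] by (simp add: comp_def)
    qed
    have openU: "openin X U"
    proof -
      have "openin X {x \<in> topspace X. N (x i) \<in> {p. p \<noteq> None}}" if "i < n" for i
        using openin_continuous_map_preimage[OF contN[OF that] openin_finite_part] .
      then have "openin X (topspace X \<inter> (\<Inter>i\<in>{..<n}. {x \<in> topspace X. N (x i) \<in> {p. p \<noteq> None}}))"
        using n by (intro openin_Int openin_topspace openin_INT2) (auto simp: lessThan_empty_iff)
      moreover have "topspace X \<inter> (\<Inter>i\<in>{..<n}. {x \<in> topspace X. N (x i) \<in> {p. p \<noteq> None}}) = U"
        by (auto simp: U_def)
      ultimately show ?thesis by simp
    qed
    have "N (x0 i) \<noteq> None" if "i < n" for i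
    proof
      assume "N (x0 i) = None"
      then have "x0 i = Some a" by (simp only: N_None)
      then show False using a imageI[of i "{..<n}" x0] that by simp
    qed
    then have "x0 \<in> U" using x0 by (simp add: U_def)
    define z where "z i x = the (N (x i))" for i :: nat and x
    define Y where "Y = subtopology X U"
    have topY: "topspace Y = U" unfolding Y_def using openU openin_subset by (auto simp: U_def)
    have z: "N (x i) = Some (z i x)" if "x \<in> U" "i < n" for x i
      using that by (auto simp: U_def z_def)
    have contz: "continuous_map Y euclidean (z i)" if "i < n" for i
    proof -
      have "continuous_map Y (subtopology riemann_sphere {p. p \<noteq> None}) (\<lambda>x. N (x i))"
        unfolding Y_def continuous_map_in_subtopology
        using contN[OF that] that by (auto simp: U_def intro: continuous_map_from_subtopology)
      then show ?thesis
        using continuous_map_compose[OF _ continuous_map_the] by (simp add: comp_def z_def[abs_def])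
    qed
    define S where "S = sphere (0 :: complex \<times> complex \<times> complex \<times> complex) 1"
    define Z where "Z = prod_topology (top_of_set S) Y"
    \<comment> \<open>for a nonsingular matrix, vanishes iff the matrix sends \<open>z\<close> to \<open>w\<close>\<close>
    define E where "E = (\<lambda>((a, b, c, d), z, w). a * z + b - w * (c * z + d) :: complex)"
    define K where "K = topspace Z \<inter>
      (\<Inter>i\<in>{..<n}. {p \<in> topspace Z. E (fst p, z i (snd p), z (s i) (snd p)) \<in> {0}})"
    have "closedin Z {p \<in> topspace Z. E (fst p, z i (snd p), z (s i) (snd p)) \<in> {0}}" if "i < n" for i
    proof -
      have "continuous_map Z euclidean (\<lambda>p. fst p)"
        unfolding Z_def using continuous_map_fst continuous_map_into_fulltopology by blast
      moreover have "continuous_map Z euclidean (\<lambda>p. z j (snd p))" if "j < n" for j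
        unfolding Z_def using continuous_map_compose[OF continuous_map_snd contz[OF that]]
        by (simp add: comp_def)
      ultimately have "continuous_map Z (prod_topology euclidean (prod_topology euclidean euclidean))
          (\<lambda>p. (fst p, z i (snd p), z (s i) (snd p)))"
        using that sn by (intro continuous_map_pairedI) auto
      moreover have "continuous_map euclidean euclidean E"
        unfolding continuous_map_iff_continuous2 E_def case_prod_unfold by (intro continuous_intros)
      ultimately have "continuous_map Z euclidean (\<lambda>p. E (fst p, z i (snd p), z (s i) (snd p)))"
        using continuous_map_compose[of Z euclidean "\<lambda>p. (fst p, z i (snd p), z (s i) (snd p))" euclidean E]
        by (simp add: euclidean_product_topology comp_def)
      then show ?thesis by (rule closedin_continuous_map_preimage) simp
    qed
    then have "closedin Z K"
      unfolding K_def using n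
      by (intro closedin_Int closedin_topspace closedin_INT) (auto simp: lessThan_empty_iff)
    moreover have "closed_map Z Y snd"
      unfolding Z_def by (intro Abstract_Topological_Spaces.closed_map_snd)
        (simp add: compact_space_subtopology S_def)
    ultimately have "closedin Y (snd ` K)" by (simp add: closed_map_def)
    moreover have "snd ` K = U \<inter> realizing_set n s"
    proof (intro equalityI subsetI)
      fix x assume "x \<in> snd ` K"
      then obtain v where v: "(v, x) \<in> K" by auto
      obtain a b c d where abcd: "v = (a, b, c, d)" by (cases v)
      have xU: "x \<in> U" and vS: "v \<in> S"
        using v topY by (auto simp: K_def Z_def)
      have rel: "a * z i x + b = z (s i) x * (c * z i x + d)" if "i < n" for i
        using v that by (auto simp: K_def E_def abcd)
      have "inj_on (\<lambda>i. z i x) {..<n}"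
      proof (rule inj_onI)
        fix i j assume ij: "i \<in> {..<n}" "j \<in> {..<n}" "z i x = z j x"
        then have "N (x i) = N (x j)" using z[OF xU] by simp
        then have "x i = x j" using Moeb_inj[OF N] by (auto dest: injD)
        moreover have "inj_on x {..<n}"
          using xU by (simp add: U_def X_def topspace_configuration_space)
        ultimately show "i = j" using ij by (auto dest: inj_onD)
      qed
      moreover from comp_inj_on[OF s(2) inj_on_subset[OF this s(1)]]
      have "inj_on (\<lambda>i. z (s i) x) {..<n}" by (simp add: comp_def)
      moreover have "(a, b, c, d) \<noteq> 0" using vS abcd by (auto simp: S_def)
      ultimately have det: "a * d - b * c \<noteq> 0"
        using moebius_relation_nondegenerate[OF n, of "\<lambda>i. z i x" "\<lambda>i. z (s i) x"] rel by blast
      define M where "M = inv N \<circ> moebius_map a b c d \<circ> N"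
      have "M \<in> Moeb" unfolding M_def by (intro Moeb_comp Moeb_inv N MoebI det)
      moreover have "M (x i) = x (s i)" if "i < n" for i
      proof -
        have "c * z i x + d \<noteq> 0"
          using nonsingular_apply[OF det, of "z i x" 1] rel[OF that] by auto
        then have "moebius_map a b c d (N (x i)) = N (x (s i))"
          using rel[OF that] z[OF xU] that sn by (simp add: moebius_map_def)
        then show ?thesis using N by (simp add: M_def)
      qed
      ultimately show "x \<in> U \<inter> realizing_set n s"
        using xU by (auto simp: realizing_set_def U_def X_def)
    next
      fix x assume x: "x \<in> U \<inter> realizing_set n s"
      then obtain M where M: "M \<in> Moeb" "\<And>i. i < n \<Longrightarrow> M (x i) = x (s i)"
        by (auto simp: realizing_set_def)
      have "N \<circ> M \<circ> inv N \<in> Moeb" by (intro Moeb_comp Moeb_inv N M)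
      then obtain a b c d where abcd: "N \<circ> M \<circ> inv N = moebius_map a b c d" "a * d - b * c \<noteq> 0"
        by (rule MoebE)
      have rel: "a * z i x + b = z (s i) x * (c * z i x + d)" if "i < n" for i
      proof -
        have "moebius_map a b c d (N (x i)) = N (x (s i))"
          unfolding abcd(1)[symmetric] using N M(2)[OF that] by simp
        then show ?thesis using z[of x] x that sn
          by (auto simp: moebius_map_def field_simps split: if_splits)
      qed
      define v where "v = (a, b, c, d)"
      have "v \<noteq> 0" using abcd(2) by (auto simp: v_def zero_prod_def)
      define r where "r = inverse (norm v)"
      have "r *\<^sub>R v \<in> S" using \<open>v \<noteq> 0\<close> by (simp add: S_def r_def)
      moreover have "E (r *\<^sub>R v, z i x, z (s i) x) = 0" if "i < n" for i
      proof -
        have "E (r *\<^sub>R v, z i x, z (s i) x) = r *\<^sub>R (a * z i x + b - z (s i) x * (c * z i x + d))"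
          by (simp add: E_def v_def algebra_simps)
        then show ?thesis using rel[OF that] by simp
      qed
      ultimately have "(r *\<^sub>R v, x) \<in> K" using x topY by (auto simp: K_def Z_def)
      then show "x \<in> snd ` K" by force
    qed
    ultimately have "closedin Y (U \<inter> realizing_set n s)" by simp
    then have "openin Y (topspace Y - U \<inter> realizing_set n s)" by blast
    then have "openin X (U - realizing_set n s)"
      using openU topY unfolding Y_def by (simp add: openin_open_subtopology Diff_Int_distrib2 Diff_Int)
    moreover have "U - realizing_set n s \<subseteq> topspace X - realizing_set n s" by (auto simp: U_def)
    ultimately show "\<exists>T. openin X T \<and> x0 \<in> T \<and> T \<subseteq> topspace X - realizing_set n s"
      using x0 \<open>x0 \<in> U\<close> by blast
  qed
  then show ?thesis by (auto simp: closedin_def realizing_set_def X_def)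
qed

lemma moduli_class_in_symmetric_classes:
  "moduli_class A \<in> symmetric_classes n e \<longleftrightarrow> card A = n \<and> has_symmetry_fixing e A"
proof
  assume "moduli_class A \<in> symmetric_classes n e"
  then obtain B where B: "moduli_class B = moduli_class A" "card B = n" "has_symmetry_fixing e B"
    by (auto simp: symmetric_classes_def)
  obtain N where "N \<in> Moeb" "A = N ` B" using moduli_class_eqD[OF B(1)] .
  then show "card A = n \<and> has_symmetry_fixing e A"
    using B has_symmetry_fixing_image Moeb_inj by (metis card_image inj_on_subset subset_UNIV)
qed (simp add: symmetric_classesI)

text \<open>A Moebius map is determined by the permutation of the points that it induces, and the fixed points
of that permutation are the points fixed by the map.\<close>
lemma has_symmetry_fixing_iff_realizing:
  assumes n: "n \<ge> 3" and x: "x \<in> topspace (configuration_space n)"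
  shows "has_symmetry_fixing e (x ` {..<n}) \<longleftrightarrow>
    (\<exists>s. s \<in> {..<n} \<rightarrow>\<^sub>E {..<n} \<and> inj_on s {..<n} \<and> (\<exists>i<n. s i \<noteq> i) \<and>
        card {i. i < n \<and> s i = i} = e \<and> x \<in> realizing_set n s)"
proof
  have inj: "inj_on x {..<n}" using x by (simp add: topspace_configuration_space)
  {
    assume "has_symmetry_fixing e (x ` {..<n})"
    then obtain M where M: "M \<in> Moeb" "M \<noteq> id" "M ` x ` {..<n} = x ` {..<n}"
      "card {y \<in> x ` {..<n}. M y = y} = e"
      by (auto simp: has_symmetry_fixing_def)
    have "\<forall>i\<in>{..<n}. \<exists>j\<in>{..<n}. M (x i) = x j" using M(3) by blast
    then obtain s where s: "\<forall>i\<in>{..<n}. s i \<in> {..<n} \<and> M (x i) = x (s i)" by metis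
    define s' where "s' = restrict s {..<n}"
    have s': "s' i < n" "M (x i) = x (s' i)" if "i < n" for i using s that by (auto simp: s'_def)
    have fix_iff: "s' i = i \<longleftrightarrow> M (x i) = x i" if "i < n" for i
      using s'[OF that] inj that by (auto simp: inj_on_def)
    have "\<exists>i<n. s' i \<noteq> i"
    proof (rule ccontr)
      assume "\<not> (\<exists>i<n. s' i \<noteq> i)"
      then have "M (x 0) = x 0" "M (x 1) = x 1" "M (x 2) = x 2" using fix_iff n by auto
      moreover have "x 0 \<noteq> x 1" "x 0 \<noteq> x 2" "x 1 \<noteq> x 2"
        using inj_onD[OF inj, of 0 1] inj_onD[OF inj, of 0 2] inj_onD[OF inj, of 1 2] n by auto
      ultimately show False using Moeb_fix_three[OF M(1)] M(2) by blast
    qed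
    moreover have "inj_on s' {..<n}"
    proof (rule inj_onI)
      fix i j assume ij: "i \<in> {..<n}" "j \<in> {..<n}" "s' i = s' j"
      then have "M (x i) = M (x j)" using s' by auto
      then have "x i = x j" using Moeb_inj[OF M(1)] by (auto dest: injD)
      then show "i = j" using inj ij by (auto dest: inj_onD)
    qed
    moreover have "card {i. i < n \<and> s' i = i} = e"
    proof -
      have "{y \<in> x ` {..<n}. M y = y} = x ` {i. i < n \<and> s' i = i}" using fix_iff by auto
      moreover have "inj_on x {i. i < n \<and> s' i = i}" using inj by (rule inj_on_subset) auto
      ultimately show ?thesis using M(4) by (simp add: card_image)
    qed
    moreover have "s' \<in> {..<n} \<rightarrow>\<^sub>E {..<n}" using s by (auto simp: s'_def)
    moreover have "x \<in> realizing_set n s'"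
      using x M(1) s'(2) by (auto simp: realizing_set_def)
    ultimately show "\<exists>s. s \<in> {..<n} \<rightarrow>\<^sub>E {..<n} \<and> inj_on s {..<n} \<and> (\<exists>i<n. s i \<noteq> i) \<and>
        card {i. i < n \<and> s i = i} = e \<and> x \<in> realizing_set n s" by blast
  }
  {
    assume "\<exists>s. s \<in> {..<n} \<rightarrow>\<^sub>E {..<n} \<and> inj_on s {..<n} \<and> (\<exists>i<n. s i \<noteq> i) \<and>
        card {i. i < n \<and> s i = i} = e \<and> x \<in> realizing_set n s"
    then obtain s M where s: "s \<in> {..<n} \<rightarrow>\<^sub>E {..<n}" "\<exists>i<n. s i \<noteq> i"
        "card {i. i < n \<and> s i = i} = e" and M: "M \<in> Moeb" "\<forall>i<n. M (x i) = x (s i)"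
      by (auto simp: realizing_set_def)
    have sn: "s i < n" if "i < n" for i using s(1) that by auto
    have fix_iff: "M (x i) = x i \<longleftrightarrow> s i = i" if "i < n" for i
      using M(2) sn[OF that] inj that by (auto simp: inj_on_def)
    have "M ` x ` {..<n} \<subseteq> x ` {..<n}" using M(2) sn by auto
    then have "M ` x ` {..<n} = x ` {..<n}" by (intro image_eq_self Moeb_inj M) auto
    moreover have "M \<noteq> id" using s(2) fix_iff by auto
    moreover have "card {y \<in> x ` {..<n}. M y = y} = e"
    proof -
      have "{y \<in> x ` {..<n}. M y = y} = x ` {i. i < n \<and> s i = i}" using fix_iff by auto
      moreover have "inj_on x {i. i < n \<and> s i = i}" using inj by (rule inj_on_subset) auto
      ultimately show ?thesis using s(3) by (simp add: card_image)
    qed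
    ultimately show "has_symmetry_fixing e (x ` {..<n})"
      using M(1) unfolding has_symmetry_fixing_def by blast
  }
qed

text \<open>The preimage in the configuration space is a finite union, over permutations, of closed sets.\<close>
theorem closedin_symmetric_classes:
  assumes n: "n \<ge> 3"
  shows "closedin (moduli_unordered n) (symmetric_classes n e)"
proof -
  define F where "F = {s. s \<in> {..<n} \<rightarrow>\<^sub>E {..<n} \<and> inj_on s {..<n} \<and> (\<exists>i<n. s i \<noteq> i) \<and>
        card {i. i < n \<and> s i = i} = e}"
  have "finite F" unfolding F_def
    by (rule finite_subset[of _ "{..<n} \<rightarrow>\<^sub>E {..<n}"]) (auto intro: finite_PiE)
  then have "closedin (configuration_space n) (\<Union>s\<in>F. realizing_set n s)"
    using closedin_realizing_set[OF n] by (intro closedin_Union) (auto simp: F_def PiE_iff)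
  moreover have "{x \<in> topspace (configuration_space n). moduli_class (x ` {..<n}) \<in> symmetric_classes n e}
    = (\<Union>s\<in>F. realizing_set n s)"
  proof (rule set_eqI)
    fix x
    show "x \<in> {x \<in> topspace (configuration_space n). moduli_class (x ` {..<n}) \<in> symmetric_classes n e}
      \<longleftrightarrow> x \<in> (\<Union>s\<in>F. realizing_set n s)"
    proof (cases "x \<in> topspace (configuration_space n)")
      case True
      then have "card (x ` {..<n}) = n" by (simp add: topspace_configuration_space card_image)
      then show ?thesis
        using True has_symmetry_fixing_iff_realizing[OF n True, of e]
        by (auto simp: moduli_class_in_symmetric_classes F_def)
    next
      case False
      then show ?thesis by (auto simp: realizing_set_def)
    qed
  qed
  moreover have "symmetric_classes n e \<subseteq> topspace (moduli_unordered n)"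
  proof
    fix c assume "c \<in> symmetric_classes n e"
    then obtain A where "c = moduli_class A" "card A = n" by (auto simp: symmetric_classes_def)
    moreover from this have "finite A" using n by (metis card.infinite not_numeral_le_zero)
    ultimately show "c \<in> topspace (moduli_unordered n)" by (auto simp: topspace_moduli_unordered)
  qed
  moreover have "quotient_map (configuration_space n) (moduli_unordered n) (\<lambda>x. moduli_class (x ` {..<n}))"
    unfolding moduli_unordered_def by (rule quotient_map_quotient_topology)
  ultimately show ?thesis unfolding quotient_map_closedin by auto
qed

section \<open>Disjointness of the two families\<close>

definition setwise_stabilizer :: "complex option set \<Rightarrow> (complex option \<Rightarrow> complex option) set" where
  "setwise_stabilizer A = {M \<in> Moeb. M ` A = A}"

lemma finite_setwise_stabilizer:
  assumes "finite A" "card A \<ge> 3"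
  shows "finite (setwise_stabilizer A)"
proof (rule inj_on_finite)
  obtain p q r where pqr: "{p, q, r} \<subseteq> A" "p \<noteq> q" "p \<noteq> r" "q \<noteq> r"
    using three_points[OF assms] .
  show "inj_on (\<lambda>M. restrict M A) (setwise_stabilizer A)"
  proof (rule inj_onI)
    fix M N assume *: "M \<in> setwise_stabilizer A" "N \<in> setwise_stabilizer A" "restrict M A = restrict N A"
    then have eq: "M x = N x" if "x \<in> A" for x using that by (metis restrict_apply)
    show "M = N"
      using * pqr eq by (intro Moeb_agree_three[of M N p q r]) (auto simp: setwise_stabilizer_def)
  qed
  show "(\<lambda>M. restrict M A) ` setwise_stabilizer A \<subseteq> (\<Pi>\<^sub>E x\<in>A. A)"
    by (auto simp: setwise_stabilizer_def)
  show "finite (\<Pi>\<^sub>E x\<in>A. A)" using assms(1) by (simp add: finite_PiE)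
qed

lemma transformation_group_stabilizer:
  assumes "finite A" "card A \<ge> 3"
  shows "transformation_group (setwise_stabilizer A)"
proof
  show "finite (setwise_stabilizer A)" by (rule finite_setwise_stabilizer[OF assms])
  fix g h assume g: "g \<in> setwise_stabilizer A"
  then show "bij g" by (simp add: setwise_stabilizer_def Moeb_bij)
  have "inv g ` A = inv g ` g ` A" using g by (simp add: setwise_stabilizer_def)
  then show "inv g \<in> setwise_stabilizer A"
    using g by (simp add: setwise_stabilizer_def Moeb_inv image_image)
  assume h: "h \<in> setwise_stabilizer A"
  have "(g \<circ> h) ` A = g ` h ` A" by (simp add: image_comp)
  then show "g \<circ> h \<in> setwise_stabilizer A"
    using g h by (simp add: setwise_stabilizer_def Moeb_comp)
qed (simp add: setwise_stabilizer_def)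

lemma stabilizer_fixed_points:
  assumes A: "finite A" "card A \<ge> 3" and g: "g \<in> setwise_stabilizer A" "g \<noteq> id" and p: "g p = p"
  obtains q where "q \<noteq> p" "{x. g x = x} = {p, q}"
proof -
  have M: "g \<in> Moeb" "g ` A = A" using g(1) unfolding setwise_stabilizer_def by blast+
  obtain k where k: "k > 0" "g ^^ k = id" using Moeb_finite_order[OF M(1) A M(2)] .
  obtain q where q: "q \<noteq> p" "g q = q" using second_fixed_point[OF M(1) g(2) p k] .
  have "x = p \<or> x = q" if "g x = x" for x
  proof (rule ccontr)
    assume "\<not> (x = p \<or> x = q)"
    then have "p \<noteq> x" "q \<noteq> x" by blast+
    then have "g = id" by (rule Moeb_fix_three[OF M(1) p q(2) that q(1)[symmetric]])
    with g(2) show False ..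
  qed
  then have "{x. g x = x} \<subseteq> {p, q}" by blast
  moreover have "{p, q} \<subseteq> {x. g x = x}" using p q(2) by simp
  ultimately have "{x. g x = x} = {p, q}" by (rule equalityI)
  with q(1) show ?thesis by (rule that)
qed

text \<open>With the common fixed point at \<open>\<infinity>\<close> and the second fixed point of \<open>g\<close> at \<open>0\<close>, \<open>g\<close> becomes \<open>w z\<close> and \<open>h\<close> becomes
\<open>a z + b\<close>. Their commutator is a translation preserving a finite set, hence trivial; so \<open>b = 0\<close>.\<close>
lemma shared_fixed_point:
  assumes A: "finite A" "card A \<ge> 3"
    and g: "g \<in> setwise_stabilizer A" "g \<noteq> id" and h: "h \<in> setwise_stabilizer A" "h \<noteq> id"
    and p: "g p = p" "h p = p"
  shows "{x. g x = x} = {x. h x = x}"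
proof -
  interpret transformation_group "setwise_stabilizer A" by (rule transformation_group_stabilizer[OF A])
  have M: "g \<in> Moeb" "h \<in> Moeb" using g(1) h(1) unfolding setwise_stabilizer_def by blast+
  obtain q where q: "q \<noteq> p" "{x. g x = x} = {p, q}" using stabilizer_fixed_points[OF A g p(1)] .
  then have gq: "g q = q" by blast
  obtain N where N: "N \<in> Moeb" "N p = None" "N q = Some 0" using Moeb_to_None_0[of p q] q(1) by auto
  have invN: "inv N None = p" "inv N (Some 0) = q" using N by (metis Moeb_inv_comp(4))+
  define conj where "conj f = N \<circ> f \<circ> inv N" for f
  have conj_Moeb: "conj f \<in> Moeb" if "f \<in> Moeb" for f
    unfolding conj_def by (intro Moeb_comp Moeb_inv N that)
  have conj_comp: "conj (f \<circ> f') = conj f \<circ> conj f'" for f f'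
    using N(1) by (simp add: conj_def fun_eq_iff)
  have conj_id: "f = id" if "conj f = id" for f
  proof -
    have "inv N \<circ> conj f \<circ> N = id" using that N by simp
    then show ?thesis using N by (simp add: conj_def fun_eq_iff)
  qed
  obtain w where w: "w \<noteq> 0" "conj g = rotation w"
    using Moeb_fix_None_0[OF conj_Moeb[OF M(1)]] invN p gq N by (auto simp: conj_def)
  have "w \<noteq> 1" using w conj_id[of g] g(2) moebius_map_id by auto
  obtain a b where ab: "a \<noteq> 0" "conj h = moebius_map a b 0 1"
    using Moeb_fix_None[OF conj_Moeb[OF M(2)]] invN p N by (auto simp: conj_def)
  \<comment> \<open>the translation vector of \<open>f\<close>, the commutator of \<open>g\<close> and \<open>h\<close>, in the new coordinate\<close>
  define c where "c = (b - w * b) / (w * a)"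
  define f where "f = inv (g \<circ> h) \<circ> (h \<circ> g)"
  have fA: "f \<in> setwise_stabilizer A" unfolding f_def by (intro comp_G inv_G g h)
  have "(g \<circ> h) \<circ> f = h \<circ> g"
  proof -
    have "(g \<circ> h) \<circ> f = ((g \<circ> h) \<circ> inv (g \<circ> h)) \<circ> (h \<circ> g)" by (simp only: f_def comp_assoc)
    then show ?thesis by (simp only: Moeb_inv_comp(1)[OF Moeb_comp[OF M]] id_comp)
  qed
  then have "conj ((g \<circ> h) \<circ> f) = conj (h \<circ> g)" by (rule arg_cong)
  then have "conj g \<circ> conj h \<circ> conj f = conj h \<circ> conj g"
    by (simp only: conj_comp)
  moreover have "conj g \<circ> conj h \<circ> moebius_map 1 c 0 1 = conj h \<circ> conj g"
  proof -
    have "w * a * c + w * b = b" using w(1) ab(1) by (simp add: c_def)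
    then show ?thesis using w(1) ab(1) unfolding w(2) ab(2)
      by (simp add: moebius_map_comp mult.commute[of a w])
  qed
  ultimately have "conj g \<circ> conj h \<circ> conj f = conj g \<circ> conj h \<circ> moebius_map 1 c 0 1"
    by simp
  from fun_cong[OF this]
  have "conj g (conj h (conj f x)) = conj g (conj h (moebius_map 1 c 0 1 x))" for x
    by simp
  then have "conj f x = moebius_map 1 c 0 1 x" for x
    using Moeb_inj[OF conj_Moeb[OF M(1)]] Moeb_inj[OF conj_Moeb[OF M(2)]] by (metis injD)
  then have f: "conj f = moebius_map 1 c 0 1" by blast
  have "f \<in> Moeb" "f ` A = A" using fA unfolding setwise_stabilizer_def by blast+
  then obtain k where k: "k > 0" "f ^^ k = id" using Moeb_finite_order A by metis
  then have "conj f ^^ k = id" using N by (simp add: conj_def conjugate_funpow)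
  then have "Some (of_nat k * c) = Some 0"
    using translation_funpow[where b = c and k = k and z = 0] f by simp
  then have "c = 0" using k by simp
  then have "b = 0" using w ab \<open>w \<noteq> 1\<close> by (simp add: c_def)
  then have "conj h (Some 0) = Some 0" using ab by (simp add: moebius_map_affine)
  then have "N (h q) = N q" using invN N by (simp add: conj_def)
  then have "h q = q" using Moeb_inj[OF N(1)] by (auto dest: injD)
  moreover obtain q' where "{x. h x = x} = {p, q'}" using stabilizer_fixed_points[OF A h p(2)] .
  ultimately show ?thesis using q by blast
qed

text \<open>Let \<open>p \<in> A\<close> and \<open>q \<notin> A\<close> be the fixed points of a symmetry \<open>m\<close>. The stabilizer of \<open>p\<close> acts freely on the
other \<open>n - 1\<close> points of \<open>A\<close>, so its order divides \<open>n - 1\<close>; this excludes the orders 2 and 3, and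
\<open>large_stabilizer_fixes_point\<close> applies. Thus every symmetry fixes \<open>p\<close>, and therefore fixes exactly
\<open>p\<close> and \<open>q\<close>.\<close>
theorem one_fixed_point_exclusive:
  assumes n: "even n" "n \<ge> 4" "\<not> 3 dvd n - 1" and A: "card A = n"
    and one: "has_symmetry_fixing 1 A" and e: "has_symmetry_fixing e A"
  shows "e = 1"
proof -
  have finA: "finite A" using n A by (metis card.infinite not_numeral_le_zero)
  have A3: "card A \<ge> 3" using n A by simp
  define G where "G = setwise_stabilizer A"
  interpret transformation_group G unfolding G_def by (rule transformation_group_stabilizer[OF finA A3])
  note shared = shared_fixed_point[OF finA A3, folded G_def]
  note fixed_points = stabilizer_fixed_points[OF finA A3, folded G_def]
  obtain m where m: "m \<in> G" "m \<noteq> id" "card {x \<in> A. m x = x} = 1"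
    using one by (auto simp: has_symmetry_fixing_def G_def setwise_stabilizer_def)
  obtain p where p: "{x \<in> A. m x = x} = {p}" using m(3) by (rule card_1_singletonE)
  then have pA: "p \<in> A" "m p = p" by auto
  obtain q where q: "q \<noteq> p" "{x. m x = x} = {p, q}" using fixed_points[OF m(1,2) pA(2)] .
  have qA: "q \<notin> A" using p q by blast
  have GA: "f x \<in> A" if "f \<in> G" "x \<in> A" for f x
    using that by (auto simp: G_def setwise_stabilizer_def)
  have "orb p \<subseteq> A" using GA pA(1) by (auto simp: orb_def)
  then have q_orb: "q \<notin> orb p" using qA by blast
  have fix_stab: "{x. f x = x} = {p, q}" if "f \<in> stab p" "f \<noteq> id" for f
    using shared[of f m p] that m pA(2) q(2) by (auto simp: stab_def)
  have "card (stab p) dvd card (A - {p})"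
  proof (rule transformation_group.free_action_dvd)
    show "transformation_group (stab p)"
    proof
      show "inv f \<in> stab p" if "f \<in> stab p" for f
        using that inv_G by (auto simp: stab_def) (metis inv_simps(2))
    qed (auto simp: stab_def finite_G id_G comp_G bij_G)
    show "finite (A - {p})" using finA by simp
    show "f x \<in> A - {p}" if "f \<in> stab p" "x \<in> A - {p}" for f x
    proof -
      have "f x \<in> A" "f p = p" "f \<in> G" using that GA by (auto simp: stab_def)
      moreover have "f x \<noteq> f p" using that bij_G[OF \<open>f \<in> G\<close>] by (auto simp: bij_is_inj inj_eq)
      ultimately show ?thesis by auto
    qed
    show "f = id" if "f \<in> stab p" "x \<in> A - {p}" "f x = x" for f x
      using fix_stab[OF that(1)] that qA by blast
  qed
  moreover have "card (A - {p}) = n - 1" using A finA pA by simp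
  ultimately have dvd: "card (stab p) dvd n - 1" by simp
  have "card (stab p) \<ge> 2"
  proof -
    have "{id, m} \<subseteq> stab p" using m pA id_G by (auto simp: stab_def)
    then have "card {id, m} \<le> card (stab p)" using finite_stab by (intro card_mono)
    then show ?thesis using m(2) by simp
  qed
  moreover have "card (stab p) \<noteq> 2"
  proof
    assume "card (stab p) = 2"
    then have "even (n - 1)" using dvd by simp
    with n show False by simp
  qed
  moreover have "card (stab p) \<noteq> 3" using dvd n(3) by auto
  ultimately have large: "card (stab p) \<ge> 4" by simp
  have fix2: "card {x. g x = x} = 2" if g: "g \<in> G" "g \<noteq> id" for g
  proof -
    have "g \<in> Moeb" using g by (simp add: G_def setwise_stabilizer_def)
    then obtain x where "g x = x" using Moeb_has_fixed_point by blast
    then obtain y where "y \<noteq> x" "{z. g z = z} = {x, y}" using fixed_points[OF g] by blast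
    then show ?thesis by simp
  qed
  have fix_p: "g p = p" if "g \<in> G" for g
    by (rule large_stabilizer_fixes_point[OF fix2 shared m(1) q(2) q_orb large that])
  obtain g where g: "g \<in> G" "g \<noteq> id" "card {x \<in> A. g x = x} = e"
    using e by (auto simp: has_symmetry_fixing_def G_def setwise_stabilizer_def)
  have "{x. g x = x} = {p, q}" using fix_stab[of g] g fix_p by (auto simp: stab_def)
  then have "{x \<in> A. g x = x} = {p}" using pA(1) qA by blast
  then show ?thesis using g(3) by simp
qed

section \<open>Components of the locus of extra automorphisms\<close>

lemma connectedin_if_all_connected_to:
  assumes "\<And>c. c \<in> S \<Longrightarrow> connected_component_of (subtopology X S) c b"
  shows "connectedin X S"
proof -
  let ?Y = "subtopology X S"
  have "S \<subseteq> topspace X"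
  proof
    fix c assume "c \<in> S"
    then show "c \<in> topspace X"
      using connected_component_in_topspace[OF assms[of c]] by simp
  qed
  moreover have "connected_component_of ?Y c d" if "c \<in> S" "d \<in> S" for c d
    using connected_component_of_trans[OF assms[OF that(1)], of d] assms[OF that(2)]
      connected_component_of_sym[of ?Y d b] by blast
  ultimately show ?thesis
    by (simp add: connectedin_def connected_space_iff_connected_component)
qed

lemma connected_component_ofI:
  assumes "connectedin X C" "C \<subseteq> S" "a \<in> C" "b \<in> C"
  shows "connected_component_of (subtopology X S) a b"
  unfolding connected_component_of_def connectedin_subtopology using assms by blast

text \<open>In their union both sets are clopen.\<close>
lemma two_connected_components:
  assumes P: "connectedin X P" "closedin X P" "P \<noteq> {}"
    and Q: "connectedin X Q" "closedin X Q" "Q \<noteq> {}"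
    and disjoint: "P \<inter> Q = {}"
  shows "card (connected_components_of (subtopology X (P \<union> Q))) = 2"
proof -
  let ?Y = "subtopology X (P \<union> Q)"
  have sub: "P \<subseteq> topspace X" "Q \<subseteq> topspace X"
    using P Q by (simp_all add: closedin_subset)
  then have top: "topspace ?Y = P \<union> Q" by auto
  have closed: "closedin ?Y P" "closedin ?Y Q"
    using P(2) Q(2) by (auto intro: closedin_subset_topspace)
  have "topspace ?Y - P = Q" "topspace ?Y - Q = P" using top disjoint by auto
  then have "openin ?Y P" "openin ?Y Q"
    using closed by (metis openin_closedin_eq closedin_def openin_diff openin_topspace)+
  have conn: "connectedin ?Y P" "connectedin ?Y Q"
    using P(1) Q(1) by (auto simp: connectedin_subtopology)
  have component: "connected_component_of_set ?Y a = C"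
    if "connectedin ?Y C" "closedin ?Y C" "openin ?Y C" "a \<in> C" for a C
  proof
    show "C \<subseteq> connected_component_of_set ?Y a"
      using that by (intro connected_component_of_maximal)
    have "a \<in> topspace ?Y" using that by (meson closedin_subset subsetD)
    then have "a \<in> connected_component_of_set ?Y a" by (simp add: connected_component_of_refl)
    then have "\<not> disjnt (connected_component_of_set ?Y a) C" using that(4) by (auto simp: disjnt_def)
    then show "connected_component_of_set ?Y a \<subseteq> C"
      using connectedin_clopen_cases[OF connectedin_connected_component_of that(2,3)] by blast
  qed
  have "connected_components_of ?Y = {P, Q}"
  proof -
    have "connected_components_of ?Y = connected_component_of_set ?Y ` (P \<union> Q)"
      by (simp only: connected_components_of_def top)
    also have "\<dots> = connected_component_of_set ?Y ` P \<union> connected_component_of_set ?Y ` Q"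
      by (rule image_Un)
    also have "connected_component_of_set ?Y ` P = (\<lambda>_. P) ` P"
      by (rule image_cong) (simp_all add: component conn closed \<open>openin ?Y P\<close>)
    also have "connected_component_of_set ?Y ` Q = (\<lambda>_. Q) ` Q"
      by (rule image_cong) (simp_all add: component conn closed \<open>openin ?Y Q\<close>)
    finally show ?thesis using P(3) Q(3) by auto
  qed
  moreover have "P \<noteq> Q" using disjoint P(3) by blast
  ultimately show ?thesis by simp
qed

lemma extra_automorphism_locus_eq:
  fixes g :: nat
  defines "n \<equiv> 2 * g + 2"
  assumes "g \<ge> 1"
  shows "extra_automorphism_locus g =
    (symmetric_classes n 0 \<union> symmetric_classes n 2) \<union> symmetric_classes n 1"
proof (intro equalityI subsetI)
  fix c assume "c \<in> extra_automorphism_locus g"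
  then obtain A M where A: "c = moduli_class A" "card A = n" "M \<in> Moeb" "M \<noteq> id" "M ` A = A"
    unfolding extra_automorphism_locus_def n_def by blast
  define e where "e = card {x \<in> A. M x = x}"
  have e: "has_symmetry_fixing e A" using A by (auto simp: has_symmetry_fixing_def e_def)
  have "finite A" using A(2) by (intro card_ge_0_finite) (simp add: n_def)
  moreover have "card A \<ge> 3" using A(2) assms by simp
  ultimately have "e \<le> 2" by (rule symmetry_normal_form[OF _ _ e])
  then have "e = 0 \<or> e = 1 \<or> e = 2" by linarith
  moreover have "c \<in> symmetric_classes n e" unfolding A(1) by (intro symmetric_classesI A(2) e)
  ultimately show "c \<in> (symmetric_classes n 0 \<union> symmetric_classes n 2) \<union> symmetric_classes n 1"
    by blast
next
  fix c assume "c \<in> (symmetric_classes n 0 \<union> symmetric_classes n 2) \<union> symmetric_classes n 1"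
  then obtain A e where "c = moduli_class A" "card A = n" "has_symmetry_fixing e A"
    unfolding symmetric_classes_def by blast
  then show "c \<in> extra_automorphism_locus g"
    unfolding extra_automorphism_locus_def n_def has_symmetry_fixing_def by blast
qed

theorem extra_automorphism_locus_connectivity:
  fixes g :: nat
  assumes g: "g \<ge> 2"
  shows "3 dvd 2 * g + 1 \<Longrightarrow> connectedin (hyperelliptic_moduli g) (extra_automorphism_locus g)"
    and "\<not> 3 dvd 2 * g + 1 \<Longrightarrow>
      card (connected_components_of
        (subtopology (hyperelliptic_moduli g) (extra_automorphism_locus g))) = 2"
proof -
  define n where "n = 2 * g + 2"
  have n: "n \<ge> 6" "even n" "n - 1 = 2 * g + 1" using g by (auto simp: n_def)
  let ?X = "moduli_unordered n"
  define P where "P = symmetric_classes n 0 \<union> symmetric_classes n 2"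
  define Q where "Q = symmetric_classes n 1"
  have locus: "extra_automorphism_locus g = P \<union> Q"
    unfolding P_def Q_def n_def using g by (intro extra_automorphism_locus_eq) simp
  have X: "hyperelliptic_moduli g = ?X" by (simp add: hyperelliptic_moduli_def n_def)
  have conn: "connectedin ?X (symmetric_classes n e)" for e
    using symmetric_class_connected_to_polygon[of _ n e] n(1)
    by (intro connectedin_if_all_connected_to[where b = "moduli_class (polygon n e)"]) simp
  have poly0: "moduli_class (polygon n 0) \<in> symmetric_classes n 0"
    using n by (intro symmetric_classesI card_polygon polygon_symmetry) auto
  have poly02: "moduli_class (polygon n 0) \<in> symmetric_classes n 2"
    using n by (intro symmetric_classesI card_polygon polygon_inversion_symmetry) auto
  have poly1: "moduli_class (polygon n 1) \<in> symmetric_classes n 1"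
    using n by (intro symmetric_classesI card_polygon polygon_symmetry) auto
  have P: "connectedin ?X P"
    unfolding P_def using conn poly0 poly02 by (intro connectedin_Un) auto
  have Q: "connectedin ?X Q" unfolding Q_def by (rule conn)
  have closed: "closedin ?X P" "closedin ?X Q"
    unfolding P_def Q_def using n by (auto intro!: closedin_symmetric_classes)
  show "connectedin (hyperelliptic_moduli g) (extra_automorphism_locus g)" if three: "3 dvd 2 * g + 1"
  proof -
    have "3 dvd n - 1" "even n" "n \<ge> 4" using three n by simp_all
    then obtain A e where A: "card A = n" "has_symmetry_fixing 1 A" "e \<noteq> 1" "has_symmetry_fixing e A"
      by (rule tetrahedral_configuration)
    have "finite A" using A(1) n(1) by (intro card_ge_0_finite) simp
    moreover have "card A \<ge> 3" using A(1) n(1) by simp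
    ultimately have "e \<le> 2" by (rule symmetry_normal_form[OF _ _ A(4)])
    then have "e = 0 \<or> e = 2" using A(3) by linarith
    moreover have "moduli_class A \<in> symmetric_classes n e" by (rule symmetric_classesI[OF A(1,4)])
    ultimately have "moduli_class A \<in> P" unfolding P_def by blast
    moreover have "moduli_class A \<in> Q" unfolding Q_def by (rule symmetric_classesI[OF A(1,2)])
    ultimately have "P \<inter> Q \<noteq> {}" by blast
    then show ?thesis unfolding X locus by (rule connectedin_Un[OF P Q])
  qed
  show "card (connected_components_of
        (subtopology (hyperelliptic_moduli g) (extra_automorphism_locus g))) = 2"
    if not_three: "\<not> 3 dvd 2 * g + 1"
  proof -
    have "P \<inter> Q = {}"
    proof (rule ccontr)
      assume "P \<inter> Q \<noteq> {}"
      then obtain c where c: "c \<in> P" "c \<in> Q" by blast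
      from c(2) obtain A where A: "c = moduli_class A" "card A = n" "has_symmetry_fixing 1 A"
        unfolding Q_def symmetric_classes_def by blast
      have "has_symmetry_fixing 0 A \<or> has_symmetry_fixing 2 A"
        using c(1) unfolding P_def A(1) Un_iff moduli_class_in_symmetric_classes by blast
      moreover have "e = 1" if "has_symmetry_fixing e A" for e
      proof (rule one_fixed_point_exclusive[OF n(2) _ _ A(2,3) that])
        show "n \<ge> 4" "\<not> 3 dvd n - 1" using n not_three by simp_all
      qed
      ultimately show False by fastforce
    qed
    then show ?thesis unfolding X locus
      using P Q closed poly0 poly1 by (intro two_connected_components) (auto simp: P_def Q_def)
  qed
qed

section \<open>Conformal maps of the sphere are Moebius transformations\<close>

text \<open>The function has a pole at infinity, so it is a polynomial. Its derivative has no zeros by injectivity,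
and so is constant by the fundamental theorem of algebra.\<close>
lemma injective_entire_proper_linear:
  assumes hol: "f holomorphic_on UNIV" and inj: "inj f"
    and lim: "((inverse \<circ> f) \<longlongrightarrow> 0) at_infinity"
  obtains a b where "a \<noteq> 0" "\<And>z. f z = a * z + b"
proof -
  obtain a n where f: "\<And>z. f z = (\<Sum>i\<le>n. a i * z ^ i)"
    by (rule pole_at_infinity[OF hol lim]) (rule that)
  define p where "p = (\<Sum>i\<le>n. monom (a i) i)"
  have fp: "f = poly p"
    by (simp add: fun_eq_iff f p_def poly_sum poly_monom)
  have "deriv f z = poly (pderiv p) z" for z
    unfolding fp by (intro DERIV_imp_deriv poly_DERIV)
  then have "poly (pderiv p) z \<noteq> 0" for z
    using holomorphic_injective_imp_regular[OF hol open_UNIV inj, of z] by simp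
  moreover have "\<exists>z. poly (pderiv p) z = 0" if "\<not> constant (poly (pderiv p))"
    using that by (rule Fundamental_Theorem_Algebra.fundamental_theorem_of_algebra)
  ultimately have "constant (poly (pderiv p))" by blast
  then have "degree p - 1 = 0" by (simp add: constant_degree degree_pderiv)
  moreover have "degree p \<noteq> 0"
  proof
    assume "degree p = 0"
    then obtain c where "p = [:c:]" by (rule degree_eq_zeroE)
    then have "f 0 = f 1" by (simp add: fp)
    then show False using inj by (metis injD zero_neq_one)
  qed
  ultimately have deg: "degree p = 1" by simp
  have "f z = coeff p 1 * z + coeff p 0" for z
    using deg by (simp add: fp poly_altdef)
  moreover have "coeff p 1 \<noteq> 0" using deg by (metis leading_coeff_0_iff degree_0 zero_neq_one)
  ultimately show ?thesis by (intro that)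
qed

text \<open>Continuity at \<open>\<infinity>\<close>, restated as the limit that makes an entire function a polynomial.\<close>
lemma sphere_map_at_infinity:
  assumes cont: "continuous_map riemann_sphere riemann_sphere k" and None: "k None = None"
    and h: "\<And>z. k (Some z) = Some (h z)"
  shows "((inverse \<circ> h) \<longlongrightarrow> 0) at_infinity"
  unfolding Lim_at_infinity
proof (intro allI impI)
  fix e :: real assume e: "e > 0"
  define U :: "complex option set" where "U = insert None (Some ` {w. norm w > inverse e})"
  have "openin riemann_sphere U"
  proof -
    have "{w. Some w \<in> U} = {w. norm w > inverse e}" by (auto simp: U_def)
    moreover have "open {w :: complex. norm w > inverse e}"
      by (intro open_Collect_less continuous_intros)
    moreover have "{w. Some w \<notin> U} \<subseteq> cball 0 (inverse e)" by (auto simp: U_def)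
    then have "bounded {w. Some w \<notin> U}" using bounded_cball bounded_subset by blast
    ultimately show ?thesis by (simp add: openin_riemann_sphere)
  qed
  then have "openin riemann_sphere {x \<in> topspace riemann_sphere. k x \<in> U}"
    by (rule openin_continuous_map_preimage[OF cont])
  moreover have "k None \<in> U" by (simp add: None U_def)
  ultimately have "bounded {z. Some (h z) \<notin> U}" by (simp add: openin_riemann_sphere h)
  then obtain B where B: "\<And>z. Some (h z) \<notin> U \<Longrightarrow> norm z \<le> B" by (auto simp: bounded_iff)
  have "dist ((inverse \<circ> h) z) 0 < e" if "norm z \<ge> B + 1" for z
  proof -
    have "Some (h z) \<in> U" using B[of z] that by force
    then have *: "norm (h z) > inverse e" by (auto simp: U_def)
    then have "inverse (norm (h z)) < inverse (inverse e)"
      using e by (intro less_imp_inverse_less) auto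
    then show ?thesis using e by (simp add: norm_inverse)
  qed
  then show "\<exists>b. \<forall>x. norm x \<ge> b \<longrightarrow> dist ((inverse \<circ> h) x) 0 < e" by blast
qed

lemma sphere_map_fixing_infinity_affine:
  assumes cont: "continuous_map riemann_sphere riemann_sphere k" and None: "k None = None"
    and inj: "inj k" and h: "\<And>z. k (Some z) = Some (h z)" and hol: "h holomorphic_on UNIV"
  shows "k \<in> Moeb"
proof -
  have "inj h"
  proof (rule injI)
    fix z w assume "h z = h w"
    then have "k (Some z) = k (Some w)" by (simp add: h)
    then show "z = w" using inj by (auto dest: injD)
  qed
  then obtain a b where ab: "a \<noteq> 0" "\<And>z. h z = a * z + b"
    using injective_entire_proper_linear[OF hol _ sphere_map_at_infinity[OF cont None h]] by metis
  have "k = moebius_map a b 0 1"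
  proof
    show "k p = moebius_map a b 0 1 p" for p
      using ab None h by (cases p) (simp_all add: moebius_map_affine)
  qed
  then show ?thesis using ab(1) by (simp add: MoebI)
qed

text \<open>Composing with a Moebius map \<open>N\<close> that moves \<open>f \<infinity>\<close> to \<open>\<infinity>\<close> reduces the claim to maps fixing \<open>\<infinity>\<close>. The composite
is entire: near a point with \<open>f \<noteq> \<infinity>\<close> it is expressed through \<open>f\<close>, near a point with \<open>f \<noteq> 0\<close> through
\<open>1/f\<close>.\<close>
lemma conformal_sphere_map_imp_Moeb:
  assumes f: "conformal_sphere_map f"
  shows "f \<in> Moeb"
proof -
  have homeo: "homeomorphic_map riemann_sphere riemann_sphere f"
    using f by (simp add: conformal_sphere_map_def)
  then have cont: "continuous_map riemann_sphere riemann_sphere f"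
    by (rule homeomorphic_imp_continuous_map)
  have inj: "inj f" using homeomorphic_imp_injective_map[OF homeo] by simp
  let ?J = "moebius_map 0 1 1 0"
  have hol1: "(\<lambda>z. the (f (Some z))) holomorphic_on {z. f (Some z) \<noteq> None}"
    using f by (simp add: conformal_sphere_map_def sphere_charts_def)
  have hol2: "(\<lambda>z. the (?J (f (Some z)))) holomorphic_on {z. ?J (f (Some z)) \<noteq> None}"
    using f by (simp add: conformal_sphere_map_def sphere_charts_def)
  show ?thesis
  proof (cases "f None")
    case None
    have "f (Some z) \<noteq> None" for z using inj None by (metis injD option.distinct(1))
    then have h: "f (Some z) = Some (the (f (Some z)))" for z by simp
    have "{z. f (Some z) \<noteq> None} = UNIV" using \<open>\<And>z. f (Some z) \<noteq> None\<close> by blast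
    then have "(\<lambda>z. the (f (Some z))) holomorphic_on UNIV" using hol1 by (simp only:)
    then show ?thesis by (rule sphere_map_fixing_infinity_affine[OF cont None inj h])
  next
    case (Some c)
    define N where "N = moebius_map 0 1 1 (- c)"
    have N: "N \<in> Moeb" unfolding N_def by (rule MoebI) simp
    define k where "k = N \<circ> f"
    have kcont: "continuous_map riemann_sphere riemann_sphere k"
      unfolding k_def by (rule continuous_map_compose[OF cont continuous_map_Moeb[OF N]])
    have kinj: "inj k" unfolding k_def by (rule inj_compose[OF Moeb_inj[OF N] inj])
    have kNone: "k None = None" by (simp add: k_def N_def Some moebius_map_def)
    have fc: "f (Some z) \<noteq> Some c" for z using inj Some by (metis injD option.distinct(1))
    define F where "F z = the (f (Some z))" for z
    define G where "G z = the (?J (f (Some z)))" for z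
    define h where "h z = the (k (Some z))" for z
    have "k (Some z) \<noteq> None" for z using kinj kNone by (metis injD option.distinct(1))
    then have h: "k (Some z) = Some (h z)" for z by (simp add: h_def)
    \<comment> \<open>the domains of the two expressions for \<open>h\<close>, which cover the plane\<close>
    define S1 where "S1 = {z. f (Some z) \<noteq> None}"
    define S2 where "S2 = {z. ?J (f (Some z)) \<noteq> None}"
    have opS: "open {z. q (Some z) \<noteq> None}"
      if "continuous_map riemann_sphere riemann_sphere q" for q
      using openin_continuous_map_preimage[OF that openin_finite_part]
      by (simp add: openin_riemann_sphere)
    have op1: "open S1" unfolding S1_def by (rule opS[OF cont])
    have "continuous_map riemann_sphere riemann_sphere (?J \<circ> f)"
      by (rule continuous_map_compose[OF cont continuous_map_inversion_sphere])
    then have op2: "open S2" using opS[of "?J \<circ> f"] by (simp add: S2_def)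
    have h1: "h z = 1 / (F z - c) \<and> F z \<noteq> c" if z: "z \<in> S1" for z
    proof -
      obtain w where w: "f (Some z) = Some w" using z by (auto simp: S1_def)
      then have "w \<noteq> c" using fc[of z] by auto
      then show ?thesis by (simp add: h_def k_def F_def w N_def moebius_map_def)
    qed
    have h2: "h z = G z / (1 - c * G z) \<and> 1 - c * G z \<noteq> 0" if z: "z \<in> S2" for z
    proof (cases "f (Some z)")
      case None
      then show ?thesis by (simp add: h_def k_def G_def N_def moebius_map_def)
    next
      case (Some w)
      then have "w \<noteq> 0" using z by (auto simp: S2_def moebius_map_inversion)
      moreover have "w \<noteq> c" using fc[of z] Some by auto
      ultimately show ?thesis using Some
        by (simp add: h_def k_def G_def N_def moebius_map_def divide_simps)
    qed
    have "h holomorphic_on S1"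
    proof -
      have "(\<lambda>z. 1 / (F z - c)) holomorphic_on S1"
        using hol1 h1 unfolding F_def[symmetric] S1_def[symmetric]
        by (intro holomorphic_intros) auto
      then show ?thesis using h1 by (metis (mono_tags, lifting) holomorphic_transform)
    qed
    moreover have "h holomorphic_on S2"
    proof -
      have "(\<lambda>z. G z / (1 - c * G z)) holomorphic_on S2"
        using hol2 h2 unfolding G_def[symmetric] S2_def[symmetric]
        by (intro holomorphic_intros) auto
      then show ?thesis using h2 by (metis (mono_tags, lifting) holomorphic_transform)
    qed
    moreover have "S1 \<union> S2 = UNIV"
      by (auto simp: S1_def S2_def moebius_map_inversion)
    ultimately have "h holomorphic_on UNIV"
      using holomorphic_on_Un[of h S1 S2] op1 op2 by simp
    then have "k \<in> Moeb" by (rule sphere_map_fixing_infinity_affine[OF kcont kNone kinj h])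
    moreover have "f = inv N \<circ> k" using N by (simp add: k_def fun_eq_iff)
    ultimately show ?thesis using N by (simp add: Moeb_comp Moeb_inv)
  qed
qed

lemma Moeb_imp_conformal_sphere_map:
  assumes M: "M \<in> Moeb"
  shows "conformal_sphere_map M"
proof -
  have hol: "(\<lambda>z. the (K (Some z))) holomorphic_on {z. K (Some z) \<noteq> None}" if K: "K \<in> Moeb" for K
  proof -
    obtain a b c d where K: "K = moebius_map a b c d" "a * d - b * c \<noteq> 0" using K by (rule MoebE)
    have "(\<lambda>z. (a * z + b) / (c * z + d)) holomorphic_on {z. K (Some z) \<noteq> None}"
      by (intro holomorphic_intros) (auto simp: K(1) moebius_map_def split: if_splits)
    then show ?thesis
      by (rule holomorphic_transform) (auto simp: K(1) moebius_map_def split: if_splits)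
  qed
  have charts: "\<phi> \<in> Moeb" if "\<phi> \<in> sphere_charts" for \<phi>
    using that MoebI[of 0 0 1 1] by (auto simp: sphere_charts_def)
  show ?thesis
    unfolding conformal_sphere_map_def
  proof (intro conjI ballI homeomorphic_map_Moeb M)
    fix \<phi> \<psi> assume "\<phi> \<in> sphere_charts" "\<psi> \<in> sphere_charts"
    then have "\<psi> \<circ> M \<circ> \<phi> \<in> Moeb" by (intro Moeb_comp charts M)
    from hol[OF this] show "(\<lambda>z. the (\<psi> (M (\<phi> (Some z))))) holomorphic_on {z. \<psi> (M (\<phi> (Some z))) \<noteq> None}"
      by simp
  qed
qed

section \<open>Anticonformal involutions\<close>

abbreviation conjugation :: "complex option \<Rightarrow> complex option" where
  "conjugation \<equiv> map_option cnj"

definition antipodal :: "complex option \<Rightarrow> complex option" where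
  "antipodal = moebius_map 0 (- 1) 1 0 \<circ> conjugation"

lemma antipodal_apply: "antipodal None = Some 0" "antipodal (Some 0) = None"
  "z \<noteq> 0 \<Longrightarrow> antipodal (Some z) = Some (- 1 / cnj z)"
  by (simp_all add: antipodal_def moebius_map_def)

lemma conjugation_involution: "conjugation \<circ> conjugation = id"
  by (simp add: fun_eq_iff option.map_comp comp_def option.map_ident)

lemma antipodal_involution: "antipodal \<circ> antipodal = id"
proof
  show "(antipodal \<circ> antipodal) p = id p" for p
  proof (cases p)
    case (Some z)
    then show ?thesis by (cases "z = 0") (simp_all add: antipodal_apply)
  qed (simp add: antipodal_apply)
qed

lemma anticonformal_conjugation: "anticonformal_involution conjugation"
  by (simp add: anticonformal_involution_def anticonformal_sphere_map_def conjugation_involution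
      Moeb_imp_conformal_sphere_map)

lemma anticonformal_antipodal: "anticonformal_involution antipodal"
proof -
  have "antipodal \<circ> conjugation = moebius_map 0 (- 1) 1 0"
    by (simp add: antipodal_def comp_assoc conjugation_involution)
  then show ?thesis
    by (simp add: anticonformal_involution_def anticonformal_sphere_map_def antipodal_involution
        Moeb_imp_conformal_sphere_map MoebI)
qed

lemma conjugation_moebius_map:
  "conjugation \<circ> moebius_map a b c d = moebius_map (cnj a) (cnj b) (cnj c) (cnj d) \<circ> conjugation"
proof
  have eq0: "cnj c * cnj z + cnj d = 0 \<longleftrightarrow> c * z + d = 0" for z
    by (metis complex_cnj_add complex_cnj_mult complex_cnj_zero_iff)
  show "(conjugation \<circ> moebius_map a b c d) p =
      (moebius_map (cnj a) (cnj b) (cnj c) (cnj d) \<circ> conjugation) p" for p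
    by (cases p) (simp_all add: moebius_map_def eq0)
qed

lemma conjugation_Moeb:
  assumes "N \<in> Moeb"
  obtains N' where "N' \<in> Moeb" "conjugation \<circ> N = N' \<circ> conjugation"
proof -
  obtain a b c d where N: "N = moebius_map a b c d" "a * d - b * c \<noteq> 0" using assms by (rule MoebE)
  have "cnj a * cnj d - cnj b * cnj c \<noteq> 0"
    using N(2) by (metis complex_cnj_diff complex_cnj_mult complex_cnj_zero_iff)
  then have "moebius_map (cnj a) (cnj b) (cnj c) (cnj d) \<in> Moeb" by (rule MoebI)
  then show ?thesis by (rule that) (simp add: N(1) conjugation_moebius_map)
qed

text \<open>Conjugation commutes with Moebius maps up to conjugating the coefficients, so the maps \<open>M \<circ> conjugation\<close>
are stable under changes of coordinate.\<close>
lemma conjugate_antiholomorphic: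
  assumes M: "M \<in> Moeb" and N: "N \<in> Moeb"
  obtains M' where "M' \<in> Moeb" "N \<circ> (M \<circ> conjugation) \<circ> inv N = M' \<circ> conjugation"
proof -
  obtain N' where N': "N' \<in> Moeb" "conjugation \<circ> inv N = N' \<circ> conjugation"
    using conjugation_Moeb[OF Moeb_inv[OF N]] .
  have "N \<circ> (M \<circ> conjugation) \<circ> inv N = N \<circ> M \<circ> N' \<circ> conjugation"
    using N'(2) by (simp add: comp_assoc)
  moreover have "N \<circ> M \<circ> N' \<in> Moeb" by (intro Moeb_comp M N N')
  ultimately show ?thesis using that by blast
qed

text \<open>An antiholomorphic affine involution is a reflection in a line. The factor \<open>s\<close> rotates the line to a
horizontal one, and the shift \<open>t\<close> moves that to the real axis.\<close>
lemma reflection_normal_form: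
  assumes a: "\<And>z. a * cnj (a * cnj z + b) + b = (z :: complex)"
  obtains s t where "s \<noteq> 0" "\<And>z. s * (a * cnj z + b) + t = cnj (s * z + t)"
proof -
  have b: "a * cnj b + b = 0" using a[of 0] by simp
  have "a * cnj a + (a * cnj b + b) = 1" using a[of 1] by (simp add: algebra_simps)
  then have aa: "a * cnj a = 1" using b by simp
  \<comment> \<open>The linear part \<open>a * cnj z\<close> preserves the direction of \<open>sqrt a\<close>, which has norm 1;
    multiplying by its conjugate makes this direction horizontal.\<close>
  define r where "r = csqrt a"
  have r: "r * r = a" by (simp add: r_def flip: power2_eq_square)
  have "r \<noteq> 0" using r aa by auto
  define s where "s = cnj r"
  have "norm a = 1" using aa
    by (metis complex_mod_cnj norm_mult norm_one norm_ge_zero abs_of_nonneg real_sqrt_abs2 real_sqrt_one)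
  then have "norm r = 1" using r
    by (metis norm_mult norm_ge_zero abs_of_nonneg real_sqrt_abs2 real_sqrt_one)
  then have rr: "r * cnj r = 1" using complex_norm_square[of r] by simp
  have sa: "s * a = cnj s"
  proof -
    have "s * a = (r * cnj r) * r" unfolding s_def r[symmetric] by (simp add: mult_ac)
    then show ?thesis by (simp add: rr s_def)
  qed
  define t where "t = - (s * b) / 2"
  have im: "cnj (s * b) = - (s * b)"
  proof -
    have "cnj (s * b) + s * b = s * a * cnj b + s * b" by (simp add: sa)
    also have "\<dots> = s * (a * cnj b + b)" by (simp add: algebra_simps)
    finally show ?thesis using b by (simp add: eq_neg_iff_add_eq_0)
  qed
  have "s * (a * cnj z + b) + t = cnj (s * z + t)" for z
  proof -
    have "s * (a * cnj z + b) + t = (s * a) * cnj z + s * b / 2" by (simp add: t_def algebra_simps)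
    also have "\<dots> = cnj s * cnj z + cnj t" using im by (simp add: sa t_def del: complex_cnj_mult)
    finally show ?thesis by simp
  qed
  moreover have "s \<noteq> 0" using \<open>r \<noteq> 0\<close> by (simp add: s_def)
  ultimately show ?thesis using that by blast
qed

text \<open>If the involution has a fixed point, it is placed at \<open>\<infinity>\<close> and the map is a reflection. Otherwise a point
and its image are placed at \<open>\<infinity>\<close> and \<open>0\<close>, where the map is \<open>\<rho> / cnj z\<close> with \<open>\<rho>\<close> real; \<open>\<rho> > 0\<close> would give
the fixed point \<open>sqrt \<rho>\<close>, so \<open>\<rho> < 0\<close> and a scaling gives \<open>-1 / cnj z\<close>.\<close>
theorem anticonformal_involution_normal_form:
  assumes T: "anticonformal_involution T"
  obtains N where "N \<in> Moeb" "N \<circ> T = conjugation \<circ> N \<or> N \<circ> T = antipodal \<circ> N"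
proof -
  define M where "M = T \<circ> conjugation"
  have M: "M \<in> Moeb" using T
    by (simp add: anticonformal_involution_def anticonformal_sphere_map_def
        conformal_sphere_map_imp_Moeb M_def)
  have TM: "T = M \<circ> conjugation" by (simp add: M_def comp_assoc conjugation_involution)
  have TT: "T (T x) = x" for x
    using T by (metis anticonformal_involution_def comp_apply id_apply)
  have finish: "\<exists>N\<in>Moeb. N \<circ> T = R \<circ> N"
    if N: "N \<in> Moeb" and K: "K \<in> Moeb" and T1: "T1 = N \<circ> T \<circ> inv N" and R: "K \<circ> T1 = R \<circ> K"
    for N K T1 R
  proof (rule bexI[of _ "K \<circ> N"])
    have "K \<circ> N \<circ> T = K \<circ> T1 \<circ> N" using N by (simp add: T1 fun_eq_iff)
    also have "\<dots> = R \<circ> (K \<circ> N)" by (simp add: R comp_assoc)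
    finally show "K \<circ> N \<circ> T = R \<circ> (K \<circ> N)" .
  qed (intro Moeb_comp K N)
  show ?thesis
  proof (cases "\<exists>p. T p = p")
    case True
    then obtain p where p: "T p = p" by blast
    obtain N where N: "N \<in> Moeb" "N p = None" by (rule Moeb_to_None)
    define T1 where "T1 = N \<circ> T \<circ> inv N"
    have T1T1: "T1 (T1 x) = x" for x using N TT by (simp add: T1_def)
    have "inv N None = p" using N by (metis Moeb_inv_comp(4))
    then have T1None: "T1 None = None" using p N by (simp add: T1_def)
    obtain M1 where M1: "M1 \<in> Moeb" "T1 = M1 \<circ> conjugation"
      using conjugate_antiholomorphic[OF M N(1)] unfolding T1_def TM .
    have "M1 None = None" using T1None M1(2) by simp
    then obtain a b where ab: "a \<noteq> 0" "M1 = moebius_map a b 0 1" using Moeb_fix_None[OF M1(1)] by metis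
    have T1z: "T1 (Some z) = Some (a * cnj z + b)" for z by (simp add: M1(2) ab(2) moebius_map_affine)
    have inv: "a * cnj (a * cnj z + b) + b = z" for z using T1T1[of "Some z"] by (simp add: T1z)
    obtain s t where st: "s \<noteq> 0" "\<And>z. s * (a * cnj z + b) + t = cnj (s * z + t)"
      by (rule reflection_normal_form[OF inv]) (rule that)
    define K where "K = moebius_map s t 0 1"
    have K: "K \<in> Moeb" unfolding K_def by (rule MoebI) (simp add: st)
    have "K \<circ> T1 = conjugation \<circ> K"
    proof
      show "(K \<circ> T1) x = (conjugation \<circ> K) x" for x
        using st(2) by (cases x) (simp_all add: K_def T1None T1z moebius_map_affine del: complex_cnj_add)
    qed
    then have "\<exists>N\<in>Moeb. N \<circ> T = conjugation \<circ> N" by (rule finish[OF N(1) K T1_def])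
    then show ?thesis using that by blast
  next
    case False
    then have "T None \<noteq> None" by (rule contrapos_nn) (rule exI)
    then obtain N where N: "N \<in> Moeb" "N None = None" "N (T None) = Some 0"
      using Moeb_to_None_0[of None "T None"] by metis
    define T1 where "T1 = N \<circ> T \<circ> inv N"
    have T1T1: "T1 (T1 x) = x" for x using N TT by (simp add: T1_def)
    have "inv N None = None" using N by (metis Moeb_inv_comp(4))
    then have T1None: "T1 None = Some 0" using N by (simp add: T1_def)
    then have T10: "T1 (Some 0) = None" using T1T1[of None] by simp
    obtain M1 where M1: "M1 \<in> Moeb" "T1 = M1 \<circ> conjugation"
      using conjugate_antiholomorphic[OF M N(1)] unfolding T1_def TM .
    define M2 where "M2 = M1 \<circ> moebius_map 0 1 1 0"
    have M2: "M2 \<in> Moeb" unfolding M2_def by (intro Moeb_comp M1 MoebI) simp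
    have "M2 None = None" "M2 (Some 0) = Some 0"
      using T1None T10 M1(2) by (simp_all add: M2_def moebius_map_inversion)
    then obtain a where a: "a \<noteq> 0" "M2 = rotation a" using Moeb_fix_None_0[OF M2] by metis
    have T1z: "T1 (Some z) = Some (a / cnj z)" if "z \<noteq> 0" for z
    proof -
      have "M2 (Some (inverse (cnj z))) = M1 (Some (cnj z))"
        using that by (simp add: M2_def moebius_map_inversion)
      then show ?thesis using a(2) M1(2) by (simp add: moebius_map_affine divide_inverse)
    qed
    have "T1 (T1 (Some 1)) = Some (a / cnj a)" using a(1) by (simp add: T1z)
    then have "a = cnj a" using T1T1[of "Some 1"] a(1) by (simp add: divide_eq_1_iff)
    then have "a \<in> \<real>" by (simp add: Reals_cnj_iff)
    then obtain \<rho> where rho: "a = complex_of_real \<rho>" by (auto simp: Reals_def)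
    have "\<rho> < 0"
    proof (rule ccontr)
      assume "\<not> \<rho> < 0"
      then have pos: "\<rho> > 0" using a(1) rho by (cases "\<rho> = 0") auto
      define x where "x = complex_of_real (sqrt \<rho>)"
      have "x \<noteq> 0" using pos by (simp add: x_def)
      moreover have "a / cnj x = x"
        using pos by (simp add: x_def rho divide_eq_eq flip: of_real_mult of_real_divide)
      ultimately have "T1 (Some x) = Some x" using T1z by simp
      then have "N (T (inv N (Some x))) = Some x" by (simp add: T1_def)
      then have "T (inv N (Some x)) = inv N (Some x)" using N(1) by (metis Moeb_inv_comp(4))
      with False show False by blast
    qed
    define s where "s = complex_of_real (1 / sqrt (- \<rho>))"
    have s: "s \<noteq> 0" "cnj s = s" "s * s * a = - 1"
    proof -
      show "s \<noteq> 0" "cnj s = s" using \<open>\<rho> < 0\<close> by (simp_all add: s_def)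
      have "(1 / sqrt (- \<rho>)) * (1 / sqrt (- \<rho>)) * \<rho> = - 1" using \<open>\<rho> < 0\<close> by simp
      then show "s * s * a = - 1" unfolding s_def rho by (metis of_real_mult of_real_minus of_real_1)
    qed
    define K where "K = rotation s"
    have K: "K \<in> Moeb" unfolding K_def by (rule rotation_Moeb[OF s(1)])
    have "K \<circ> T1 = antipodal \<circ> K"
    proof
      fix x show "(K \<circ> T1) x = (antipodal \<circ> K) x"
      proof (cases x)
        case (Some z)
        show ?thesis
        proof (cases "z = 0")
          case False
          have "s * (a / cnj z) = - 1 / (s * cnj z)"
            using s(1,3) False by (simp add: field_simps)
          then show ?thesis using Some False s by (simp add: K_def moebius_map_affine T1z antipodal_apply)
        qed (simp add: Some K_def T10 antipodal_apply moebius_map_affine)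
      qed (simp add: K_def T1None antipodal_apply moebius_map_affine)
    qed
    then have "\<exists>N\<in>Moeb. N \<circ> T = antipodal \<circ> N" by (rule finish[OF N(1) K T1_def])
    then show ?thesis using that by blast
  qed
qed

section \<open>Sets invariant under complex conjugation\<close>

lemma real_locus_eq:
  fixes g :: nat
  shows "real_locus g = {moduli_class A | A. card A = 2 * g + 2 \<and>
      (conjugation ` A = A \<or> antipodal ` A = A)}"
proof (intro equalityI subsetI)
  fix c assume "c \<in> real_locus g"
  then obtain A T where A: "c = moduli_class A" "card A = 2 * g + 2"
    and T: "anticonformal_involution T" "T ` A = A"
    unfolding real_locus_def by blast
  obtain N where N: "N \<in> Moeb" "N \<circ> T = conjugation \<circ> N \<or> N \<circ> T = antipodal \<circ> N"
    using anticonformal_involution_normal_form[OF T(1)] .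
  have "R ` N ` A = N ` A" if "N \<circ> T = R \<circ> N" for R
    using that T(2) by (metis image_comp)
  then have "conjugation ` N ` A = N ` A \<or> antipodal ` N ` A = N ` A" using N(2) by blast
  moreover have "card (N ` A) = 2 * g + 2"
    using A(2) Moeb_inj[OF N(1)] by (simp add: card_image inj_on_subset)
  moreover have "c = moduli_class (N ` A)" using A(1) moduli_class_image[OF N(1)] by simp
  ultimately show "c \<in> {moduli_class A | A. card A = 2 * g + 2 \<and>
      (conjugation ` A = A \<or> antipodal ` A = A)}"
    by blast
next
  fix c assume "c \<in> {moduli_class A | A. card A = 2 * g + 2 \<and>
      (conjugation ` A = A \<or> antipodal ` A = A)}"
  then show "c \<in> real_locus g"
    unfolding real_locus_def using anticonformal_conjugation anticonformal_antipodal by blast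
qed

lemma open_convex_half_planes:
  fixes Q :: "(real \<times> complex) set"
  assumes "finite Q"
  defines "S \<equiv> {t. \<forall>(\<alpha>, \<beta>) \<in> Q. \<alpha> + Re (\<beta> * t) > 0}"
  shows "open S" "convex S"
proof -
  have S: "S = (\<Inter>q\<in>Q. {t. fst q + Re (snd q * t) > 0})"
    by (auto simp: S_def case_prod_unfold)
  have "open {t. fst q + Re (snd q * t) > 0}" for q :: "real \<times> complex"
    by (intro open_Collect_less continuous_intros)
  then show "open S" unfolding S using assms(1) by (intro open_INT) auto
  have "convex {t. fst q + Re (snd q * t) > 0}" for q :: "real \<times> complex"
  proof -
    have "{t. fst q + Re (snd q * t) > 0} = {t. inner (cnj (snd q)) t > - fst q}"
      by (auto simp: inner_complex_def)
    then show ?thesis by (simp add: convex_halfspace_gt)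
  qed
  then show "convex S" unfolding S by (intro convex_INT) auto
qed

text \<open>The general form of a finite set of finite points that is invariant under conjugation.\<close>
definition conj_config :: "nat \<Rightarrow> nat \<Rightarrow> (nat \<Rightarrow> real) \<Rightarrow> (nat \<Rightarrow> complex) \<Rightarrow> complex option set" where
  "conj_config k h r u =
     (\<lambda>i. Some (complex_of_real (r i))) ` {..<k} \<union> (\<lambda>j. Some (u j)) ` {..<h} \<union> (\<lambda>j. Some (cnj (u j))) ` {..<h}"

definition real_ordered :: "nat \<Rightarrow> (nat \<Rightarrow> real) \<Rightarrow> bool" where
  "real_ordered k r \<longleftrightarrow> (\<forall>i<k. \<forall>j<k. i < j \<longrightarrow> r i < r j)"

definition upper_config :: "nat \<Rightarrow> (nat \<Rightarrow> complex) \<Rightarrow> bool" where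
  "upper_config h u \<longleftrightarrow> (\<forall>j<h. Im (u j) > 0) \<and> inj_on u {..<h}"

lemma conjugation_conj_config: "conjugation ` conj_config k h r u = conj_config k h r u"
  unfolding conj_config_def image_Un image_image by auto

text \<open>The real points keep their order and the points \<open>u j\<close> stay in the upper half-plane, for all parameters \<open>t\<close>
in a convex open set containing \<open>0\<close> and \<open>1\<close>; the real points use the real part of \<open>t\<close>. Then only collisions in the upper
half-plane have to be avoided.\<close>
lemma conj_config_connected:
  fixes g :: nat
  assumes n: "2 * g + 2 = k + 2 * h"
    and r: "real_ordered k r" and s: "real_ordered k s"
    and u: "upper_config h u" and v: "upper_config h v"
  shows "connected_component_of (subtopology (hyperelliptic_moduli g) (real_locus g))
    (moduli_class (conj_config k h r u)) (moduli_class (conj_config k h s v))"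
proof -
  define a where "a t j = u j + t * (v j - u j)" for t j
  define b where "b t i = r i + Re t * (s i - r i)" for t i
  \<comment> \<open>one real affine inequality in \<open>t\<close> for each point \<open>u j\<close> and for each pair of real points\<close>
  define Q where "Q = (\<lambda>j. (Im (u j), - \<i> * (v j - u j))) ` {..<h} \<union>
    (\<lambda>(i, j). (r j - r i, complex_of_real ((s j - r j) - (s i - r i)))) ` {(i, j). i < k \<and> j < k \<and> i < j}"
  define S where "S = {t. \<forall>(\<alpha>, \<beta>) \<in> Q. \<alpha> + Re (\<beta> * t) > 0}"
  have "finite {(i, j). i < k \<and> j < k \<and> i < j}"
    by (rule finite_subset[of _ "{..<k} \<times> {..<k}"]) auto
  then have "finite Q" by (simp add: Q_def)
  note S_open_convex = open_convex_half_planes[OF this, folded S_def]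
  have S_iff: "t \<in> S \<longleftrightarrow> (\<forall>j<h. Im (a t j) > 0) \<and> real_ordered k (b t)" for t
  proof -
    have 1: "Im (u j) + Re (- \<i> * (v j - u j) * t) = Im (a t j)" for j
      by (simp add: a_def algebra_simps)
    have 2: "(r j - r i) + Re (complex_of_real ((s j - r j) - (s i - r i)) * t) = b t j - b t i" for i j
      by (simp add: b_def algebra_simps)
    have "t \<in> S \<longleftrightarrow> (\<forall>j\<in>{..<h}. Im (u j) + Re (- \<i> * (v j - u j) * t) > 0) \<and>
      (\<forall>i j. i < k \<and> j < k \<and> i < j \<longrightarrow>
         (r j - r i) + Re (complex_of_real ((s j - r j) - (s i - r i)) * t) > 0)"
      unfolding S_def Q_def mem_Collect_eq ball_Un ball_image_pairs ball_image_pair ..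
    then show ?thesis unfolding 1 2 real_ordered_def diff_gt_0_iff_gt Ball_def lessThan_iff by blast
  qed
  define D where "D = {t \<in> S. inj_on (a t) {..<h}}"
  have D: "connected D"
    unfolding D_def a_def using u S_open_convex
    by (intro connected_injective_parameters) (auto simp: upper_config_def)
  have D_iff: "t \<in> D \<longleftrightarrow> upper_config h (a t) \<and> real_ordered k (b t)" for t
    unfolding D_def mem_Collect_eq S_iff upper_config_def by blast
  define I where "I = Inl ` {..<k} \<union> Inr ` ({..<h} \<times> (UNIV :: bool set))"
  define f where "f t = case_sum (\<lambda>i. Some (complex_of_real (b t i)))
      (\<lambda>(j, c). Some (if c then a t j else cnj (a t j)))" for t
  have f_image: "f t ` I = conj_config k h (b t) (a t)" for t
  proof -
    have "{..<h} \<times> (UNIV :: bool set) = (\<lambda>j. (j, True)) ` {..<h} \<union> (\<lambda>j. (j, False)) ` {..<h}"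
      by (auto simp: image_iff)
    then show ?thesis
      unfolding I_def f_def conj_config_def by (simp add: image_Un image_image Un_assoc)
  qed
  have cardI: "card I = 2 * g + 2"
  proof -
    have "card I = card (Inl ` {..<k} :: (nat + nat \<times> bool) set) +
        card (Inr ` ({..<h} \<times> (UNIV :: bool set)) :: (nat + nat \<times> bool) set)"
      unfolding I_def by (intro card_Un_disjoint) auto
    then show ?thesis using n by (simp add: card_image)
  qed
  have finI: "finite I" by (simp add: I_def)
  have inj: "inj_on (f t) I" if "t \<in> D" for t
  proof -
    have up: "Im (a t j) > 0" if "j < h" for j
      using \<open>t \<in> D\<close> that by (auto simp: D_iff upper_config_def)
    have inja: "i = j" if "a t i = a t j" "i < h" "j < h" for i j
      using \<open>t \<in> D\<close> that by (auto simp: D_iff upper_config_def inj_on_def)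
    have injb: "i = j" if "b t i = b t j" "i < k" "j < k" for i j
      using \<open>t \<in> D\<close> that unfolding D_iff real_ordered_def by (metis less_irrefl nat_neq_iff)
    have neq: "a t i \<noteq> cnj (a t j)" "cnj (a t j) \<noteq> a t i" if "i < h" "j < h" for i j
      using up[OF that(1)] up[OF that(2)] by (auto simp: complex_eq_iff)
    have real: "complex_of_real x \<noteq> a t j" "complex_of_real x \<noteq> cnj (a t j)"
      "a t j \<noteq> complex_of_real x" "cnj (a t j) \<noteq> complex_of_real x" if "j < h" for x j
      using up[OF that] by (auto simp: complex_eq_iff)
    show ?thesis
    proof (rule inj_onI)
      fix x y assume xy: "x \<in> I" "y \<in> I" "f t x = f t y"
      show "x = y"
      proof (cases x)
        case (Inl i)
        show ?thesis
        proof (cases y)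
          case (Inl i')
          then show ?thesis using xy \<open>x = Inl i\<close> injb by (auto simp: I_def f_def)
        next
          case (Inr jc)
          then show ?thesis using xy \<open>x = Inl i\<close> real
            by (cases jc) (auto simp: I_def f_def split: if_splits)
        qed
      next
        case (Inr jc)
        obtain j c where jc: "jc = (j, c)" by (cases jc)
        show ?thesis
        proof (cases y)
          case (Inl i')
          then show ?thesis using xy \<open>x = Inr jc\<close> real jc
            by (auto simp: I_def f_def split: if_splits)
        next
          case (Inr jc')
          obtain j' c' where jc': "jc' = (j', c')" by (cases jc')
          then show ?thesis using xy \<open>x = Inr jc\<close> jc Inr inja neq
            by (auto simp: I_def f_def split: if_splits)
        qed
      qed
    qed
  qed
  have "continuous_map (top_of_set D) riemann_sphere (\<lambda>t. f t i)" if "i \<in> I" for i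
  proof (cases i)
    case (Inl p)
    then show ?thesis unfolding f_def
      by (auto simp: b_def intro!: continuous_map_Some_comp continuous_intros)
  next
    case (Inr jc)
    then show ?thesis unfolding f_def
      by (cases jc; cases "snd jc") (auto simp: a_def intro!: continuous_map_Some_comp continuous_intros)
  qed
  then have "connectedin (hyperelliptic_moduli g) ((\<lambda>t. moduli_class (f t ` I)) ` D)"
    unfolding hyperelliptic_moduli_def
    by (intro connectedin_moving_points[OF D cardI finI] inj)
  moreover have "(\<lambda>t. moduli_class (f t ` I)) ` D \<subseteq> real_locus g"
  proof
    fix c assume "c \<in> (\<lambda>t. moduli_class (f t ` I)) ` D"
    then obtain t where t: "t \<in> D" "c = moduli_class (f t ` I)" by blast
    have "card (f t ` I) = 2 * g + 2" using card_image[OF inj[OF t(1)]] cardI by simp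
    moreover have "conjugation ` f t ` I = f t ` I" unfolding f_image by (rule conjugation_conj_config)
    ultimately show "c \<in> real_locus g" unfolding real_locus_eq t(2) by blast
  qed
  moreover have ends: "a 0 = u" "a 1 = v" "b 0 = r" "b 1 = s"
    by (simp_all add: a_def b_def fun_eq_iff)
  moreover have "0 \<in> D" "1 \<in> D" using r s u v by (simp_all add: D_iff ends)
  then have "moduli_class (f 0 ` I) \<in> (\<lambda>t. moduli_class (f t ` I)) ` D"
    "moduli_class (f 1 ` I) \<in> (\<lambda>t. moduli_class (f t ` I)) ` D" by blast+
  ultimately show ?thesis
    by (intro connected_component_ofI) (simp_all add: f_image)
qed

lemma conjugation_invariant_finite_part:
  assumes A: "finite A" "conjugation ` A = A" "None \<notin> A"
  obtains h r u where "real_ordered (card {x \<in> A. conjugation x = x}) r" "upper_config h u"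
    "A = conj_config (card {x \<in> A. conjugation x = x}) h r u"
    "card A = card {x \<in> A. conjugation x = x} + 2 * h"
proof -
  define R where "R = {x. Some (complex_of_real x) \<in> A}"
  define U where "U = {z. Some z \<in> A \<and> Im z > 0}"
  have finR: "finite R" and finU: "finite U"
  proof -
    have "inj (\<lambda>x. Some (complex_of_real x))" by (simp add: inj_def)
    from finite_vimageI[OF A(1) this] show "finite R" by (simp add: R_def vimage_def)
    have "finite {z. Some z \<in> A}" using finite_vimageI[OF A(1) inj_Some] by (simp add: vimage_def)
    then show "finite U" by (rule rev_finite_subset) (auto simp: U_def)
  qed
  have cA: "Some (cnj z) \<in> A" if "Some z \<in> A" for z
    using A(2) that by (metis image_eqI option.map(2))
  have fixed: "{x \<in> A. conjugation x = x} = (\<lambda>x. Some (complex_of_real x)) ` R"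
  proof (intro equalityI subsetI)
    fix p assume p: "p \<in> {x \<in> A. conjugation x = x}"
    then obtain z where z: "p = Some z" using A(3) by (cases p) auto
    then have "cnj z = z" using p by simp
    then have "z = complex_of_real (Re z)" by (simp add: complex_eq_iff)
    then show "p \<in> (\<lambda>x. Some (complex_of_real x)) ` R" using p z
      by (intro image_eqI[of _ _ "Re z"]) (auto simp: R_def)
  qed (auto simp: R_def)
  define k where "k = card R"
  have card_fixed: "card {x \<in> A. conjugation x = x} = k"
    unfolding fixed k_def by (intro card_image) (simp add: inj_on_def)
  define r where "r i = sorted_list_of_set R ! i" for i
  have r: "real_ordered k r"
    unfolding real_ordered_def r_def k_def
    using sorted_wrt_nth_less[OF strict_sorted_list_of_set[of R]] finR by simp
  have r_image: "r ` {..<k} = R"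
  proof -
    have "r ` {..<k} = set (sorted_list_of_set R)"
      unfolding r_def k_def set_conv_nth using finR by auto
    then show ?thesis using finR by simp
  qed
  define h where "h = card U"
  obtain u where u: "bij_betw u {..<h} U"
    using bij_betw_from_nat_into_finite[OF finU] by (auto simp: h_def)
  have uU: "u ` {..<h} = U" using u by (simp add: bij_betw_def)
  have upper: "upper_config h u"
    using u by (auto simp: upper_config_def bij_betw_def U_def)
  have config: "conj_config k h r u = (\<lambda>x. Some (complex_of_real x)) ` R \<union> Some ` U \<union> Some ` cnj ` U"
    unfolding conj_config_def r_image[symmetric] uU[symmetric] by (simp only: image_image)
  have A_eq: "A = conj_config k h r u"
  proof (intro equalityI subsetI)
    fix p assume p: "p \<in> A"
    then obtain z where z: "p = Some z" using A(3) by (cases p) auto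
    consider "Im z = 0" | "Im z > 0" | "Im z < 0" by linarith
    then show "p \<in> conj_config k h r u"
    proof cases
      case 1
      then have "z = complex_of_real (Re z)" by (simp add: complex_eq_iff)
      then have "Re z \<in> R" "p = Some (complex_of_real (Re z))" using p z by (simp_all add: R_def)
      then show ?thesis unfolding config by blast
    next
      case 2
      then show ?thesis using p z unfolding config by (simp add: U_def)
    next
      case 3
      then have "cnj z \<in> U" using cA p z by (simp add: U_def)
      then have "Some (cnj (cnj z)) \<in> Some ` cnj ` U" by blast
      then show ?thesis using z unfolding config by simp
    qed
  next
    fix p assume "p \<in> conj_config k h r u"
    then show "p \<in> A" unfolding config using cA by (auto simp: R_def U_def)
  qed
  have "card A = k + 2 * h"
  proof -
    have disj: "(\<lambda>x. Some (complex_of_real x)) ` R \<inter> Some ` U = {}"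
      "((\<lambda>x. Some (complex_of_real x)) ` R \<union> Some ` U) \<inter> Some ` cnj ` U = {}"
      by (auto simp: U_def complex_eq_iff)
    have "card A = card ((\<lambda>x. Some (complex_of_real x)) ` R \<union> Some ` U) + card (Some ` cnj ` U)"
      unfolding A_eq config using finR finU disj by (intro card_Un_disjoint) auto
    also have "card ((\<lambda>x. Some (complex_of_real x)) ` R \<union> Some ` U) =
        card ((\<lambda>x. Some (complex_of_real x)) ` R) + card (Some ` U)"
      using finR finU disj by (intro card_Un_disjoint) auto
    also have "card ((\<lambda>x. Some (complex_of_real x)) ` R) = k"
      unfolding k_def by (intro card_image) (simp add: inj_on_def)
    also have "card (Some ` U) = h" by (simp add: h_def card_image)
    also have "card (Some ` cnj ` U) = h" by (simp add: h_def card_image inj_on_def)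
    finally show ?thesis by simp
  qed
  then show ?thesis
    using r upper A_eq unfolding card_fixed[symmetric] by (intro that)
qed

text \<open>The map \<open>1 / (z - x)\<close> with \<open>x\<close> real commutes with conjugation; \<open>x\<close> is chosen outside \<open>A\<close>.\<close>
lemma real_moebius_off_infinity:
  assumes A: "finite A" "conjugation ` A = A"
  obtains N where "N \<in> Moeb" "None \<notin> N ` A" "conjugation ` N ` A = N ` A"
    "card {x \<in> N ` A. conjugation x = x} = card {x \<in> A. conjugation x = x}"
proof -
  have "finite {x. Some (complex_of_real x) \<in> A}"
  proof -
    have "inj (\<lambda>x. Some (complex_of_real x))" by (simp add: inj_def)
    from finite_vimageI[OF A(1) this] show ?thesis by (simp add: vimage_def)
  qed
  then obtain x where x: "Some (complex_of_real x) \<notin> A"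
    using ex_new_if_finite[OF infinite_UNIV_char_0] by blast
  define N where "N = moebius_map 0 1 1 (- complex_of_real x)"
  have N: "N \<in> Moeb" unfolding N_def by (rule MoebI) simp
  have "N p = None \<longleftrightarrow> p = Some (complex_of_real x)" for p
    by (cases p) (auto simp: N_def moebius_map_def)
  then have off: "None \<notin> N ` A" using x by (metis imageE)
  have comm: "conjugation (N p) = N (conjugation p)" for p
    using fun_cong[OF conjugation_moebius_map[of 0 1 1 "- complex_of_real x"], of p] by (simp add: N_def)
  have "conjugation ` N ` A = N ` conjugation ` A" by (simp add: image_image comm)
  then have inv: "conjugation ` N ` A = N ` A" using A(2) by simp
  have "{x \<in> N ` A. conjugation x = x} = N ` {x \<in> A. conjugation x = x}"
    using Moeb_inj[OF N] by (auto simp: comm inj_eq)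
  then have "card {x \<in> N ` A. conjugation x = x} = card {x \<in> A. conjugation x = x}"
    using Moeb_inj[OF N] by (simp add: card_image inj_on_subset)
  then show ?thesis by (rule that[OF N off inv])
qed

theorem conjugation_invariant_connected:
  fixes g :: nat
  assumes A: "card A = 2 * g + 2" "conjugation ` A = A"
    and B: "card B = 2 * g + 2" "conjugation ` B = B"
    and same: "card {x \<in> A. conjugation x = x} = card {x \<in> B. conjugation x = x}"
  shows "connected_component_of (subtopology (hyperelliptic_moduli g) (real_locus g))
    (moduli_class A) (moduli_class B)"
proof -
  have finA: "finite A" and finB: "finite B" using A B by (auto intro: card_ge_0_finite)
  obtain M where M: "M \<in> Moeb" "None \<notin> M ` A" "conjugation ` M ` A = M ` A"
    "card {x \<in> M ` A. conjugation x = x} = card {x \<in> A. conjugation x = x}"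
    using real_moebius_off_infinity[OF finA A(2)] .
  obtain N where N: "N \<in> Moeb" "None \<notin> N ` B" "conjugation ` N ` B = N ` B"
    "card {x \<in> N ` B. conjugation x = x} = card {x \<in> B. conjugation x = x}"
    using real_moebius_off_infinity[OF finB B(2)] .
  define k where "k = card {x \<in> A. conjugation x = x}"
  obtain h r u where A': "real_ordered k r" "upper_config h u" "M ` A = conj_config k h r u"
    "card (M ` A) = k + 2 * h"
    using conjugation_invariant_finite_part[OF finite_imageI[OF finA] M(3,2),
        unfolded M(4), folded k_def] .
  obtain h' s v where B': "real_ordered k s" "upper_config h' v" "N ` B = conj_config k h' s v"
    "card (N ` B) = k + 2 * h'"
    using conjugation_invariant_finite_part[OF finite_imageI[OF finB] N(3,2),
        unfolded N(4), folded same, folded k_def] .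
  have "card (M ` A) = 2 * g + 2" "card (N ` B) = 2 * g + 2"
    using A(1) B(1) Moeb_inj[OF M(1)] Moeb_inj[OF N(1)] by (simp_all add: card_image inj_on_subset)
  then have n: "2 * g + 2 = k + 2 * h" "h' = h" using A'(4) B'(4) by simp_all
  have "connected_component_of (subtopology (hyperelliptic_moduli g) (real_locus g))
    (moduli_class (M ` A)) (moduli_class (N ` B))"
    using conj_config_connected[OF n(1) A'(1) B'(1) A'(2) B'(2)[unfolded n(2)]]
    unfolding A'(3) B'(3) n(2) .
  then show ?thesis by (simp add: moduli_class_image M(1) N(1))
qed

section \<open>Sets invariant under the antipodal map\<close>

text \<open>A pair of antipodal points is represented by its member in the closed unit disc, which is finite even if
the pair is \<open>0, \<infinity>\<close>.\<close>
definition disc_config :: "nat \<Rightarrow> (nat \<Rightarrow> complex) \<Rightarrow> complex option set" where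
  "disc_config h u = (\<lambda>j. Some (u j)) ` {..<h} \<union> (\<lambda>j. antipodal (Some (u j))) ` {..<h}"

lemma antipodal_disc_config: "antipodal ` disc_config h u = disc_config h u"
proof -
  have "antipodal (antipodal p) = p" for p using fun_cong[OF antipodal_involution, of p] by simp
  then show ?thesis unfolding disc_config_def image_Un image_image by auto
qed

lemma antipodal_inj: "inj antipodal"
  using antipodal_involution by (metis inj_on_id inj_on_imageI2)

lemma antipodal_outside_disc:
  assumes "norm z < 1" "norm w < 1"
  shows "antipodal (Some z) \<noteq> Some w"
proof (cases "z = 0")
  case False
  show ?thesis
  proof
    assume "antipodal (Some z) = Some w"
    then have "w = - 1 / cnj z" using False by (simp add: antipodal_apply)
    then have "norm w * norm z = 1" using False by (simp add: norm_divide)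
    moreover have "norm w * norm z < 1 * 1"
      using assms by (intro mult_strict_mono') auto
    ultimately show False by simp
  qed
qed (simp add: antipodal_apply)

text \<open>The points of \<open>disc_config h u\<close> as an indexed family, in the form required by \<open>connectedin_moving_points\<close>.\<close>
definition disc_family :: "(nat \<Rightarrow> complex) \<Rightarrow> nat \<times> bool \<Rightarrow> complex option" where
  "disc_family u = (\<lambda>(j, c). if c then Some (u j) else antipodal (Some (u j)))"

lemma disc_family_image: "disc_family u ` ({..<h} \<times> UNIV) = disc_config h u"
proof -
  have "{..<h} \<times> (UNIV :: bool set) = (\<lambda>j. (j, True)) ` {..<h} \<union> (\<lambda>j. (j, False)) ` {..<h}"
    by (auto simp: image_iff)
  then show ?thesis
    unfolding disc_family_def disc_config_def by (simp add: image_Un image_image)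
qed

text \<open>For points in the open disc, whose antipodes lie outside the closed disc, no collision is possible except between
the points \<open>u j\<close> themselves.\<close>
lemma disc_family_inj:
  assumes "\<And>j. j < h \<Longrightarrow> norm (u j) < 1" "inj_on u {..<h}"
  shows "inj_on (disc_family u) ({..<h} \<times> UNIV)"
proof (rule inj_onI)
  fix x y assume xy: "x \<in> {..<h} \<times> (UNIV :: bool set)" "y \<in> {..<h} \<times> (UNIV :: bool set)"
    "disc_family u x = disc_family u y"
  obtain i c where x: "x = (i, c)" by (cases x)
  obtain j d where y: "y = (j, d)" by (cases y)
  have ij: "i < h" "j < h" using xy x y by auto
  have inju: "i = j" if "u i = u j" using inj_onD[OF assms(2) that] ij by simp
  have "antipodal (Some (u i)) \<noteq> Some (u j)" "antipodal (Some (u j)) \<noteq> Some (u i)"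
    using antipodal_outside_disc assms(1) ij by blast+
  moreover have "u i = u j" if "antipodal (Some (u i)) = antipodal (Some (u j))"
    using injD[OF antipodal_inj that] by simp
  ultimately show "x = y"
    using xy(3) inju unfolding x y disc_family_def by (cases c; cases d) auto
qed

lemma disc_family_connected:
  fixes g :: nat and a :: "'t::topological_space \<Rightarrow> nat \<Rightarrow> complex"
  assumes D: "connected D" and n: "2 * g + 2 = 2 * h"
    and cont: "\<And>j. j < h \<Longrightarrow> continuous_on D (\<lambda>t. a t j)"
    and inj: "\<And>t. t \<in> D \<Longrightarrow> inj_on (disc_family (a t)) ({..<h} \<times> UNIV)"
    and pq: "p \<in> D" "q \<in> D"
  shows "connected_component_of (subtopology (hyperelliptic_moduli g) (real_locus g))
    (moduli_class (disc_config h (a p))) (moduli_class (disc_config h (a q)))"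
proof -
  define I where "I = {..<h} \<times> (UNIV :: bool set)"
  have finI: "finite I" and cardI: "card I = 2 * g + 2" using n by (simp_all add: I_def)
  note image = disc_family_image[of _ h, folded I_def] and inj' = inj[folded I_def]
  have "continuous_map (top_of_set D) riemann_sphere (\<lambda>t. disc_family (a t) i)" if i: "i \<in> I" for i
  proof -
    obtain j c where jc: "i = (j, c)" by (cases i)
    have 1: "continuous_map (top_of_set D) riemann_sphere (\<lambda>t. Some (a t j))"
      using cont i jc by (intro continuous_map_Some_comp) (auto simp: I_def)
    have "continuous_map riemann_sphere riemann_sphere antipodal"
      unfolding antipodal_def
      by (intro continuous_map_compose[OF continuous_map_conjugation] continuous_map_Moeb MoebI) simp
    from continuous_map_compose[OF 1 this]
    have 2: "continuous_map (top_of_set D) riemann_sphere (\<lambda>t. antipodal (Some (a t j)))"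
      by (simp add: comp_def)
    show ?thesis using 1 2 by (cases c) (simp_all add: jc disc_family_def)
  qed
  then have "connectedin (hyperelliptic_moduli g) ((\<lambda>t. moduli_class (disc_family (a t) ` I)) ` D)"
    unfolding hyperelliptic_moduli_def
    by (intro connectedin_moving_points[OF D cardI finI] inj')
  moreover have "(\<lambda>t. moduli_class (disc_family (a t) ` I)) ` D \<subseteq> real_locus g"
  proof
    fix c assume "c \<in> (\<lambda>t. moduli_class (disc_family (a t) ` I)) ` D"
    then obtain t where t: "t \<in> D" "c = moduli_class (disc_family (a t) ` I)" by blast
    have "card (disc_family (a t) ` I) = 2 * g + 2" using card_image[OF inj'[OF t(1)]] cardI by simp
    moreover have "antipodal ` disc_family (a t) ` I = disc_family (a t) ` I"
      unfolding image by (rule antipodal_disc_config)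
    ultimately show "c \<in> real_locus g" unfolding real_locus_eq t(2) by blast
  qed
  ultimately show ?thesis
    using pq unfolding image by (intro connected_component_ofI) auto
qed

text \<open>Of two antipodal points on the unit circle the one with positive imaginary part, or \<open>1\<close>, is taken.\<close>
lemma antipodal_invariant_representatives:
  assumes A: "finite A" "antipodal ` A = A"
  obtains h u where "A = disc_config h u" "\<And>j. j < h \<Longrightarrow> norm (u j) \<le> 1" "inj_on u {..<h}"
    "card A = 2 * h"
proof -
  define U where "U = {z. Some z \<in> A \<and> (norm z < 1 \<or> norm z = 1 \<and> (Im z > 0 \<or> z = 1))}"
  have inv: "antipodal (antipodal p) = p" for p using fun_cong[OF antipodal_involution, of p] by simp
  have aA: "antipodal p \<in> A" if "p \<in> A" for p using A(2) that by blast
  have finU: "finite U"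
  proof -
    have "finite {z. Some z \<in> A}" using finite_vimageI[OF A(1) inj_Some] by (simp add: vimage_def)
    then show ?thesis by (rule rev_finite_subset) (auto simp: U_def)
  qed
  have unit: "antipodal (Some z) = Some (- z)" if "norm z = 1" for z
  proof -
    have "z * cnj z = 1" using complex_norm_square[of z] that by simp
    moreover have "z \<noteq> 0" using that by auto
    ultimately have "- 1 / cnj z = - z" by (simp add: field_simps)
    then show ?thesis using \<open>z \<noteq> 0\<close> by (simp add: antipodal_apply)
  qed
  have cover: "p \<in> Some ` U \<or> antipodal p \<in> Some ` U" if p: "p \<in> A" for p
  proof (cases p)
    case None
    then have "0 \<in> U" using aA[OF p] by (simp add: U_def antipodal_apply)
    then show ?thesis using None by (simp add: antipodal_apply)
  next
    case (Some z)
    consider "norm z < 1" | "norm z > 1" | "norm z = 1" by linarith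
    then show ?thesis
    proof cases
      case 1
      then show ?thesis using p Some by (simp add: U_def)
    next
      case 2
      then have z: "z \<noteq> 0" by auto
      then have eq: "antipodal p = Some (- 1 / cnj z)" using Some by (simp add: antipodal_apply)
      have "norm (- 1 / cnj z) < 1" using 2 z by (simp add: norm_divide)
      then have "- 1 / cnj z \<in> U" using aA[OF p] eq by (simp add: U_def)
      then show ?thesis unfolding eq by blast
    next
      case 3
      have eq: "antipodal p = Some (- z)" using unit[OF 3] Some by simp
      have memb: "Some z \<in> A" "Some (- z) \<in> A" using p aA[OF p] Some eq by simp_all
      consider "Im z > 0" | "Im z < 0" | "Im z = 0" by linarith
      then have "z \<in> U \<or> - z \<in> U"
      proof cases
        case 3
        then have "z = 1 \<or> z = - 1"
          using \<open>norm z = 1\<close> by (auto simp: cmod_eq_Re complex_eq_iff)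
        then show ?thesis using memb by (auto simp: U_def)
      qed (use memb 3 in \<open>simp_all add: U_def\<close>)
      then show ?thesis using eq Some by auto
    qed
  qed
  have A_eq: "A = Some ` U \<union> antipodal ` Some ` U"
  proof (intro equalityI subsetI)
    fix p assume "p \<in> A"
    then show "p \<in> Some ` U \<union> antipodal ` Some ` U"
      using cover[of p] inv[of p] by (metis UnI1 UnI2 imageI)
  next
    fix p assume "p \<in> Some ` U \<union> antipodal ` Some ` U"
    then show "p \<in> A" using aA by (auto simp: U_def)
  qed
  have no_common: False if zw: "z \<in> U" "w \<in> U" "antipodal (Some w) = Some z" for z w
  proof -
    have le: "norm z \<le> 1" "norm w \<le> 1" using zw by (auto simp: U_def)
    have w0: "w \<noteq> 0" using zw(3) antipodal_apply(2) by auto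
    then have "z = - 1 / cnj w" using zw(3) by (simp add: antipodal_apply)
    then have prod: "norm z * norm w = 1" using w0 by (simp add: norm_divide)
    have "norm w = 1"
    proof (rule ccontr)
      assume "norm w \<noteq> 1"
      then have "norm w < 1" using le by simp
      then have "norm z * norm w < 1" using le(1) mult_right_mono[of "norm z" 1 "norm w"]
        by simp
      with prod show False by simp
    qed
    then have "w = - z" using unit zw(3) by auto
    moreover from this have "norm z = 1" using \<open>norm w = 1\<close> by simp
    then have "Im z > 0 \<or> z = 1" "Im w > 0 \<or> w = 1"
      using zw(1,2) \<open>norm w = 1\<close> by (simp_all add: U_def)
    ultimately show False by (auto simp: complex_eq_iff)
  qed
  have disj: "Some ` U \<inter> antipodal ` Some ` U = {}"
  proof (rule equals0I)
    fix p assume "p \<in> Some ` U \<inter> antipodal ` Some ` U"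
    then show False by (elim IntE imageE) (metis no_common)
  qed
  define h where "h = card U"
  obtain u where u: "bij_betw u {..<h} U"
    using bij_betw_from_nat_into_finite[OF finU] by (auto simp: h_def)
  have uU: "u ` {..<h} = U" and inju: "inj_on u {..<h}" using u by (auto simp: bij_betw_def)
  have "A = disc_config h u"
    unfolding A_eq disc_config_def uU[symmetric] by (simp only: image_image)
  moreover have "norm (u j) \<le> 1" if "j < h" for j
  proof -
    have "u j \<in> U" using uU that by blast
    then show ?thesis by (auto simp: U_def)
  qed
  moreover have "card A = 2 * h"
  proof -
    have "card A = card (Some ` U) + card (antipodal ` Some ` U)"
      using finU disj unfolding A_eq by (intro card_Un_disjoint) auto
    also have "card (antipodal ` Some ` U) = card (Some ` U)"
      by (intro card_image inj_on_subset[OF antipodal_inj]) simp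
    also have "card (Some ` U) = h" by (simp add: h_def card_image)
    finally show ?thesis by simp
  qed
  ultimately show ?thesis using inju by (intro that)
qed

definition disc_base :: "nat \<Rightarrow> nat \<Rightarrow> complex" where
  "disc_base h j = complex_of_real (real j / real (Suc h))"

lemma disc_base: "j < h \<Longrightarrow> norm (disc_base h j) < 1" "inj_on (disc_base h) {..<h}"
  by (auto simp: disc_base_def inj_on_def norm_divide simp del: of_nat_Suc)

text \<open>The representatives may lie on the unit circle, where they could collide with antipodes of others. They
are scaled into the open disc, which creates no collision, and then moved along complex lines in the disc to fixed
positions.\<close>
theorem antipodal_invariant_connected:
  fixes g :: nat
  assumes A: "card A = 2 * g + 2" "antipodal ` A = A"
  shows "connected_component_of (subtopology (hyperelliptic_moduli g) (real_locus g))
    (moduli_class A) (moduli_class (disc_config (g + 1) (disc_base (g + 1))))"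
proof -
  have finA: "finite A" using A by (auto intro: card_ge_0_finite)
  obtain h u where u: "A = disc_config h u" "\<And>j. j < h \<Longrightarrow> norm (u j) \<le> 1" "inj_on u {..<h}"
    "card A = 2 * h"
    by (rule antipodal_invariant_representatives[OF finA A(2)]) (rule that)
  have n: "2 * g + 2 = 2 * h" and h: "h = g + 1" using u(4) A(1) by simp_all
  define v where "v = disc_base h"
  have v: "\<And>j. j < h \<Longrightarrow> norm (v j) < 1" "inj_on v {..<h}" using disc_base by (auto simp: v_def)
  \<comment> \<open>any scaling factor strictly between 0 and 1 would do\<close>
  define w where "w j = u j / 2" for j
  have w: "\<And>j. j < h \<Longrightarrow> norm (w j) < 1" "inj_on w {..<h}"
    using u(2,3) by (auto simp: w_def inj_on_def norm_divide) fastforce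
  have first: "connected_component_of (subtopology (hyperelliptic_moduli g) (real_locus g))
    (moduli_class (disc_config h u)) (moduli_class (disc_config h w))"
  proof -
    define a where "a s j = complex_of_real s * u j" for s :: real and j
    have ends: "a 1 = u" "a (1 / 2) = w" by (auto simp: a_def w_def)
    have "connected_component_of (subtopology (hyperelliptic_moduli g) (real_locus g))
      (moduli_class (disc_config h (a 1))) (moduli_class (disc_config h (a (1 / 2))))"
    proof (rule disc_family_connected[where D = "{1 / 2..1}"])
      show "inj_on (disc_family (a s)) ({..<h} \<times> UNIV)" if s: "s \<in> {1 / 2..1}" for s
      proof (cases "s = 1")
        case True
        have "card (disc_family u ` ({..<h} \<times> UNIV)) = card ({..<h} \<times> (UNIV :: bool set))"
          unfolding disc_family_image using u(1,4) by simp
        then show ?thesis unfolding True ends(1) by (intro eq_card_imp_inj_on) auto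
      next
        case False
        then have s: "0 < s" "s < 1" using s by auto
        show ?thesis
        proof (rule disc_family_inj)
          show "norm (a s j) < 1" if "j < h" for j
          proof -
            have "s * norm (u j) \<le> s * 1" using u(2)[OF that] s by (intro mult_left_mono) auto
            then have "s * norm (u j) < 1" using s by linarith
            then show ?thesis using s by (simp add: a_def norm_mult)
          qed
          show "inj_on (a s) {..<h}" using u(3) s by (auto simp: a_def inj_on_def)
        qed
      qed
    qed (use n in \<open>auto simp: a_def intro!: continuous_intros\<close>)
    then show ?thesis unfolding ends .
  qed
  have second: "connected_component_of (subtopology (hyperelliptic_moduli g) (real_locus g))
    (moduli_class (disc_config h w)) (moduli_class (disc_config h v))"
  proof -
    define a where "a t j = w j + t * (v j - w j)" for t j
    have ends: "a 0 = w" "a 1 = v" by (auto simp: a_def)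
    define S where "S = {t. \<forall>j<h. norm (a t j) < 1}"
    have S: "S = (\<Inter>j\<in>{..<h}. {t. norm (a t j) < 1})" by (auto simp: S_def)
    have "open {t. norm (a t j) < 1}" for j
      unfolding a_def by (intro open_Collect_less continuous_intros)
    then have openS: "open S" unfolding S by (intro open_INT) auto
    have "convex {t. norm (a t j) < 1}" for j
    proof (rule convexI)
      fix x y :: complex and p q :: real
      assume *: "x \<in> {t. norm (a t j) < 1}" "y \<in> {t. norm (a t j) < 1}" "0 \<le> p" "0 \<le> q" "p + q = 1"
      have "a (p *\<^sub>R x + q *\<^sub>R y) j = p *\<^sub>R a x j + q *\<^sub>R a y j"
      proof -
        have "w j = complex_of_real (p + q) * w j" using *(5) by simp
        then show ?thesis by (simp add: a_def scaleR_conv_of_real algebra_simps)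
      qed
      moreover have "p *\<^sub>R a x j + q *\<^sub>R a y j \<in> ball 0 1"
        using * by (intro convexD[OF convex_ball]) auto
      ultimately show "p *\<^sub>R x + q *\<^sub>R y \<in> {t. norm (a t j) < 1}" by simp
    qed
    then have convexS: "convex S" unfolding S by (intro convex_INT) auto
    define D where "D = {t \<in> S. inj_on (a t) {..<h}}"
    have D: "connected D"
      unfolding D_def a_def using w(2) openS convexS by (intro connected_injective_parameters)
    have D_iff: "t \<in> D \<longleftrightarrow> (\<forall>j<h. norm (a t j) < 1) \<and> inj_on (a t) {..<h}" for t
      by (simp add: D_def S_def)
    have "connected_component_of (subtopology (hyperelliptic_moduli g) (real_locus g))
      (moduli_class (disc_config h (a 0))) (moduli_class (disc_config h (a 1)))"
    proof (rule disc_family_connected[OF D n])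
      show "continuous_on D (\<lambda>t. a t j)" for j unfolding a_def by (intro continuous_intros)
      show "inj_on (disc_family (a t)) ({..<h} \<times> UNIV)" if "t \<in> D" for t
        using that unfolding D_iff by (intro disc_family_inj) auto
      show "0 \<in> D" "1 \<in> D" unfolding D_iff ends using v w by auto
    qed
    then show ?thesis unfolding ends .
  qed
  show ?thesis
    using connected_component_of_trans[OF first second] unfolding u(1) v_def h .
qed

section \<open>Linking the families of symmetric real sets\<close>

text \<open>Points on the real line and the imaginary line, symmetric about \<open>0\<close>. Such a set is invariant
under the reflections in both lines, and \<open>z \<mapsto> \<i> z\<close> exchanges the roles of the lines.\<close>
definition cross :: "complex option set \<Rightarrow> nat \<Rightarrow> nat \<Rightarrow> complex option set" where
  "cross E a b = E \<union> (\<lambda>x. Some (of_int x)) ` ({- int a..int a} - {0}) \<union>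
     (\<lambda>x. Some (\<i> * of_int x)) ` ({- int b..int b} - {0})"

lemma cross_properties:
  assumes E: "E = {} \<or> E = {None, Some 0}"
  shows "card (cross E a b) = card E + 2 * a + 2 * b"
    and "conjugation ` cross E a b = cross E a b"
    and "card {x \<in> cross E a b. conjugation x = x} = card E + 2 * a"
    and "rotation \<i> ` cross E a b = cross E b a"
proof -
  define J where "J a = {- int a..int a} - {0}" for a
  define X where "X a = (\<lambda>x. Some (complex_of_int x)) ` J a" for a
  define Y where "Y b = (\<lambda>x. Some (\<i> * complex_of_int x)) ` J b" for b
  have cross: "cross E a b = E \<union> X a \<union> Y b" for a b by (simp add: cross_def X_def Y_def J_def)
  have neg: "- x \<in> J a" if "x \<in> J a" for x a using that by (auto simp: J_def)
  have finJ: "finite (J a)" for a by (simp add: J_def)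
  have cardJ: "card (J a) = 2 * a" for a
    unfolding J_def by (subst card_Diff_subset) auto
  have nz: "x \<noteq> 0" if "x \<in> J a" for x a using that by (simp add: J_def)
  have finE: "finite E" using E by auto
  have disj: "E \<inter> X a = {}" "(E \<union> X a) \<inter> Y b = {}"
  proof -
    show "E \<inter> X a = {}" using E nz by (auto simp: X_def)
    have "E \<inter> Y b = {}" using E nz by (auto simp: Y_def)
    moreover have "X a \<inter> Y b = {}"
    proof (rule ccontr)
      assume "X a \<inter> Y b \<noteq> {}"
      then obtain x y where xy: "x \<in> J a" "complex_of_int x = \<i> * complex_of_int y"
        by (auto simp: X_def Y_def)
      then have "Re (complex_of_int x) = 0" by simp
      then show False using nz[OF xy(1)] by simp
    qed
    ultimately show "(E \<union> X a) \<inter> Y b = {}" by blast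
  qed
  have finXY: "finite (X a)" "finite (Y b)" by (simp_all add: X_def Y_def finJ)
  have cardX: "card (X a) = 2 * a" and cardY: "card (Y b) = 2 * b"
    unfolding X_def Y_def by (subst card_image; simp add: inj_on_def cardJ)+
  have cardEX: "card (E \<union> X a) = card E + 2 * a"
    using finE finXY disj(1) cardX by (simp add: card_Un_disjoint)
  then show "card (cross E a b) = card E + 2 * a + 2 * b"
    unfolding cross using finE finXY disj(2) cardY by (simp add: card_Un_disjoint)
  have conjE: "conjugation p = p" if "p \<in> E" for p using that E by auto
  have conjX: "conjugation p = p" if "p \<in> X a" for p using that by (auto simp: X_def)
  have conjY: "conjugation p \<in> Y b \<and> conjugation p \<noteq> p" if "p \<in> Y b" for p
  proof -
    from that obtain y where y: "y \<in> J b" "p = Some (\<i> * complex_of_int y)"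
      unfolding Y_def by blast
    then have "conjugation p = Some (\<i> * complex_of_int (- y))" by simp
    moreover have "Some (\<i> * complex_of_int (- y)) \<in> Y b"
      unfolding Y_def using neg[OF y(1)] by (rule imageI)
    moreover have "\<i> * complex_of_int (- y) \<noteq> \<i> * complex_of_int y"
      using nz[OF y(1)] by simp
    ultimately show ?thesis using y(2) by simp
  qed
  show "conjugation ` cross E a b = cross E a b"
  proof (rule image_eq_self)
    show "finite (cross E a b)" unfolding cross using finE finXY by simp
    show "inj conjugation" by (rule option.inj_map) (simp add: inj_def)
    show "conjugation ` cross E a b \<subseteq> cross E a b"
      unfolding cross using conjE conjX conjY by (auto simp del: not_None_eq)
  qed
  have "{x \<in> cross E a b. conjugation x = x} = E \<union> X a"
    unfolding cross using conjE conjX conjY by blast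
  then show "card {x \<in> cross E a b. conjugation x = x} = card E + 2 * a" using cardEX by simp
  have "rotation \<i> ` E = E"
    using E by (auto simp: moebius_map_affine)
  moreover have "rotation \<i> ` X a = Y a"
    unfolding X_def Y_def image_image by (simp add: moebius_map_affine)
  moreover have "rotation \<i> ` Y b = X b"
  proof -
    have "rotation \<i> (Some (\<i> * complex_of_int y)) = Some (complex_of_int (- y))" for y
      by (simp add: moebius_map_affine flip: mult.assoc)
    then have "rotation \<i> ` Y b = (\<lambda>x. Some (complex_of_int x)) ` uminus ` J b"
      unfolding Y_def image_image by simp
    moreover have "uminus ` J b = J b"
    proof (intro equalityI subsetI)
      fix x assume "x \<in> J b"
      then have "- (- x) \<in> uminus ` J b" using neg by blast
      then show "x \<in> uminus ` J b" by simp
    qed (use neg in auto)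
    ultimately show ?thesis by (simp add: X_def)
  qed
  ultimately show "rotation \<i> ` cross E a b = cross E b a"
    unfolding cross image_Un by blast
qed

lemma conjugation_disc_base: "conjugation ` disc_config h (disc_base h) = disc_config h (disc_base h)"
proof -
  have "conjugation (antipodal (Some (disc_base h j))) = antipodal (Some (disc_base h j))" for j
    by (cases "disc_base h j = 0") (simp_all add: antipodal_apply, simp add: disc_base_def)
  moreover have "conjugation (Some (disc_base h j)) = Some (disc_base h j)" for j
    by (simp add: disc_base_def)
  ultimately show ?thesis unfolding disc_config_def image_Un image_image by simp
qed

text \<open>Let \<open>n = 2 (g + 1)\<close>. The set \<open>?C a\<close> has \<open>2 a\<close> real points, and \<open>2 (g + 1 - a)\<close> of them after exchanging the two
lines; \<open>?D a\<close>, which contains \<open>0\<close> and \<open>\<infinity>\<close>, has \<open>2 (a + 1)\<close> and again \<open>2 (g + 1 - a)\<close>. Hence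
\<open>?C a\<close>, \<open>?D a\<close> and \<open>?C (a + 1)\<close> are joined for all \<open>a\<close>, and any set invariant under conjugation is joined to some
\<open>?C a\<close>. The antipodal family is joined to this chain because its base set is also invariant under
conjugation.\<close>
theorem real_locus_connected: "connectedin (hyperelliptic_moduli g) (real_locus g)"
proof -
  define Y where "Y = subtopology (hyperelliptic_moduli g) (real_locus g)"
  define fixed where "fixed A = card {x \<in> A. conjugation x = x}" for A :: "complex option set"
  let ?C = "\<lambda>a. cross {} a (g + 1 - a)"
  let ?D = "\<lambda>a. cross {None, Some 0} a (g - a)"
  have same: "connected_component_of Y (moduli_class A) (moduli_class B)"
    if "card A = 2 * g + 2" "conjugation ` A = A" "card B = 2 * g + 2" "conjugation ` B = B"
      "fixed A = fixed B" for A B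
    unfolding Y_def using that unfolding fixed_def by (rule conjugation_invariant_connected)
  have rot: "moduli_class (rotation \<i> ` A) = moduli_class A" for A
    by (intro moduli_class_image rotation_Moeb) simp
  have C: "card (?C a) = 2 * g + 2" "conjugation ` ?C a = ?C a" "fixed (?C a) = 2 * a"
    "moduli_class (cross {} (g + 1 - a) a) = moduli_class (?C a)" if "a \<le> g + 1" for a
    using cross_properties[of "{}" a "g + 1 - a"] that rot[of "?C a"] by (simp_all add: fixed_def)
  have C': "card (cross {} (g + 1 - a) a) = 2 * g + 2"
    "conjugation ` cross {} (g + 1 - a) a = cross {} (g + 1 - a) a"
    "fixed (cross {} (g + 1 - a) a) = 2 * (g + 1 - a)" if "a \<le> g + 1" for a
    using cross_properties[of "{}" "g + 1 - a" a] that by (simp_all add: fixed_def)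
  have D: "card (?D a) = 2 * g + 2" "conjugation ` ?D a = ?D a" "fixed (?D a) = 2 * (a + 1)"
    "moduli_class (cross {None, Some 0} (g - a) a) = moduli_class (?D a)" if "a \<le> g" for a
    using cross_properties[of "{None, Some 0}" a "g - a"] that rot[of "?D a"]
    by (simp_all add: fixed_def)
  have D': "card (cross {None, Some 0} (g - a) a) = 2 * g + 2"
    "conjugation ` cross {None, Some 0} (g - a) a = cross {None, Some 0} (g - a) a"
    "fixed (cross {None, Some 0} (g - a) a) = 2 * (g + 1 - a)" if "a \<le> g" for a
    using cross_properties[of "{None, Some 0}" "g - a" a] that by (simp_all add: fixed_def)
  have chain: "connected_component_of Y (moduli_class (?C a)) (moduli_class (?C 0))" if "a \<le> g + 1" for a
    using that
  proof (induction a)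
    case 0
    have "0 \<le> g + 1" by simp
    then show ?case by (intro same C refl)
  next
    case (Suc a)
    then have a: "a \<le> g" "a \<le> g + 1" "Suc a \<le> g + 1" by simp_all
    \<comment> \<open>both have \<open>2 (a + 1)\<close> real points\<close>
    have "connected_component_of Y (moduli_class (?C (Suc a))) (moduli_class (?D a))"
      using C(3)[OF a(3)] D(3)[OF a(1)]
      by (intro same[OF C(1,2)[OF a(3)] D(1,2)[OF a(1)]]) simp
    \<comment> \<open>both have \<open>2 (g + 1 - a)\<close> points on the imaginary line\<close>
    moreover have "connected_component_of Y (moduli_class (?D a)) (moduli_class (?C a))"
      using same[OF D'(1,2)[OF a(1)] C'(1,2)[OF a(2)]] D'(3)[OF a(1)] C'(3)[OF a(2)]
        D(4)[OF a(1)] C(4)[OF a(2)] by simp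
    ultimately show ?case using Suc.IH[OF a(2)] by (meson connected_component_of_trans)
  qed
  have conj_case: "connected_component_of Y (moduli_class A) (moduli_class (?C 0))"
    if A: "card A = 2 * g + 2" "conjugation ` A = A" for A
  proof -
    have finA: "finite A" using A by (auto intro: card_ge_0_finite)
    obtain M where M: "M \<in> Moeb" "None \<notin> M ` A" "conjugation ` M ` A = M ` A"
      "card {x \<in> M ` A. conjugation x = x} = card {x \<in> A. conjugation x = x}"
      using real_moebius_off_infinity[OF finA A(2)] .
    have "\<exists>h. card (M ` A) = fixed A + 2 * h"
      using conjugation_invariant_finite_part[OF finite_imageI[OF finA] M(3,2)]
      unfolding M(4) fixed_def by metis
    then obtain h where h: "card (M ` A) = fixed A + 2 * h" ..
    have "card (M ` A) = 2 * g + 2"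
      using A(1) Moeb_inj[OF M(1)] by (simp add: card_image inj_on_subset)
    with h have a: "g + 1 - h \<le> g + 1" "fixed A = 2 * (g + 1 - h)" by simp_all
    have "connected_component_of Y (moduli_class A) (moduli_class (?C (g + 1 - h)))"
      using a C(3)[OF a(1)] by (intro same[OF A C(1,2)[OF a(1)]]) simp
    then show ?thesis using chain[OF a(1)] by (rule connected_component_of_trans)
  qed
  have base: "card (disc_config (g + 1) (disc_base (g + 1))) = 2 * g + 2"
  proof -
    have "inj_on (disc_family (disc_base (g + 1))) ({..<g + 1} \<times> UNIV)"
      by (intro disc_family_inj disc_base)
    from card_image[OF this] show ?thesis unfolding disc_family_image by simp
  qed
  show ?thesis
  proof (rule connectedin_if_all_connected_to, fold Y_def)
    fix c assume "c \<in> real_locus g"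
    then obtain A where A: "c = moduli_class A" "card A = 2 * g + 2"
      "conjugation ` A = A \<or> antipodal ` A = A"
      unfolding real_locus_eq by blast
    from A(3) show "connected_component_of Y c (moduli_class (?C 0))"
    proof
      assume "conjugation ` A = A"
      then show ?thesis unfolding A(1) by (rule conj_case[OF A(2)])
    next
      assume "antipodal ` A = A"
      then show ?thesis
        using connected_component_of_trans[OF antipodal_invariant_connected[OF A(2), folded Y_def]
            conj_case[OF base conjugation_disc_base]] unfolding A(1) by blast
    qed
  qed
qed

section \<open>Connectivity of the two loci\<close>

theorem corollary1:
  fixes g :: nat
  assumes "g \<ge> 2"
  shows "(3 dvd 2 * g + 1 \<longrightarrow>
            connectedin (hyperelliptic_moduli g) (extra_automorphism_locus g)) \<and>
         (\<not> 3 dvd 2 * g + 1 \<longrightarrow>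
            card (connected_components_of
              (subtopology (hyperelliptic_moduli g) (extra_automorphism_locus g))) = 2) \<and>
         connectedin (hyperelliptic_moduli g) (real_locus g)"
  using extra_automorphism_locus_connectivity[OF assms] real_locus_connected by blast

end
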